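(* Let $(X,\omega)$ be a compact complex Hermitian manifold with $\dim_{\mathbb C}X=n$. For any $C^\infty$ function $\eta:X\to(0,\infty)$ and any $k\in\{0,\dots,2n\}$, the twisted Laplacians $\Delta_\eta,\Delta_{\omega_\eta}:C^\infty_k(X,\mathbb C)\to C^\infty_k(X,\mathbb C)$ are related by $$\Delta_\eta=\theta_\eta\Delta_{\omega_\eta}\theta_\eta^{-1}.$$ In particular, they have the same spectrum, $\mathrm{Spec}(\Delta_\eta)=\mathrm{Spec}(\Delta_{\omega_\eta})$, and for every eigenvalue $\lambda$ the linear map $$E^k_{\Delta_\eta}(\lambda)\ni u\longmapsto\theta_\eta^{-1}u\in E^k_{\Delta_{\omega_\eta}}(\lambda)$$ is an isomorphism between the corresponding eigenspaces.
   Context: $C^\infty_k(X,\mathbb C)$ is the space of smooth $k$-forms. The Hermitian metric is identified with its positive definite $(1,1)$-form $\omega$, normalized so that $\omega=i\sum_j\zeta_j\wedge\bar\zeta_j$ for a local orthonormal coframe of $(1,0)$-forms. $\Lambda=\Lambda_\omega$ is the adjoint (for $\omega$) of $\omega\wedge\cdot$; $[A,B]=AB-(-1)^{ab}BA$ is the graded commutator of operators of degrees $a,b$. $\theta_\eta$ acts on $(p,q)$-forms as multiplication by $\eta^p$ (extended linearly to $k$-forms), $D_\eta=\theta_\eta d\theta_\eta^{-1}$, $D_\eta^\star$ is the formal adjoint of $D_\eta$ for the $L^2$-inner product induced by $\omega$, and $\Delta_\eta=D_\eta D_\eta^\star+D_\eta^\star D_\eta$. Twisted $L^2$-inner product: for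 $(p,q)$-forms, $\langle\langle u,v\rangle\rangle_{\omega_\eta}=\int_X\eta^{-2(n-p)}\langle u,v\rangle_\omega\,dV_\omega$ (different bidegrees being orthogonal); $d^\star_{\omega_\eta}$ is the formal adjoint of $d$ for it. Define $T^\star_\eta:C^\infty_k(X,\mathbb C)\to C^\infty_{k-1}(X,\mathbb C)$ by $T^\star_\eta(\sum_{p+q=k}u^{p,q})=\sum_{p+q=k}T^\star_{p,\eta}(u^{p,q})$ with, on $(p,q)$-forms, $$T^\star_{p,\eta}=\frac1{\eta^{2p}}\Big(d^\star_{\omega_\eta}-2(n-p)\big[\Lambda,\ i(\tfrac1\eta\partial\eta-\eta\bar\partial\eta)\wedge\cdot\big]\Big)\circ\theta_\eta^2.$$ Then $\Delta_{\omega_\eta}:=dT_\eta^\star+T_\eta^\star d$. $E^k_P(\lambda)$ denotes the $\lambda$-eigenspace of an operator $P$ acting on $C^\infty_k(X,\mathbb C)$. *)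

theory Defs
  imports "HOL-Analysis.Analysis" "HOL-Library.Function_Algebras"
begin

section \<open>Smooth functions and Wirtinger derivatives\<close>

fun diff_order_on ::
    "nat \<Rightarrow> 'a::real_normed_vector set \<Rightarrow> ('a \<Rightarrow> 'b::real_normed_vector) \<Rightarrow> bool" where
  "diff_order_on 0 S f \<longleftrightarrow> continuous_on S f"
| "diff_order_on (Suc m) S f \<longleftrightarrow>
     (\<forall>x\<in>S. f differentiable (at x)) \<and>
     (\<forall>v. diff_order_on m S (\<lambda>x. frechet_derivative f (at x) v))"

text \<open>Only used for open sets \<open>S\<close>, in the real sense (also when the spaces are complex).\<close>

definition smooth_on ::
    "'a::real_normed_vector set \<Rightarrow> ('a \<Rightarrow> 'b::real_normed_vector) \<Rightarrow> bool" where
  "smooth_on S f \<longleftrightarrow> (\<forall>m. diff_order_on m S f)"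

text \<open>
  The \<open>2n\<close> complex coordinates \<open>w\<close> on \<open>\<complex>\<^sup>n\<close> are indexed by \<open>'n + 'n\<close>: \<open>Inl j\<close> stands for
  \<open>z\<^sub>j\<close> and \<open>Inr j\<close> for its conjugate; \<open>pd a\<close> is the Wirtinger derivative with respect to
  the coordinate with index \<open>a\<close>.
\<close>

type_synonym 'n cidx = "'n + 'n"

fun coord :: "'n::finite cidx \<Rightarrow> complex^'n \<Rightarrow> complex" where
  "coord (Inl j) z = z $ j"
| "coord (Inr j) z = cnj (z $ j)"

fun pd :: "'n::finite cidx \<Rightarrow> (complex^'n \<Rightarrow> complex) \<Rightarrow> complex^'n \<Rightarrow> complex" where
  "pd (Inl j) f y = (frechet_derivative f (at y) (axis j 1)
                      - \<i> * frechet_derivative f (at y) (axis j \<i>)) / 2"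
| "pd (Inr j) f y = (frechet_derivative f (at y) (axis j 1)
                      + \<i> * frechet_derivative f (at y) (axis j \<i>)) / 2"

section \<open>Complex manifolds\<close>

text \<open>A chart is a pair of its domain and its coordinate map.\<close>

type_synonym ('x, 'n) chart = "'x set \<times> ('x \<Rightarrow> complex^'n)"

abbreviation cdom :: "('x, 'n) chart \<Rightarrow> 'x set" where
  "cdom c \<equiv> fst c"

abbreviation cmap :: "('x, 'n) chart \<Rightarrow> 'x \<Rightarrow> complex^'n" where
  "cmap c \<equiv> snd c"

definition cinv :: "('x, 'n::finite) chart \<Rightarrow> complex^'n \<Rightarrow> 'x" where
  "cinv c = inv_into (cdom c) (cmap c)"

text \<open>The open set in \<open>\<complex>\<^sup>n\<close> onto which the chart maps its domain.\<close>

definition cimg :: "('x, 'n::finite) chart \<Rightarrow> (complex^'n) set" where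
  "cimg c = cmap c ` cdom c"

definition transition ::
    "('x, 'n::finite) chart \<Rightarrow> ('x, 'n) chart \<Rightarrow> complex^'n \<Rightarrow> complex^'n" where
  "transition c c' = cmap c' \<circ> cinv c"

definition holomorphic_map_on ::
    "(complex^'n::finite) set \<Rightarrow> (complex^'n \<Rightarrow> complex^'n) \<Rightarrow> bool" where
  "holomorphic_map_on S f \<longleftrightarrow>
     (\<forall>j. smooth_on S (\<lambda>y. f y $ j)) \<and> (\<forall>j k. \<forall>y\<in>S. pd (Inr k) (\<lambda>z. f z $ j) y = 0)"

definition complex_manifold :: "'x topology \<Rightarrow> ('x, 'n::finite) chart set \<Rightarrow> bool" where
  "complex_manifold X A \<longleftrightarrow>
     Hausdorff_space X \<and> second_countable X \<and>
     (\<Union>c\<in>A. cdom c) = topspace X \<and>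
     (\<forall>c\<in>A. openin X (cdom c) \<and> open (cimg c) \<and>
        homeomorphic_map (subtopology X (cdom c)) (top_of_set (cimg c)) (cmap c)) \<and>
     (\<forall>c\<in>A. \<forall>c'\<in>A. holomorphic_map_on (cmap c ` (cdom c \<inter> cdom c')) (transition c c'))"

section \<open>Exterior algebra at a point\<close>

text \<open>
  An element of the complexified exterior algebra of \<open>\<complex>\<^sup>n\<close> is given by its skew-symmetric
  components: \<open>t\<close> stands for the sum over all \<open>k\<close> of
  \<open>1/k! \<Sum> t [a\<^sub>1,\<dots>,a\<^sub>k] dw\<^sub>a\<^sub>1 \<and> \<dots> \<and> dw\<^sub>a\<^sub>k\<close>, the sum ranging over all index lists of
  length \<open>k\<close>. The degree of a component is thus the length of its index list, and skew
  symmetry makes all components of degree above \<open>2n\<close> vanish.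
\<close>

type_synonym 'n tensor = "'n cidx list \<Rightarrow> complex"

definition skew :: "'n tensor \<Rightarrow> bool" where
  "skew t \<longleftrightarrow>
     (\<forall>as i j. i < j \<and> j < length as \<longrightarrow> t (as[i := as ! j, j := as ! i]) = - t as)"

text \<open>
  The sum is over the sets \<open>S\<close> of positions that go to the first factor (shuffles). The
  normalization is \<open>(\<alpha> \<and> \<beta>)(v, w) = \<alpha>(v) \<beta>(w) - \<alpha>(w) \<beta>(v)\<close> for \<open>1\<close>-forms.
\<close>

definition wedge :: "'n tensor \<Rightarrow> 'n tensor \<Rightarrow> 'n tensor" where
  "wedge s t as =
     (\<Sum>S\<in>Pow {..<length as}.
        (-1) ^ card {(i, j). i < j \<and> j \<in> S \<and> i \<notin> S} * s (nths as S) * t (nths as (- S)))"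

text \<open>The numbers of holomorphic and of antiholomorphic indices, i.e. the bidegree \<open>(p,q)\<close>.\<close>

definition hdeg :: "'n cidx list \<Rightarrow> nat" where
  "hdeg as = length (filter isl as)"

definition adeg :: "'n cidx list \<Rightarrow> nat" where
  "adeg as = length (filter (\<lambda>a. \<not> isl a) as)"

text \<open>
  The coefficients \<open>h\<close> of a \<open>(1,1)\<close>-form \<open>\<omega> = \<i> \<Sum> h\<^sub>j\<^sub>k dz\<^sub>j \<and> d(cnj z\<^sub>k)\<close>.
\<close>

definition hmat :: "'n::finite tensor \<Rightarrow> complex^'n^'n" where
  "hmat w = (\<chi> j k. - \<i> * w [Inl j, Inr k])"

definition pos_11 :: "'n::finite tensor \<Rightarrow> bool" where
  "pos_11 w \<longleftrightarrow>
     (\<forall>as. w as \<noteq> 0 \<longrightarrow> hdeg as = 1 \<and> adeg as = 1) \<and>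
     (\<forall>v::complex^'n. v \<noteq> 0 \<longrightarrow>
        (let s = (\<Sum>j\<in>UNIV. \<Sum>k\<in>UNIV. hmat w $ j $ k * v $ j * cnj (v $ k))
         in s \<in> \<real> \<and> 0 < Re s))"

text \<open>
  The Hermitian products of the coordinate \<open>1\<close>-forms \<open>dw\<close>. If
  \<open>\<omega> = \<i> \<Sum> \<zeta>\<^sub>l \<and> cnj \<zeta>\<^sub>l\<close> with \<open>\<zeta> = B dz\<close>, then \<open>h = B\<^sup>T cnj B\<close>, and the coframe
  \<open>\<zeta>\<close> is orthonormal if and only if \<open>\<langle>dz\<^sub>j, dz\<^sub>k\<rangle>\<close> is the \<open>(k,j)\<close> entry of \<open>h\<^sup>-\<^sup>1\<close>.
\<close>

fun cometric :: "'n::finite tensor \<Rightarrow> 'n cidx \<Rightarrow> 'n cidx \<Rightarrow> complex" where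
  "cometric w (Inl j) (Inl k) = matrix_inv (hmat w) $ k $ j"
| "cometric w (Inr j) (Inr k) = matrix_inv (hmat w) $ j $ k"
| "cometric w (Inl j) (Inr k) = 0"
| "cometric w (Inr j) (Inl k) = 0"

text \<open>
  The induced Hermitian product on the exterior algebra, for which
  \<open>\<langle>\<alpha>\<^sub>1 \<and> \<dots> \<and> \<alpha>\<^sub>k, \<beta>\<^sub>1 \<and> \<dots> \<and> \<beta>\<^sub>k\<rangle> = det \<langle>\<alpha>\<^sub>i, \<beta>\<^sub>j\<rangle>\<close>, different degrees (and, the
  cometric being block diagonal, different bidegrees) being orthogonal.
\<close>

definition tip :: "'n::finite tensor \<Rightarrow> 'n tensor \<Rightarrow> 'n tensor \<Rightarrow> complex" where
  "tip w s t =
     (\<Sum>k\<le>2 * CARD('n).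
        (\<Sum>as | length as = k. \<Sum>bs | length bs = k.
           (\<Prod>m<k. cometric w (as ! m) (bs ! m)) * s as * cnj (t bs)) / fact k)"

section \<open>Differential forms\<close>

text \<open>
  A form is given by its components in each chart of the atlas, as functions of the
  coordinates. So that forms that agree are equal, all components that have no meaning
  (outside the atlas, outside the image of the chart, in the wrong degree) are \<open>0\<close>.
\<close>

type_synonym ('x, 'n) form = "('x, 'n) chart \<Rightarrow> complex^'n \<Rightarrow> 'n tensor"

definition jac ::
    "('x, 'n::finite) chart \<Rightarrow> ('x, 'n) chart \<Rightarrow> complex^'n \<Rightarrow> 'n cidx \<Rightarrow> 'n cidx \<Rightarrow> complex" where
  "jac c c' y b a = pd a (\<lambda>z. coord b (transition c c' z)) y"

definition forms :: "('x, 'n::finite) chart set \<Rightarrow> nat \<Rightarrow> ('x, 'n) form set" where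
  "forms A k = {u.
     (\<forall>c y as. \<not> (c \<in> A \<and> y \<in> cimg c \<and> length as = k) \<longrightarrow> u c y as = 0) \<and>
     (\<forall>c y. skew (u c y)) \<and>
     (\<forall>c\<in>A. \<forall>as. smooth_on (cimg c) (\<lambda>y. u c y as)) \<and>
     (\<forall>c\<in>A. \<forall>c'\<in>A. \<forall>x\<in>cdom c \<inter> cdom c'. \<forall>as.
        u c (cmap c x) as =
          (\<Sum>bs | length bs = length as.
             (\<Prod>m<length as. jac c c' (cmap c x) (bs ! m) (as ! m)) * u c' (cmap c' x) bs))}"

definition cscale :: "complex \<Rightarrow> ('x, 'n) form \<Rightarrow> ('x, 'n) form" where
  "cscale a u = (\<lambda>c y as. a * u c y as)"

definition wedgef :: "('x, 'n) form \<Rightarrow> ('x, 'n) form \<Rightarrow> ('x, 'n) form" where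
  "wedgef u v = (\<lambda>c y. wedge (u c y) (v c y))"

definition bideg :: "nat \<Rightarrow> nat \<Rightarrow> ('x, 'n) form \<Rightarrow> ('x, 'n) form" where
  "bideg p q u = (\<lambda>c y as. if hdeg as = p \<and> adeg as = q then u c y as else 0)"

definition ext_d ::
    "('x, 'n::finite) chart set \<Rightarrow> ('x, 'n) form \<Rightarrow> ('x, 'n) form" where
  "ext_d A u = (\<lambda>c y as.
     if c \<in> A \<and> y \<in> cimg c
     then \<Sum>m<length as. (-1) ^ m * pd (as ! m) (\<lambda>z. u c z (take m as @ drop (Suc m) as)) y
     else 0)"

definition loc :: "('x \<Rightarrow> real) \<Rightarrow> ('x, 'n::finite) chart \<Rightarrow> complex^'n \<Rightarrow> real" where
  "loc f c y = f (cinv c y)"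

definition smooth_fun :: "('x, 'n::finite) chart set \<Rightarrow> ('x \<Rightarrow> real) \<Rightarrow> bool" where
  "smooth_fun A f \<longleftrightarrow> (\<forall>c\<in>A. smooth_on (cimg c) (loc f c))"

text \<open>A function as a \<open>0\<close>-form.\<close>

definition fun_form ::
    "('x, 'n::finite) chart set \<Rightarrow> ('x \<Rightarrow> real) \<Rightarrow> ('x, 'n) form" where
  "fun_form A f = (\<lambda>c y as.
     if c \<in> A \<and> y \<in> cimg c \<and> as = [] then complex_of_real (loc f c y) else 0)"

definition del_fun ::
    "('x, 'n::finite) chart set \<Rightarrow> ('x \<Rightarrow> real) \<Rightarrow> ('x, 'n) form" where
  "del_fun A f = bideg 1 0 (ext_d A (fun_form A f))"

definition delbar_fun ::
    "('x, 'n::finite) chart set \<Rightarrow> ('x \<Rightarrow> real) \<Rightarrow> ('x, 'n) form" where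
  "delbar_fun A f = bideg 0 1 (ext_d A (fun_form A f))"

section \<open>Hermitian metrics and inner products\<close>

definition hermitian_metric ::
    "('x, 'n::finite) chart set \<Rightarrow> ('x, 'n) form \<Rightarrow> bool" where
  "hermitian_metric A \<omega> \<longleftrightarrow> \<omega> \<in> forms A 2 \<and> (\<forall>c\<in>A. \<forall>y\<in>cimg c. pos_11 (\<omega> c y))"

text \<open>
  Integration over \<open>X\<close>: the manifold is cut into finitely many disjoint Borel pieces, each
  with closure inside a chart domain, and the integral is computed piecewise in coordinates.
  Such a partition exists if \<open>X\<close> is compact, and by the change of variables formula the
  integral of a globally defined function does not depend on the choice.
  The density of \<open>dV = \<omega>\<^sup>n / n!\<close> with respect to Lebesgue measure is \<open>2\<^sup>n det h\<close>, because
  \<open>\<i> dz \<and> d(cnj z) = 2 dx \<and> dy\<close>.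
\<close>

definition chart_partition ::
    "'x topology \<Rightarrow> ('x, 'n::finite) chart set \<Rightarrow> (('x, 'n) chart \<times> 'x set) set \<Rightarrow> bool" where
  "chart_partition X A P \<longleftrightarrow>
     finite P \<and>
     (\<forall>(c, V)\<in>P. c \<in> A \<and> V \<subseteq> cdom c \<and> X closure_of V \<subseteq> cdom c \<and> cmap c ` V \<in> sets borel) \<and>
     disjoint_family_on snd P \<and> (\<Union>(c, V)\<in>P. V) = topspace X"

definition vol_integral ::
    "'x topology \<Rightarrow> ('x, 'n::finite) chart set \<Rightarrow> ('x, 'n) form \<Rightarrow>
     (('x, 'n) chart \<Rightarrow> complex^'n \<Rightarrow> complex) \<Rightarrow> complex" where
  "vol_integral X A \<omega> f =
     (\<Sum>(c, V)\<in>(SOME P. chart_partition X A P).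
        set_lebesgue_integral lborel (cmap c ` V)
          (\<lambda>y. f c y * 2 ^ CARD('n) * det (hmat (\<omega> c y))))"

definition l2 ::
    "'x topology \<Rightarrow> ('x, 'n::finite) chart set \<Rightarrow> ('x, 'n) form \<Rightarrow>
     ('x, 'n) form \<Rightarrow> ('x, 'n) form \<Rightarrow> complex" where
  "l2 X A \<omega> u v = vol_integral X A \<omega> (\<lambda>c y. tip (\<omega> c y) (u c y) (v c y))"

definition l2_twisted ::
    "'x topology \<Rightarrow> ('x, 'n::finite) chart set \<Rightarrow> ('x, 'n) form \<Rightarrow> ('x \<Rightarrow> real) \<Rightarrow>
     ('x, 'n) form \<Rightarrow> ('x, 'n) form \<Rightarrow> complex" where
  "l2_twisted X A \<omega> \<eta> u v =
     (\<Sum>p\<le>CARD('n). \<Sum>q\<le>CARD('n).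
        vol_integral X A \<omega> (\<lambda>c y.
          complex_of_real (loc \<eta> c y powi (- 2 * (int CARD('n) - int p))) *
          tip (\<omega> c y) (bideg p q u c y) (bideg p q v c y)))"

text \<open>
  \<open>S\<close> is the formal adjoint of the operator \<open>T\<close> of degree \<open>1\<close> on smooth forms: it lowers the
  degree by \<open>1\<close> and vanishes on functions. For the inner products used here, the relation
  determines \<open>S\<close> uniquely on smooth forms, because they are nondegenerate.
\<close>

definition formal_adjoint ::
    "('x, 'n::finite) chart set \<Rightarrow> (('x, 'n) form \<Rightarrow> ('x, 'n) form \<Rightarrow> complex) \<Rightarrow>
     (('x, 'n) form \<Rightarrow> ('x, 'n) form) \<Rightarrow> (('x, 'n) form \<Rightarrow> ('x, 'n) form) \<Rightarrow> bool" where
  "formal_adjoint A ip T S \<longleftrightarrow>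
     (\<forall>v\<in>forms A 0. S v = 0) \<and>
     (\<forall>k. \<forall>v\<in>forms A (Suc k). S v \<in> forms A k \<and> (\<forall>u\<in>forms A k. ip (T u) v = ip u (S v)))"

section \<open>The operators\<close>

text \<open>The pointwise adjoint of \<open>\<omega> \<and> \<cdot>\<close>.\<close>

definition Lambda_op ::
    "('x, 'n::finite) chart set \<Rightarrow> ('x, 'n) form \<Rightarrow> ('x, 'n) form \<Rightarrow> ('x, 'n) form" where
  "Lambda_op A \<omega> u = (\<lambda>c y.
     if c \<in> A \<and> y \<in> cimg c
     then THE s. skew s \<and>
            (\<forall>r. skew r \<longrightarrow> tip (\<omega> c y) (wedge (\<omega> c y) r) (u c y) = tip (\<omega> c y) r s)
     else 0)"

definition gcomm ::
    "int \<Rightarrow> int \<Rightarrow> (('x, 'n) form \<Rightarrow> ('x, 'n) form) \<Rightarrow> (('x, 'n) form \<Rightarrow> ('x, 'n) form) \<Rightarrow>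
     ('x, 'n) form \<Rightarrow> ('x, 'n) form" where
  "gcomm a b P Q u = P (Q u) - cscale ((-1) powi (a * b)) (Q (P u))"

definition theta :: "('x \<Rightarrow> real) \<Rightarrow> ('x, 'n::finite) form \<Rightarrow> ('x, 'n) form" where
  "theta \<eta> u = (\<lambda>c y as. complex_of_real (loc \<eta> c y ^ hdeg as) * u c y as)"

definition theta_inv :: "('x \<Rightarrow> real) \<Rightarrow> ('x, 'n::finite) form \<Rightarrow> ('x, 'n) form" where
  "theta_inv \<eta> u = (\<lambda>c y as. u c y as / complex_of_real (loc \<eta> c y ^ hdeg as))"

definition D_op ::
    "('x, 'n::finite) chart set \<Rightarrow> ('x \<Rightarrow> real) \<Rightarrow> ('x, 'n) form \<Rightarrow> ('x, 'n) form" where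
  "D_op A \<eta> u = theta \<eta> (ext_d A (theta_inv \<eta> u))"

text \<open>The \<open>1\<close>-form \<open>\<i> (\<eta>\<^sup>-\<^sup>1 \<partial>\<eta> - \<eta> \<partial>bar \<eta>)\<close>.\<close>

definition tau_form ::
    "('x, 'n::finite) chart set \<Rightarrow> ('x \<Rightarrow> real) \<Rightarrow> ('x, 'n) form" where
  "tau_form A \<eta> = (\<lambda>c y as.
     \<i> * (complex_of_real (1 / loc \<eta> c y) * del_fun A \<eta> c y as
          - complex_of_real (loc \<eta> c y) * delbar_fun A \<eta> c y as))"

text \<open>In the following two definitions \<open>dst\<close> is the formal adjoint of \<open>d\<close> for the twisted
  inner product.\<close>

definition T_star_p ::
    "('x, 'n::finite) chart set \<Rightarrow> ('x, 'n) form \<Rightarrow> ('x \<Rightarrow> real) \<Rightarrow>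
     (('x, 'n) form \<Rightarrow> ('x, 'n) form) \<Rightarrow> nat \<Rightarrow> ('x, 'n) form \<Rightarrow> ('x, 'n) form" where
  "T_star_p A \<omega> \<eta> dst p u =
     (let v = theta \<eta> (theta \<eta> u) in
      (\<lambda>c y as. complex_of_real (1 / loc \<eta> c y ^ (2 * p)) *
         (dst v
          - cscale (2 * (of_nat CARD('n) - of_nat p))
              (gcomm (-2) 1 (Lambda_op A \<omega>) (wedgef (tau_form A \<eta>)) v)) c y as))"

definition T_star ::
    "('x, 'n::finite) chart set \<Rightarrow> ('x, 'n) form \<Rightarrow> ('x \<Rightarrow> real) \<Rightarrow>
     (('x, 'n) form \<Rightarrow> ('x, 'n) form) \<Rightarrow> ('x, 'n) form \<Rightarrow> ('x, 'n) form" where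
  "T_star A \<omega> \<eta> dst u =
     (\<Sum>p\<le>CARD('n). \<Sum>q\<le>CARD('n). T_star_p A \<omega> \<eta> dst p (bideg p q u))"

definition laplacian ::
    "(('x, 'n) form \<Rightarrow> ('x, 'n) form) \<Rightarrow> (('x, 'n) form \<Rightarrow> ('x, 'n) form) \<Rightarrow>
     ('x, 'n) form \<Rightarrow> ('x, 'n) form" where
  "laplacian P Q u = P (Q u) + Q (P u)"

section \<open>Spectrum and eigenspaces\<close>

definition eigenspace ::
    "('x, 'n::finite) chart set \<Rightarrow> nat \<Rightarrow> (('x, 'n) form \<Rightarrow> ('x, 'n) form) \<Rightarrow> complex \<Rightarrow>
     ('x, 'n) form set" where
  "eigenspace A k P l = {u \<in> forms A k. P u = cscale l u}"

definition eigenvalues ::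
    "('x, 'n::finite) chart set \<Rightarrow> nat \<Rightarrow> (('x, 'n) form \<Rightarrow> ('x, 'n) form) \<Rightarrow> complex set" where
  "eigenvalues A k P = {l. \<exists>u\<in>eigenspace A k P l. u \<noteq> 0}"

definition spectrum ::
    "('x, 'n::finite) chart set \<Rightarrow> nat \<Rightarrow> (('x, 'n) form \<Rightarrow> ('x, 'n) form) \<Rightarrow> complex set" where
  "spectrum A k P = {l. \<not> bij_betw (\<lambda>u. P u - cscale l u) (forms A k) (forms A k)}"

definition linear_iso ::
    "(('x, 'n) form \<Rightarrow> ('x, 'n) form) \<Rightarrow> ('x, 'n) form set \<Rightarrow> ('x, 'n) form set \<Rightarrow> bool" where
  "linear_iso f E F \<longleftrightarrow>
     module.subspace cscale E \<and> module.subspace cscale F \<and>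
     (\<forall>a b. \<forall>u\<in>E. \<forall>v\<in>E.
        f (cscale a u + cscale b v) = cscale a (f u) + cscale b (f v)) \<and>
     bij_betw f E F"

end

theory Submission
  imports Defs
begin

text \<open>
  Let \<open>w\<close> be of bidegree \<open>(p,q)\<close> and \<open>m = n - p\<close>. The twisted inner product weights bidegree
  \<open>(r,s)\<close> by \<open>\<eta>\<close> to the power \<open>- 2 (n - r)\<close>. Testing the adjoint of \<open>d\<close> for it against
  \<open>\<eta>\<close>-to-the-\<open>2 m\<close> times a form \<open>a\<close> therefore produces, on the one side, the operator \<open>d\<close>
  conjugated by that power of \<open>\<eta>\<close>, that is \<open>d + 2 m \<eta>\<inverse> d\<eta> \<and> \<cdot>\<close>, and on the other side exactly
  the powers of \<open>\<eta>\<close> that occur when \<open>T\<^sup>*\<close> is conjugated by \<open>\<theta>\<close>. The error term is the contraction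
  adjoint to \<open>\<eta>\<inverse> d\<eta> \<and> \<cdot>\<close>. On the other hand \<open>[\<Lambda>, \<tau> \<and> \<cdot>]\<close> is the contraction with the vector
  field \<open>Y\<close> determined by \<open>i\<^sub>Y \<omega> = - \<tau>\<close>, and for \<open>\<tau> = \<i> (\<eta>\<inverse> \<partial>\<eta> - \<eta> \<partial>bar \<eta>)\<close> the two contractions
  cancel. Hence \<open>\<theta> T\<^sup>* \<theta>\<inverse>\<close> is a formal adjoint of \<open>\<theta> d \<theta>\<inverse>\<close>, and the two adjoints agree because the
  \<open>L\<^sup>2\<close> product is definite on smooth forms. The Laplacians are then conjugate by \<open>\<theta>\<close>.
\<close>

section \<open>Smooth functions\<close>

text \<open>The unequal coefficients of \<tau> are what makes the two contractions cancel.
  Contracting a form of bidegree (p,q) removes either a holomorphic index, leaving r = p - 1, or an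
  antiholomorphic one, leaving r = p; the surviving power of \<eta> has exponent 2 r - 2 p, hence -2
  or 0. As \<omega> pairs the two types, the holomorphic part of \<open>Y\<close> carries the
  coefficient \<eta> of the antiholomorphic part of \<tau>, and the antiholomorphic part of
  \<open>Y\<close> carries 1/\<eta>. Both products are 1/\<eta>, so a single contraction, dual to
  d(log \<eta>), results. The adjoints are known only through their defining relation, which may be
  used only on smooth global forms. The obstacle is therefore to show that each intermediate object
  is one, above all the commutator, whose \<Lambda> is given by a pointwise description. Replacing
  the commutator by the contraction with \<open>Y\<close> settles this, since \<open>Y\<close> is
  global by uniqueness of the solution of its defining equation. Definiteness has to be proved for
  an integral over an unspecified choice of chart pieces, whose interiors may be empty.\<close>

lemma diff_order_on_cong:
  assumes "open S" "\<And>x. x \<in> S \<Longrightarrow> f x = g x" "diff_order_on m S f"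
  shows "diff_order_on m S g"
  using assms(2,3)
proof (induction m arbitrary: f g)
  case 0
  then show ?case using continuous_on_cong by fastforce
next
  case (Suc m)
  have d: "g differentiable (at x)" if "x \<in> S" for x
  proof -
    have "(f has_derivative frechet_derivative f (at x)) (at x)"
      using Suc.prems(2) that by (simp add: frechet_derivative_works)
    then have "(g has_derivative frechet_derivative f (at x)) (at x)"
      by (rule has_derivative_transform_within_open[OF _ \<open>open S\<close> that]) (rule Suc.prems(1))
    then show ?thesis by (auto simp: differentiable_def)
  qed
  have "diff_order_on m S (\<lambda>x. frechet_derivative g (at x) v)" for v
  proof (rule Suc.IH)
    show "diff_order_on m S (\<lambda>x. frechet_derivative f (at x) v)"
      using Suc.prems(2) by simp
    show "frechet_derivative f (at x) v = frechet_derivative g (at x) v" if "x \<in> S" for x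
      using frechet_derivative_transform_within_open[of f x S g] Suc.prems that \<open>open S\<close> by auto
  qed
  with d show ?case by simp
qed

text \<open>\<open>frechet_derivative\<close> is a choice operator; on an open set it may be
  exchanged for any explicit derivative \<open>F\<close>. The closure rules below are inductions
  through this exchange.\<close>

lemma diff_order_on_SucI:
  assumes "open S" "\<And>x. x \<in> S \<Longrightarrow> (f has_derivative F x) (at x)"
    "\<And>v. diff_order_on m S (\<lambda>x. F x v)"
  shows "diff_order_on (Suc m) S f"
proof -
  have "diff_order_on m S (\<lambda>x. frechet_derivative f (at x) v)" for v
    by (rule diff_order_on_cong[OF assms(1) _ assms(3)])
      (simp add: frechet_derivative_at[OF assms(2), symmetric])
  then show ?thesis using assms(2) by (auto simp: differentiable_def)
qed

lemma diff_order_on_Suc_has_derivative: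
  "diff_order_on (Suc m) S f \<Longrightarrow> x \<in> S \<Longrightarrow>
    (f has_derivative frechet_derivative f (at x)) (at x)"
  by (simp add: frechet_derivative_works)

text \<open>The product and inverse rules need this, because their derivatives contain the
  undifferentiated factors again, at the lower order.\<close>

lemma diff_order_on_Suc_D: "diff_order_on (Suc m) S f \<Longrightarrow> diff_order_on m S f"
proof (induction m arbitrary: f)
  case 0
  then show ?case
    by (auto intro!: continuous_at_imp_continuous_on differentiable_imp_continuous_within)
qed auto

lemma diff_order_on_const: "diff_order_on m S (\<lambda>x. c)"
  by (induction m arbitrary: c) auto

lemma diff_order_on_bounded_linear:
  assumes "open S" "bounded_linear L" "diff_order_on m S f"
  shows "diff_order_on m S (\<lambda>x. L (f x))"
  using assms(3)
proof (induction m arbitrary: f)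
  case 0
  then show ?case using bounded_linear.continuous_on[OF assms(2)] by simp
next
  case (Suc m)
  show ?case
  proof (rule diff_order_on_SucI[OF assms(1), where F="\<lambda>x v. L (frechet_derivative f (at x) v)"])
    show "((\<lambda>x. L (f x)) has_derivative (\<lambda>v. L (frechet_derivative f (at x) v))) (at x)"
      if "x \<in> S" for x
      by (rule bounded_linear.has_derivative[OF assms(2)
            diff_order_on_Suc_has_derivative[OF Suc.prems that]])
    show "diff_order_on m S (\<lambda>x. L (frechet_derivative f (at x) v))" for v
      using Suc.prems by (intro Suc.IH) simp
  qed
qed

lemma diff_order_on_add:
  assumes "open S" "diff_order_on m S f" "diff_order_on m S g"
  shows "diff_order_on m S (\<lambda>x. f x + g x)"
  using assms(2,3)
proof (induction m arbitrary: f g)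
  case 0
  then show ?case by (auto intro: continuous_on_add)
next
  case (Suc m)
  show ?case
    using diff_order_on_Suc_has_derivative[OF Suc.prems(1)]
      diff_order_on_Suc_has_derivative[OF Suc.prems(2)] Suc.prems
    by (intro diff_order_on_SucI[OF assms(1), where
          F="\<lambda>x v. frechet_derivative f (at x) v + frechet_derivative g (at x) v"]
        Suc.IH has_derivative_add) auto
qed

lemma diff_order_on_mult:
  fixes f g :: "'a::real_normed_vector \<Rightarrow> 'b::real_normed_algebra"
  assumes "open S" "diff_order_on m S f" "diff_order_on m S g"
  shows "diff_order_on m S (\<lambda>x. f x * g x)"
  using assms(2,3)
proof (induction m arbitrary: f g)
  case 0
  then show ?case by (auto intro: continuous_on_mult)
next
  case (Suc m)
  show ?case
    using diff_order_on_Suc_has_derivative[OF Suc.prems(1)]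
      diff_order_on_Suc_has_derivative[OF Suc.prems(2)] Suc.prems
      diff_order_on_Suc_D[OF Suc.prems(1)] diff_order_on_Suc_D[OF Suc.prems(2)]
    by (intro diff_order_on_SucI[OF assms(1), where
          F="\<lambda>x v. f x * frechet_derivative g (at x) v + frechet_derivative f (at x) v * g x"]
        diff_order_on_add[OF assms(1)] Suc.IH has_derivative_mult) auto
qed

lemma diff_order_on_inverse:
  fixes f :: "'a::real_normed_vector \<Rightarrow> 'b::real_normed_field"
  assumes "open S" "\<And>x. x \<in> S \<Longrightarrow> f x \<noteq> 0" "diff_order_on m S f"
  shows "diff_order_on m S (\<lambda>x. inverse (f x))"
  using assms(3)
proof (induction m)
  case 0
  then show ?case using assms(2) by (auto intro: continuous_on_inverse)
next
  case (Suc m)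
  have 1: "diff_order_on m S (\<lambda>x. inverse (f x))"
    using Suc diff_order_on_Suc_D by blast
  show ?case
  proof (rule diff_order_on_SucI[OF assms(1), where
          F="\<lambda>x v. (-1) * (inverse (f x) * frechet_derivative f (at x) v * inverse (f x))"])
    show "((\<lambda>x. inverse (f x)) has_derivative
      (\<lambda>v. (-1) * (inverse (f x) * frechet_derivative f (at x) v * inverse (f x)))) (at x)"
      if "x \<in> S" for x
      using Deriv.has_derivative_inverse[OF assms(2)[OF that] diff_order_on_Suc_has_derivative[OF Suc.prems that]]
      by simp
    show "diff_order_on m S (\<lambda>x. (-1) * (inverse (f x) * frechet_derivative f (at x) v * inverse (f x)))" for v
      using Suc.prems 1 by (intro diff_order_on_mult[OF assms(1)] diff_order_on_const) auto
  qed
qed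

lemma smooth_on_cong:
  "open S \<Longrightarrow> (\<And>x. x \<in> S \<Longrightarrow> f x = g x) \<Longrightarrow> smooth_on S f \<Longrightarrow> smooth_on S g"
  unfolding smooth_on_def using diff_order_on_cong by blast

lemma smooth_on_const: "smooth_on S (\<lambda>x. c)"
  by (simp add: smooth_on_def diff_order_on_const)

lemma smooth_on_bounded_linear:
  "open S \<Longrightarrow> bounded_linear L \<Longrightarrow> smooth_on S f \<Longrightarrow> smooth_on S (\<lambda>x. L (f x))"
  by (simp add: smooth_on_def diff_order_on_bounded_linear)

lemma smooth_on_add:
  "open S \<Longrightarrow> smooth_on S f \<Longrightarrow> smooth_on S g \<Longrightarrow> smooth_on S (\<lambda>x. f x + g x)"
  by (simp add: smooth_on_def diff_order_on_add)

lemma smooth_on_mult: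
  fixes f g :: "'a::real_normed_vector \<Rightarrow> 'b::real_normed_algebra"
  shows "open S \<Longrightarrow> smooth_on S f \<Longrightarrow> smooth_on S g \<Longrightarrow> smooth_on S (\<lambda>x. f x * g x)"
  by (simp add: smooth_on_def diff_order_on_mult)

lemma smooth_on_uminus:
  "open S \<Longrightarrow> smooth_on S f \<Longrightarrow> smooth_on S (\<lambda>x. - f x)"
  by (rule smooth_on_bounded_linear[OF _ bounded_linear_minus[OF bounded_linear_ident]])

lemma smooth_on_diff:
  "open S \<Longrightarrow> smooth_on S f \<Longrightarrow> smooth_on S g \<Longrightarrow> smooth_on S (\<lambda>x. f x - g x)"
  using smooth_on_add[of S f "\<lambda>x. - g x"] smooth_on_uminus by auto

lemma smooth_on_inverse:
  fixes f :: "'a::real_normed_vector \<Rightarrow> 'b::real_normed_field"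
  shows "open S \<Longrightarrow> (\<And>x. x \<in> S \<Longrightarrow> f x \<noteq> 0) \<Longrightarrow> smooth_on S f \<Longrightarrow>
    smooth_on S (\<lambda>x. inverse (f x))"
  by (simp add: smooth_on_def diff_order_on_inverse)

lemma smooth_on_divide:
  fixes f :: "'a::real_normed_vector \<Rightarrow> 'b::real_normed_field"
  shows "open S \<Longrightarrow> (\<And>x. x \<in> S \<Longrightarrow> g x \<noteq> 0) \<Longrightarrow> smooth_on S f \<Longrightarrow> smooth_on S g \<Longrightarrow>
    smooth_on S (\<lambda>x. f x / g x)"
  by (simp add: divide_inverse smooth_on_inverse smooth_on_mult)

lemma smooth_on_of_real:
  fixes f :: "'a::real_normed_vector \<Rightarrow> real"
  shows "open S \<Longrightarrow> smooth_on S f \<Longrightarrow> smooth_on S (\<lambda>x. of_real (f x) :: complex)"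
  by (rule smooth_on_bounded_linear[OF _ bounded_linear_of_real])

lemma smooth_on_sum:
  assumes "open S" "\<And>i. i \<in> I \<Longrightarrow> smooth_on S (f i)"
  shows "smooth_on S (\<lambda>x. \<Sum>i\<in>I. f i x)"
  using assms(2) by (induction I rule: infinite_finite_induct)
    (auto simp: smooth_on_const intro!: smooth_on_add[OF assms(1)])

lemma smooth_on_prod:
  fixes f :: "'i \<Rightarrow> 'a::real_normed_vector \<Rightarrow> 'b::{real_normed_algebra,comm_ring_1}"
  assumes "open S" "\<And>i. i \<in> I \<Longrightarrow> smooth_on S (f i)"
  shows "smooth_on S (\<lambda>x. \<Prod>i\<in>I. f i x)"
  using assms(2) by (induction I rule: infinite_finite_induct)
    (auto simp: smooth_on_const intro!: smooth_on_mult[OF assms(1)])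

lemma smooth_on_power:
  fixes f :: "'a::real_normed_vector \<Rightarrow> 'b::real_normed_algebra_1"
  shows "open S \<Longrightarrow> smooth_on S f \<Longrightarrow> smooth_on S (\<lambda>x. f x ^ k)"
  by (induction k) (auto simp: smooth_on_const intro: smooth_on_mult)

lemma smooth_on_continuous: "smooth_on S f \<Longrightarrow> continuous_on S f"
  unfolding smooth_on_def using diff_order_on.simps(1) by blast

lemma smooth_on_has_derivative:
  "smooth_on S f \<Longrightarrow> x \<in> S \<Longrightarrow> (f has_derivative frechet_derivative f (at x)) (at x)"
  unfolding smooth_on_def using diff_order_on_Suc_has_derivative by blast

lemma smooth_on_frechet:
  "smooth_on S f \<Longrightarrow> smooth_on S (\<lambda>x. frechet_derivative f (at x) v)"
  unfolding smooth_on_def using diff_order_on.simps(2) by blast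

section \<open>Symmetry of second derivatives\<close>

text \<open>The mean value theorem is applied in direction \<open>w\<close> to a difference of two
  translates of \<open>g\<close>, and then in direction \<open>v\<close> to the derivative so
  obtained. The left side is symmetric in \<open>v\<close> and \<open>w\<close>, while the right
  side is one particular mixed derivative.\<close>

lemma second_difference:
  fixes g :: "'a::real_normed_vector \<Rightarrow> real"
  assumes "t > 0"
    and D: "\<And>a b. 0 \<le> a \<Longrightarrow> a \<le> t \<Longrightarrow> 0 \<le> b \<Longrightarrow> b \<le> t \<Longrightarrow>
      (g has_derivative G (x + a *\<^sub>R v + b *\<^sub>R w)) (at (x + a *\<^sub>R v + b *\<^sub>R w))"
    and DD: "\<And>a b. 0 \<le> a \<Longrightarrow> a \<le> t \<Longrightarrow> 0 \<le> b \<Longrightarrow> b \<le> t \<Longrightarrow>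
      ((\<lambda>y. G y w) has_derivative H (x + a *\<^sub>R v + b *\<^sub>R w)) (at (x + a *\<^sub>R v + b *\<^sub>R w))"
  shows "\<exists>a b. 0 < a \<and> a < t \<and> 0 < b \<and> b < t \<and>
    g (x + t *\<^sub>R v + t *\<^sub>R w) - g (x + t *\<^sub>R v) - g (x + t *\<^sub>R w) + g x
      = t * t * H (x + a *\<^sub>R v + b *\<^sub>R w) v"
proof -
  have 1: "((\<lambda>s. g (x + a *\<^sub>R v + s *\<^sub>R w)) has_real_derivative G (x + a *\<^sub>R v + b *\<^sub>R w) w) (at b)"
    if "0 \<le> a" "a \<le> t" "0 \<le> b" "b \<le> t" for a b
  proof -
    have L: "linear (G (x + a *\<^sub>R v + b *\<^sub>R w))"
      using D[OF that] has_derivative_linear by blast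
    have "((\<lambda>s. g (x + a *\<^sub>R v + s *\<^sub>R w)) has_derivative
        (\<lambda>s. G (x + a *\<^sub>R v + b *\<^sub>R w) (s *\<^sub>R w))) (at b)"
      by (rule has_derivative_compose[of _ _ _ _ g]) (auto intro!: derivative_eq_intros D that)
    moreover have "(\<lambda>s. F (s *\<^sub>R w)) = (*) (F w)" if "linear F" for F :: "'a \<Rightarrow> real" and w
      by (auto simp: linear_cmul[OF that])
    ultimately show ?thesis using L by (simp add: has_field_derivative_def)
  qed
  have 2: "((\<lambda>s. G (x + s *\<^sub>R v + b *\<^sub>R w) w) has_real_derivative H (x + a *\<^sub>R v + b *\<^sub>R w) v) (at a)"
    if "0 \<le> a" "a \<le> t" "0 \<le> b" "b \<le> t" for a b
  proof -
    have L: "linear (H (x + a *\<^sub>R v + b *\<^sub>R w))"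
      using DD[OF that] has_derivative_linear by blast
    have "((\<lambda>s. G (x + s *\<^sub>R v + b *\<^sub>R w) w) has_derivative
        (\<lambda>s. H (x + a *\<^sub>R v + b *\<^sub>R w) (s *\<^sub>R v))) (at a)"
      by (rule has_derivative_compose[of _ _ _ _ "\<lambda>y. G y w"])
        (auto intro!: derivative_eq_intros DD that)
    moreover have "(\<lambda>s. F (s *\<^sub>R w)) = (*) (F w)" if "linear F" for F :: "'a \<Rightarrow> real" and w
      by (auto simp: linear_cmul[OF that])
    ultimately show ?thesis using L by (simp add: has_field_derivative_def)
  qed
  \<comment> \<open>The zero multiple of \<open>v\<close> is written out so that fact
    \<open>1\<close> covers both translates, with \<open>a\<close> equal to \<open>t\<close> and to
    0.\<close>
  define \<phi> where "\<phi> s = g (x + t *\<^sub>R v + s *\<^sub>R w) - g (x + 0 *\<^sub>R v + s *\<^sub>R w)" for s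
  have "(\<phi> has_real_derivative
      G (x + t *\<^sub>R v + b *\<^sub>R w) w - G (x + 0 *\<^sub>R v + b *\<^sub>R w) w) (at b)"
    if "0 \<le> b" "b \<le> t" for b
    unfolding \<phi>_def[abs_def] using that assms(1) by (intro DERIV_diff 1) auto
  from MVT2[OF assms(1) this] obtain b where b: "0 < b" "b < t"
    "\<phi> t - \<phi> 0 = t * (G (x + t *\<^sub>R v + b *\<^sub>R w) w - G (x + 0 *\<^sub>R v + b *\<^sub>R w) w)"
    by auto
  from MVT2[OF assms(1) 2[where b=b]] b obtain a where a: "0 < a" "a < t"
    "G (x + t *\<^sub>R v + b *\<^sub>R w) w - G (x + 0 *\<^sub>R v + b *\<^sub>R w) w = t * H (x + a *\<^sub>R v + b *\<^sub>R w) v"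
    by auto
  show ?thesis
    using a b by (intro exI[of _ a] exI[of _ b]) (simp add: \<phi>_def algebra_simps)
qed

text \<open>Schwarz's theorem: the same second difference equals \<open>t * t\<close> times either
  mixed derivative, each at some point near \<open>x\<close>, and continuity of both forces equality
  at \<open>x\<close>.\<close>

lemma frechet_derivative_symmetric_real:
  fixes f :: "'a::real_normed_vector \<Rightarrow> real"
  assumes "open S" "smooth_on S f" "x \<in> S"
  shows "frechet_derivative (\<lambda>y. frechet_derivative f (at y) v) (at x) w
       = frechet_derivative (\<lambda>y. frechet_derivative f (at y) w) (at x) v"
    (is "?H v w x = ?H w v x")
proof (rule ccontr)
  assume ne: "?H v w x \<noteq> ?H w v x"
  \<comment> \<open>Half the gap: two deviations below \<open>e\<close> cannot bridge a distance of
    \<open>2 * e\<close>.\<close>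
  define e where "e = \<bar>?H v w x - ?H w v x\<bar> / 2"
  have "e > 0" using ne by (simp add: e_def)
  have sm: "smooth_on S (?H a b)" for a b
    by (intro smooth_on_frechet assms)
  have cont: "continuous (at x) (?H a b)" for a b
    using smooth_on_continuous[OF sm] assms by (simp add: continuous_on_eq_continuous_at)
  obtain d1 where d1: "d1 > 0" "\<And>y. dist y x < d1 \<Longrightarrow> dist (?H v w y) (?H v w x) < e"
    using cont[of v w] \<open>e > 0\<close> unfolding continuous_at_eps_delta dist_norm by blast
  obtain d2 where d2: "d2 > 0" "\<And>y. dist y x < d2 \<Longrightarrow> dist (?H w v y) (?H w v x) < e"
    using cont[of w v] \<open>e > 0\<close> unfolding continuous_at_eps_delta dist_norm by blast
  obtain d3 where d3: "d3 > 0" "ball x d3 \<subseteq> S"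
    using assms open_contains_ball by blast
  define d where "d = min d1 (min d2 d3)"
  \<comment> \<open>Keeps the parallelogram with sides \<open>t *\<^sub>R v\<close> and
    \<open>t *\<^sub>R w\<close> within distance \<open>d / 2\<close> of \<open>x\<close>; the
    summand 1 keeps the denominator positive when both directions vanish.\<close>
  define t where "t = d / (2 * (norm v + norm w + 1))"
  have "d > 0" using d1 d2 d3 by (simp add: d_def)
  have nn: "norm v + norm w + 1 > 0" by (simp add: add_nonneg_pos)
  have "t > 0" using \<open>d > 0\<close> nn by (simp add: t_def)
  have close: "norm (a *\<^sub>R v + b *\<^sub>R w) < d" if "0 \<le> a" "a \<le> t" "0 \<le> b" "b \<le> t" for a b
  proof -
    have "norm (a *\<^sub>R v + b *\<^sub>R w) \<le> a * norm v + b * norm w"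
      using norm_triangle_ineq[of "a *\<^sub>R v" "b *\<^sub>R w"] that by simp
    also have "\<dots> \<le> t * norm v + t * norm w"
      using that by (intro add_mono mult_right_mono) auto
    also have "\<dots> \<le> t * (norm v + norm w + 1)" using \<open>t > 0\<close> by (simp add: algebra_simps)
    also have "\<dots> = d / 2"
    proof -
      have "d / (2 * N) * N = d / 2" if "N > 0" for N :: real using that by simp
      then show ?thesis unfolding t_def using nn by blast
    qed
    also have "\<dots> < d" using \<open>d > 0\<close> by simp
    finally show ?thesis .
  qed
  have dst: "dist (x + a *\<^sub>R v + b *\<^sub>R w) x < d" if "0 \<le> a" "a \<le> t" "0 \<le> b" "b \<le> t" for a b
    using close[OF that] by (simp add: dist_norm add.assoc)
  have inS: "x + a *\<^sub>R v + b *\<^sub>R w \<in> S" if "0 \<le> a" "a \<le> t" "0 \<le> b" "b \<le> t" for a b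
    using dst[OF that] d3 by (auto simp: d_def dist_commute subset_iff)
  have comm: "x + b *\<^sub>R w + a *\<^sub>R v = x + a *\<^sub>R v + b *\<^sub>R w" for a b by simp
  have inS': "x + b *\<^sub>R w + a *\<^sub>R v \<in> S" if "0 \<le> b" "b \<le> t" "0 \<le> a" "a \<le> t" for a b
    using inS[of a b] that by (simp add: comm)
  have diff2: "\<exists>a b. 0 < a \<and> a < t \<and> 0 < b \<and> b < t \<and>
      f (x + t *\<^sub>R p + t *\<^sub>R q) - f (x + t *\<^sub>R p) - f (x + t *\<^sub>R q) + f x
      = t * t * ?H q p (x + a *\<^sub>R p + b *\<^sub>R q)"
    if "\<And>a b. 0 \<le> a \<Longrightarrow> a \<le> t \<Longrightarrow> 0 \<le> b \<Longrightarrow> b \<le> t \<Longrightarrow> x + a *\<^sub>R p + b *\<^sub>R q \<in> S" for p q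
    by (rule second_difference[OF \<open>t > 0\<close>, where g=f and
          G="\<lambda>y. frechet_derivative f (at y)" and
          H="\<lambda>y. frechet_derivative (\<lambda>y. frechet_derivative f (at y) q) (at y)"];
        rule smooth_on_has_derivative[OF _ that], (intro smooth_on_frechet assms)?)
  obtain a b where ab: "0 < a" "a < t" "0 < b" "b < t"
    "f (x + t *\<^sub>R v + t *\<^sub>R w) - f (x + t *\<^sub>R v) - f (x + t *\<^sub>R w) + f x
      = t * t * ?H w v (x + a *\<^sub>R v + b *\<^sub>R w)"
    using diff2[of v w, OF inS] by blast
  obtain a' b' where ab': "0 < a'" "a' < t" "0 < b'" "b' < t"
    "f (x + t *\<^sub>R w + t *\<^sub>R v) - f (x + t *\<^sub>R w) - f (x + t *\<^sub>R v) + f x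
      = t * t * ?H v w (x + b' *\<^sub>R w + a' *\<^sub>R v)"
    using diff2[of w v, OF inS'] by blast
  have "t * t * ?H w v (x + a *\<^sub>R v + b *\<^sub>R w) = t * t * ?H v w (x + a' *\<^sub>R v + b' *\<^sub>R w)"
    using ab(5) ab'(5) unfolding comm by linarith
  then have eq: "?H w v (x + a *\<^sub>R v + b *\<^sub>R w) = ?H v w (x + a' *\<^sub>R v + b' *\<^sub>R w)"
    using \<open>t > 0\<close> by simp
  have "dist (?H w v (x + a *\<^sub>R v + b *\<^sub>R w)) (?H w v x) < e"
    using dst[of a b] ab by (intro d2) (auto simp: d_def)
  moreover have "dist (?H v w (x + a' *\<^sub>R v + b' *\<^sub>R w)) (?H v w x) < e"
    using dst[of a' b'] ab' by (intro d1) (auto simp: d_def)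
  ultimately have "\<bar>?H v w x - ?H w v x\<bar> < 2 * e"
    using eq unfolding dist_real_def by linarith
  then show False by (simp add: e_def)
qed

lemma frechet_derivative_bounded_linear:
  assumes "bounded_linear L" "f differentiable (at x)"
  shows "frechet_derivative (\<lambda>x. L (f x)) (at x) v = L (frechet_derivative f (at x) v)"
  using fun_cong[OF frechet_derivative_at[OF bounded_linear.has_derivative[OF assms(1)
        assms(2)[unfolded frechet_derivative_works]], symmetric], of v] .

lemma frechet_derivative_symmetric:
  fixes f :: "'a::real_normed_vector \<Rightarrow> complex"
  assumes "open S" "smooth_on S f" "x \<in> S"
  shows "frechet_derivative (\<lambda>y. frechet_derivative f (at y) v) (at x) w
       = frechet_derivative (\<lambda>y. frechet_derivative f (at y) w) (at x) v"
proof -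
  have df: "g differentiable (at y)" if "smooth_on S g" "y \<in> S" for y and g :: "'a \<Rightarrow> complex"
    using smooth_on_has_derivative[OF that] by (auto simp: differentiable_def)
  have *: "L (frechet_derivative (\<lambda>y. frechet_derivative f (at y) v) (at x) w)
       = frechet_derivative (\<lambda>y. frechet_derivative (\<lambda>x. L (f x)) (at y) v) (at x) w"
    if L: "bounded_linear L" for L :: "complex \<Rightarrow> real" and v w
  proof -
    have "L (frechet_derivative (\<lambda>y. frechet_derivative f (at y) v) (at x) w) =
        frechet_derivative (\<lambda>y. L (frechet_derivative f (at y) v)) (at x) w"
      by (rule frechet_derivative_bounded_linear[OF L, symmetric])
        (intro df smooth_on_frechet assms)
    also have "\<dots> = frechet_derivative (\<lambda>y. frechet_derivative (\<lambda>x. L (f x)) (at y) v) (at x) w"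
    proof (rule fun_cong[OF frechet_derivative_transform_within_open[OF _ assms(1,3)]])
      show "(\<lambda>y. L (frechet_derivative f (at y) v)) differentiable at x"
        using bounded_linear.has_derivative[OF L
            smooth_on_has_derivative[OF smooth_on_frechet[OF assms(2)] assms(3)]]
        by (auto simp: differentiable_def)
    qed (simp add: frechet_derivative_bounded_linear[OF L df[OF assms(2)]])
    finally show ?thesis .
  qed
  show ?thesis
  proof (rule complex_eqI)
    show "Re (frechet_derivative (\<lambda>y. frechet_derivative f (at y) v) (at x) w)
        = Re (frechet_derivative (\<lambda>y. frechet_derivative f (at y) w) (at x) v)"
      unfolding *[OF bounded_linear_Re]
      by (intro frechet_derivative_symmetric_real[OF assms(1)] assms
          smooth_on_bounded_linear[OF assms(1) bounded_linear_Re])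
    show "Im (frechet_derivative (\<lambda>y. frechet_derivative f (at y) v) (at x) w)
        = Im (frechet_derivative (\<lambda>y. frechet_derivative f (at y) w) (at x) v)"
      unfolding *[OF bounded_linear_Im]
      by (intro frechet_derivative_symmetric_real[OF assms(1)] assms
          smooth_on_bounded_linear[OF assms(1) bounded_linear_Im])
  qed
qed

section \<open>Wirtinger derivatives\<close>

lemma sum_cidx:
  fixes f :: "'n::finite cidx \<Rightarrow> 'b::comm_monoid_add"
  shows "(\<Sum>b\<in>UNIV. f b) = (\<Sum>j\<in>UNIV. f (Inl j)) + (\<Sum>j\<in>UNIV. f (Inr j))"
  by (simp flip: UNIV_Plus_UNIV add: sum.Plus)

text \<open>\<open>pd\<close> depends on a function only through its derivative. This functional
  separates the calculus (\<open>pd_eqI\<close>) from the linear algebra of Wirtinger operators, and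
  allows two of them to be interchanged.\<close>

fun wirt :: "'n::finite cidx \<Rightarrow> (complex^'n \<Rightarrow> complex) \<Rightarrow> complex" where
  "wirt (Inl j) F = (F (axis j 1) - \<i> * F (axis j \<i>)) / 2"
| "wirt (Inr j) F = (F (axis j 1) + \<i> * F (axis j \<i>)) / 2"

lemma pd_wirt: "pd a f y = wirt a (frechet_derivative f (at y))"
  by (cases a) auto

lemma pd_eqI: "(f has_derivative F) (at y) \<Longrightarrow> pd a f y = wirt a F"
  using frechet_derivative_at[of f F y] by (simp add: pd_wirt)

lemma wirt_add: "wirt a (\<lambda>v. F v + G v) = wirt a F + wirt a G"
  by (cases a) (auto simp: field_simps)

lemma wirt_cmult: "wirt a (\<lambda>v. c * F v) = c * wirt a F"
  by (cases a) (auto simp: field_simps)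

lemma wirt_cmult_right: "wirt a (\<lambda>v. F v * c) = wirt a F * c"
  by (cases a) (auto simp: field_simps)

lemma wirt_zero: "wirt a (\<lambda>v. 0) = 0"
  by (cases a) auto

lemma wirt_sum: "wirt a (\<lambda>v. \<Sum>i\<in>I. F i v) = (\<Sum>i\<in>I. wirt a (F i))"
  by (induction I rule: infinite_finite_induct) (auto simp: wirt_zero wirt_add)

lemma wirt_swap: "wirt a (\<lambda>w. wirt b (\<lambda>v. H v w)) = wirt b (\<lambda>v. wirt a (\<lambda>w. H v w))"
  by (cases a; cases b) (auto simp: field_simps)

text \<open>A real linear map into the complex numbers splits into a complex linear and a conjugate
  linear part; for a derivative this is the splitting of the differential into its two types. The
  chain rule for \<open>pd\<close> rests on it.\<close>

lemma wirt_decomp: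
  fixes F :: "complex^'n::finite \<Rightarrow> complex"
  assumes "linear F"
  shows "F v = (\<Sum>b\<in>UNIV. wirt b F * coord b v)"
proof -
  have v: "v = (\<Sum>j\<in>UNIV. Re (v $ j) *\<^sub>R axis j 1 + Im (v $ j) *\<^sub>R axis j \<i>)"
    by (simp add: vec_eq_iff axis_def if_distrib if_distribR cong: if_cong)
      (metis complex_eq mult.commute scaleR_conv_of_real mult.right_neutral)
  have "F v = (\<Sum>j\<in>UNIV. of_real (Re (v $ j)) * F (axis j 1) + of_real (Im (v $ j)) * F (axis j \<i>))"
    by (subst v, simp add: linear_sum[OF assms] linear_add[OF assms] linear_cmul[OF assms],
        simp add: scaleR_conv_of_real)
  also have "\<dots> = (\<Sum>j\<in>UNIV. wirt (Inl j) F * (v $ j) + wirt (Inr j) F * cnj (v $ j))"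
    by (rule sum.cong[OF refl]) (simp add: complex_eq_iff field_simps)
  finally show ?thesis by (simp add: sum_cidx sum.distrib)
qed

lemma pd_cong:
  assumes "open S" "y \<in> S" "\<And>z. z \<in> S \<Longrightarrow> f z = g z" "f differentiable (at y)"
  shows "pd a f y = pd a g y"
  using frechet_derivative_transform_within_open[OF assms(4,1,2,3)] by (simp add: pd_wirt)

lemma pd_const: "pd a (\<lambda>z. c) y = 0"
  by (cases a) auto

lemma pd_add:
  assumes "f differentiable (at y)" "g differentiable (at y)"
  shows "pd a (\<lambda>z. f z + g z) y = pd a f y + pd a g y"
proof -
  have "pd a (\<lambda>z. f z + g z) y = wirt a (\<lambda>v. frechet_derivative f (at y) v + frechet_derivative g (at y) v)"
    by (rule pd_eqI[OF has_derivative_add]) (use assms in \<open>simp_all add: frechet_derivative_works\<close>)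
  then show ?thesis by (simp add: wirt_add pd_wirt)
qed

lemma pd_mult:
  assumes "f differentiable (at y)" "g differentiable (at y)"
  shows "pd a (\<lambda>z. f z * g z) y = pd a f y * g y + f y * pd a g y"
proof -
  have "pd a (\<lambda>z. f z * g z) y = wirt a (\<lambda>v. f y * frechet_derivative g (at y) v +
      frechet_derivative f (at y) v * g y)"
    by (rule pd_eqI[OF has_derivative_mult]) (use assms in \<open>simp_all add: frechet_derivative_works\<close>)
  then show ?thesis by (simp add: wirt_add wirt_cmult wirt_cmult_right pd_wirt)
qed

lemma pd_cmult:
  assumes "f differentiable (at y)"
  shows "pd a (\<lambda>z. c * f z) y = c * pd a f y"
  using pd_mult[of "\<lambda>z. c" y f a] assms by (simp add: pd_const)

lemma pd_sum:
  assumes "\<And>i. i \<in> I \<Longrightarrow> f i differentiable (at y)"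
  shows "pd a (\<lambda>z. \<Sum>i\<in>I. f i z) y = (\<Sum>i\<in>I. pd a (f i) y)"
  using assms
  by (induction I rule: infinite_finite_induct) (auto simp: pd_const pd_add)

text \<open>The inner map is only real differentiable here, so the conjugate coordinates of \<phi>
  contribute their own terms; hence the sum over all \<open>2n\<close> coordinates.\<close>

lemma pd_chain:
  fixes \<phi> :: "complex^'n::finite \<Rightarrow> complex^'n"
  assumes "f differentiable (at (\<phi> y))" "\<phi> differentiable (at y)"
  shows "pd a (\<lambda>z. f (\<phi> z)) y = (\<Sum>b\<in>UNIV. pd a (\<lambda>z. coord b (\<phi> z)) y * pd b f (\<phi> y))"
proof -
  let ?F = "frechet_derivative f (at (\<phi> y))" and ?P = "frechet_derivative \<phi> (at y)"
  have F: "(f has_derivative ?F) (at (\<phi> y))" and P: "(\<phi> has_derivative ?P) (at y)"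
    using assms by (simp_all add: frechet_derivative_works)
  have c: "((\<lambda>z. coord b (\<phi> z)) has_derivative (\<lambda>v. coord b (?P v))) (at y)" for b :: "'n cidx"
  proof (cases b)
    case (Inl j)
    then show ?thesis using bounded_linear.has_derivative[OF bounded_linear_vec_nth P] by simp
  next
    case (Inr j)
    then show ?thesis
      using bounded_linear.has_derivative[OF bounded_linear_cnj
          bounded_linear.has_derivative[OF bounded_linear_vec_nth P]] by simp
  qed
  have "pd a (\<lambda>z. f (\<phi> z)) y = wirt a (\<lambda>v. ?F (?P v))"
    by (rule pd_eqI[OF has_derivative_compose[OF P F]])
  also have "(\<lambda>v. ?F (?P v)) = (\<lambda>v. \<Sum>b\<in>UNIV. wirt b ?F * coord b (?P v))"
    using wirt_decomp[OF has_derivative_linear[OF F]] by blast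
  also have "wirt a \<dots> = (\<Sum>b\<in>UNIV. wirt b ?F * wirt a (\<lambda>v. coord b (?P v)))"
    by (simp add: wirt_sum wirt_cmult)
  finally show ?thesis
    by (simp add: pd_eqI[OF c] pd_wirt[of _ f] mult.commute)
qed

lemma smooth_on_differentiable: "smooth_on S f \<Longrightarrow> x \<in> S \<Longrightarrow> f differentiable (at x)"
  using smooth_on_has_derivative by (auto simp: differentiable_def)

lemma smooth_on_pd:
  assumes "open S" "smooth_on S f"
  shows "smooth_on S (\<lambda>y. pd a f y)"
  by (cases a; simp; intro smooth_on_const smooth_on_divide smooth_on_diff smooth_on_add smooth_on_mult
      smooth_on_frechet assms) auto

lemma pd_pd_commute:
  assumes "open S" "smooth_on S f" "y \<in> S"
  shows "pd a (\<lambda>z. pd b f z) y = pd b (\<lambda>z. pd a f z) y"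
proof -
  let ?H = "\<lambda>v w. frechet_derivative (\<lambda>z. frechet_derivative f (at z) v) (at y) w"
  have *: "pd a (\<lambda>z. pd b f z) y = wirt a (\<lambda>w. wirt b (\<lambda>v. ?H v w))" for a b
  proof (rule pd_eqI)
    have d: "((\<lambda>z. frechet_derivative f (at z) v) has_derivative ?H v) (at y)" for v
      by (rule smooth_on_has_derivative[OF smooth_on_frechet[OF assms(2)] assms(3)])
    show "((\<lambda>z. pd b f z) has_derivative (\<lambda>w. wirt b (\<lambda>v. ?H v w))) (at y)"
      using bounded_linear.has_derivative[OF bounded_linear_divide has_derivative_diff[OF d has_derivative_mult_right[OF d]]]
        bounded_linear.has_derivative[OF bounded_linear_divide has_derivative_add[OF d has_derivative_mult_right[OF d]]]
      by (cases b) simp_all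
  qed
  have "(\<lambda>v. wirt a (\<lambda>w. ?H v w)) = (\<lambda>v. wirt a (\<lambda>w. ?H w v))"
    by (intro ext arg_cong[of _ _ "wirt a"] frechet_derivative_symmetric[OF assms])
  then show ?thesis
    unfolding * wirt_swap[of a b] by (rule arg_cong)
qed

section \<open>Exterior algebra at a point\<close>

text \<open>Interior product with the coordinate vector of index \<open>a\<close>. Recursion on the
  first index turns identities between antisymmetrized sums into inductions over the index
  list.\<close>

definition slot :: "'n cidx \<Rightarrow> 'n tensor \<Rightarrow> 'n tensor" where
  "slot a t = (\<lambda>as. t (a # as))"

lemma slot_apply [simp]: "slot a t as = t (a # as)"
  by (simp add: slot_def)

text \<open>Skew symmetry in a single degree, the form in which it can be proved by induction on the
  degree.\<close>

definition skew_at :: "nat \<Rightarrow> 'n tensor \<Rightarrow> bool" where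
  "skew_at n t \<longleftrightarrow> (\<forall>as i j. i < j \<and> j < length as \<and> length as = n \<longrightarrow>
      t (as[i := as ! j, j := as ! i]) = - t as)"

lemma skew_iff_skew_at: "skew t \<longleftrightarrow> (\<forall>n. skew_at n t)"
  by (auto simp: skew_def skew_at_def)

text \<open>A general transposition reduces to transpositions inside the tail and exchanges of the
  first two entries.\<close>

lemma skew_at_SucI:
  assumes "\<And>a. skew_at n (slot a t)"
    and "\<And>a b as. Suc (length as) = n \<Longrightarrow> t (a # b # as) = - t (b # a # as)"
  shows "skew_at (Suc n) t"
  unfolding skew_at_def
proof (intro allI impI)
  fix as :: "'a cidx list" and i j :: nat
  assume ij: "i < j \<and> j < length as \<and> length as = Suc n"
  then obtain a as' where as: "as = a # as'" by (cases as) auto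
  obtain j' where j: "j = Suc j'" using ij by (cases j) auto
  show "t (as[i := as ! j, j := as ! i]) = - t as"
  proof (cases i)
    case (Suc i')
    have "slot a t (as'[i' := as' ! j', j' := as' ! i']) = - slot a t as'"
      using assms(1)[of a] ij as j Suc unfolding skew_at_def by simp
    then show ?thesis by (simp add: as j Suc)
  next
    case 0
    show ?thesis
    proof (cases j')
      case 0
      with ij as j obtain b cs where "as' = b # cs" by (cases as') auto
      then show ?thesis using assms(2)[of cs b a] ij by (simp add: as j 0 \<open>i = 0\<close>)
    next
      case (Suc k)
      with ij as j obtain b cs where b: "as' = b # cs" by (cases as') auto
      let ?c = "cs ! k"
      have k: "k < length cs" "length cs = n - 1" "n > 0" using ij as b j Suc by auto
      \<comment> \<open>Exchanging position 0 with a position beyond 1 is a product of three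
        transpositions of the allowed kinds: the front pair, one inside the tail, and the front pair
        again. Three signs make one.\<close>
      have "t (a # b # cs) = - t (b # a # cs)" by (rule assms(2)) (use k in simp)
      also have "slot b t ((a # cs)[0 := (a # cs) ! Suc k, Suc k := (a # cs) ! 0]) = - slot b t (a # cs)"
        using assms(1)[of b, unfolded skew_at_def, rule_format, of 0 "Suc k" "a # cs"] k by simp
      then have "- t (b # a # cs) = t (b # ?c # cs[k := a])" by simp
      also have "\<dots> = - t (?c # b # cs[k := a])"
        using assms(2)[of "cs[k := a]" b ?c] k by simp
      finally show ?thesis by (simp add: as b j Suc \<open>i = 0\<close>)
    qed
  qed
qed

lemma skew_slot: "skew t \<Longrightarrow> skew (slot a t)"
  unfolding skew_def
proof (intro allI impI)
  fix as :: "'a cidx list" and i j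
  assume t: "\<forall>as i j. i < j \<and> j < length as \<longrightarrow> t (as[i := as ! j, j := as ! i]) = - t as"
    and "i < j \<and> j < length as"
  then show "slot a t (as[i := as ! j, j := as ! i]) = - slot a t as"
    using t[rule_format, of "Suc i" "Suc j" "a # as"] by simp
qed

lemma skew_swap: "skew t \<Longrightarrow> t (a # b # as) = - t (b # a # as)"
  unfolding skew_def by (drule spec[of _ "b # a # as"], drule spec[of _ 0], drule spec[of _ 1]) simp

lemma skew_not_distinct:
  assumes "skew t" "\<not> distinct as"
  shows "t as = 0"
proof -
  obtain i j where ij: "i < j" "j < length as" "as ! i = as ! j"
    using assms(2) unfolding distinct_conv_nth by (metis linorder_neqE_nat)
  have "t (as[i := as ! j, j := as ! i]) = - t as"
    by (rule assms(1)[unfolded skew_def, rule_format]) (use ij in simp)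
  moreover have "as[i := as ! j, j := as ! i] = as" using ij by (metis list_update_id)
  ultimately show ?thesis by simp
qed

text \<open>A nonvanishing component has distinct indices, of which there are \<open>n\<close>
  holomorphic and \<open>n\<close> antiholomorphic ones. This justifies the ranges of the finite
  sums in \<open>tip\<close>, \<open>l2_twisted\<close> and \<open>T_star\<close>.\<close>

lemma skew_degree_bound:
  fixes t :: "'n::finite tensor"
  assumes "skew t" "t as \<noteq> 0"
  shows "length as \<le> 2 * CARD('n)" "hdeg as \<le> CARD('n)" "adeg as \<le> CARD('n)"
proof -
  have d: "distinct as" using assms skew_not_distinct by blast
  have "length as = card (set as)" using d by (simp add: distinct_card)
  also have "\<dots> \<le> card (UNIV :: 'n cidx set)" by (rule card_mono) auto
  finally show "length as \<le> 2 * CARD('n)" by (simp add: card_UNIV_sum)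
  have "hdeg as = card (set (filter isl as))" using d by (simp add: hdeg_def distinct_card[symmetric] del: set_filter)
  also have "\<dots> \<le> card (range (Inl :: 'n \<Rightarrow> 'n cidx))" by (rule card_mono) (auto simp: isl_def)
  also have "\<dots> = CARD('n)" by (simp add: card_image)
  finally show "hdeg as \<le> CARD('n)" .
  have "adeg as = card (set (filter (\<lambda>a. \<not> isl a) as))"
    using d by (simp add: adeg_def distinct_card[symmetric] del: set_filter)
  also have "\<dots> \<le> card (range (Inr :: 'n \<Rightarrow> 'n cidx))"
  proof (rule card_mono)
    show "set (filter (\<lambda>a. \<not> isl a) as) \<subseteq> range Inr"
      by (auto simp: isl_def) (metis range_eqI sumE)
  qed simp
  also have "\<dots> = CARD('n)" by (simp add: card_image)
  finally show "adeg as \<le> CARD('n)" .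
qed

lemma skew_zero: "skew (\<lambda>as. 0)"
  by (simp add: skew_def)

lemma skew_add: "skew s \<Longrightarrow> skew t \<Longrightarrow> skew (\<lambda>as. s as + t as)"
  by (simp add: skew_def)

lemma skew_diff: "skew s \<Longrightarrow> skew t \<Longrightarrow> skew (\<lambda>as. s as - t as)"
  by (simp add: skew_def)

lemma skew_cmult: "skew t \<Longrightarrow> skew (\<lambda>as. c * t as)"
  by (simp add: skew_def)

lemma skew_sum: "(\<And>i. i \<in> I \<Longrightarrow> skew (f i)) \<Longrightarrow> skew (\<lambda>as. \<Sum>i\<in>I. f i as)"
  by (induction I rule: infinite_finite_induct) (auto simp: skew_zero skew_add)

definition contract :: "('n::finite cidx \<Rightarrow> complex) \<Rightarrow> 'n tensor \<Rightarrow> 'n tensor" where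
  "contract X t = (\<lambda>as. \<Sum>b\<in>UNIV. X b * t (b # as))"

lemma contract_skew: "skew t \<Longrightarrow> skew (contract X t)"
  unfolding contract_def using skew_cmult[OF skew_slot] by (intro skew_sum) (simp add: slot_def)

text \<open>
  Both the exterior derivative and the wedge product with a \<open>1\<close>-form are alternations, and
  all facts about them are proved by induction on the index list with \<open>alt_Cons\<close>.
\<close>

definition alt :: "('n cidx \<Rightarrow> 'n tensor) \<Rightarrow> 'n tensor" where
  "alt F as = (\<Sum>m<length as. (-1) ^ m * F (as ! m) (take m as @ drop (Suc m) as))"

lemma alt_Nil [simp]: "alt F [] = 0"
  by (simp add: alt_def)

lemma alt_Cons: "alt F (a # as) = F a as - alt (\<lambda>b. slot a (F b)) as"
  by (simp add: alt_def sum.lessThan_Suc_shift del: sum.lessThan_Suc flip: sum_negf)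

lemma alt_cong: "(\<And>a as. F a as = G a as) \<Longrightarrow> alt F as = alt G as"
  by (simp add: alt_def)

lemma alt_sum: "alt (\<lambda>a as. \<Sum>i\<in>I. F i a as) as = (\<Sum>i\<in>I. alt (F i) as)"
  by (simp add: alt_def sum_distrib_left sum.swap[of _ I])

lemma alt_cmult: "alt (\<lambda>a as. c * F a as) as = c * alt F as"
  by (simp add: alt_def sum_distrib_left mult.left_commute)

lemma alt_add: "alt (\<lambda>a as. F a as + G a as) as = alt F as + alt G as"
  by (simp add: alt_def sum.distrib algebra_simps)

lemma alt_skew:
  assumes "\<And>b. skew (F b)"
  shows "skew (alt F)"
proof -
  have "skew_at n (alt F)" if "\<And>b. skew (F b)" for n and F :: "'a cidx \<Rightarrow> 'a tensor"
    using that
  proof (induction n arbitrary: F)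
    case 0
    then show ?case by (simp add: skew_at_def)
  next
    case (Suc n)
    show ?case
    proof (rule skew_at_SucI)
      fix a
      have "skew_at n (alt (\<lambda>b. slot a (F b)))" by (rule Suc.IH) (rule skew_slot[OF Suc.prems])
      moreover have "skew_at n (F a)" using Suc.prems skew_iff_skew_at by blast
      ultimately show "skew_at n (slot a (alt F))" by (simp add: skew_at_def alt_Cons)
    next
      fix a b :: "'a cidx" and as
      have "alt (\<lambda>c. slot b (slot a (F c))) as = alt (\<lambda>c cs. (-1) * slot a (slot b (F c)) cs) as"
        using skew_swap[OF Suc.prems, where a = a and b = b] by (intro alt_cong) simp
      then show "alt F (a # b # as) = - alt F (b # a # as)"
        by (simp only: alt_cmult) (simp add: alt_Cons slot_def)
    qed
  qed
  then show ?thesis using assms by (simp add: skew_iff_skew_at)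
qed

section \<open>Wedge products by recursion on the first index\<close>

definition wedge1 :: "('n cidx \<Rightarrow> complex) \<Rightarrow> 'n tensor \<Rightarrow> 'n tensor" where
  "wedge1 \<sigma> t = alt (\<lambda>a as. \<sigma> a * t as)"

lemma wedge1_Nil [simp]: "wedge1 \<sigma> t [] = 0"
  by (simp add: wedge1_def)

lemma wedge1_Cons: "wedge1 \<sigma> t (a # as) = \<sigma> a * t as - wedge1 \<sigma> (slot a t) as"
  by (simp add: wedge1_def alt_Cons slot_def)

lemma wedge1_skew: "skew t \<Longrightarrow> skew (wedge1 \<sigma> t)"
  unfolding wedge1_def by (rule alt_skew) (simp add: skew_cmult)

lemma wedge1_sum_right: "wedge1 \<sigma> (\<lambda>as. \<Sum>i\<in>I. f i as) as = (\<Sum>i\<in>I. wedge1 \<sigma> (f i) as)"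
  unfolding wedge1_def by (simp add: sum_distrib_left alt_sum)

lemma wedge1_cmult_right: "wedge1 \<sigma> (\<lambda>as. c * t as) as = c * wedge1 \<sigma> t as"
  unfolding wedge1_def by (simp add: mult.left_commute alt_cmult)

text \<open>The subsets are split by whether they contain 0, the rest being shifted by one; in
  \<open>wedge\<close> this separates the shuffles by the factor that receives the first
  index.\<close>

lemma sum_Pow_lessThan_Suc:
  fixes f :: "nat set \<Rightarrow> 'b::comm_monoid_add"
  shows "(\<Sum>S\<in>Pow {..<Suc n}. f S) = (\<Sum>S\<in>Pow {..<n}. f (insert 0 (Suc ` S)) + f (Suc ` S))"
proof -
  have P: "Pow {..<Suc n} = (\<lambda>S. insert 0 (Suc ` S)) ` Pow {..<n} \<union> (`) Suc ` Pow {..<n}"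
  proof (rule set_eqI, rule iffI)
    fix S assume "S \<in> Pow {..<Suc n}"
    let ?T = "{j. Suc j \<in> S}"
    have T: "?T \<in> Pow {..<n}" using \<open>S \<in> _\<close> by auto
    have S: "S = (if 0 \<in> S then insert 0 (Suc ` ?T) else Suc ` ?T)"
    proof (rule set_eqI)
      fix x show "x \<in> S \<longleftrightarrow> x \<in> (if 0 \<in> S then insert 0 (Suc ` ?T) else Suc ` ?T)"
        by (cases x) auto
    qed
    show "S \<in> (\<lambda>S. insert 0 (Suc ` S)) ` Pow {..<n} \<union> (`) Suc ` Pow {..<n}"
      using T S by (metis (no_types, lifting) UnI1 UnI2 imageI)
  qed auto
  have i1: "inj_on (\<lambda>S. insert 0 (Suc ` S)) (Pow {..<n})"
  proof (rule inj_onI)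
    fix S T assume "insert 0 (Suc ` S) = insert 0 (Suc ` T)"
    then have "Suc ` S = Suc ` T" by (metis Diff_insert_absorb imageE nat.distinct(1))
    then show "S = T" by (simp add: inj_image_eq_iff)
  qed
  have i2: "inj_on ((`) Suc) (Pow {..<n})"
    by (rule inj_onI) (simp add: inj_image_eq_iff)
  have "(\<Sum>S\<in>Pow {..<Suc n}. f S) =
      sum f ((\<lambda>S. insert 0 (Suc ` S)) ` Pow {..<n}) + sum f ((`) Suc ` Pow {..<n})"
    unfolding P by (rule sum.union_disjoint) auto
  then show ?thesis
    by (simp add: sum.reindex[OF i1] sum.reindex[OF i2] sum.distrib)
qed

lemma wedge_Nil: "wedge s t [] = s [] * t []"
  by (simp add: wedge_def)

text \<open>The degree involution; it records the sign of moving an interior product past a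
  factor.\<close>

definition sgnt :: "'n tensor \<Rightarrow> 'n tensor" where
  "sgnt t = (\<lambda>as. (-1) ^ length as * t as)"

text \<open>The antiderivation rule for the interior product with a coordinate vector. If the first
  position goes to the second factor, it forms one inversion with each of the \<open>card S\<close>
  positions of the first factor; this is the sign in \<open>sgnt\<close>.\<close>

lemma wedge_Cons: "wedge s t (a # as) = wedge (slot a s) t as + wedge (sgnt s) (slot a t) as"
proof -
  let ?n = "length as"
  define inv where "inv S = card {(i, j). i < j \<and> j \<in> S \<and> i \<notin> S}" for S :: "nat set"
  have fin: "finite {(i, j). i < j \<and> j \<in> S \<and> i \<notin> S}" if "S \<subseteq> {..<?n}" for S
    by (rule finite_subset[of _ "{..<?n} \<times> {..<?n}"]) (use that in auto)
  have 1: "inv (insert 0 (Suc ` S)) = inv S" for S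
  proof -
    have "{(i, j). i < j \<and> j \<in> insert 0 (Suc ` S) \<and> i \<notin> insert 0 (Suc ` S)}
        = map_prod Suc Suc ` {(i, j). i < j \<and> j \<in> S \<and> i \<notin> S}" (is "?A = ?B")
    proof (rule set_eqI)
      fix x show "x \<in> ?A \<longleftrightarrow> x \<in> ?B"
        by (cases x; cases "fst x"; cases "snd x") (auto simp: image_iff)
    qed
    then show ?thesis unfolding inv_def by (simp add: card_image inj_on_def)
  qed
  have 2: "inv (Suc ` S) = card S + inv S" if "S \<subseteq> {..<?n}" for S
  proof -
    have "{(i, j). i < j \<and> j \<in> Suc ` S \<and> i \<notin> Suc ` S}
        = (\<lambda>j. (0, Suc j)) ` S \<union> map_prod Suc Suc ` {(i, j). i < j \<and> j \<in> S \<and> i \<notin> S}" (is "?A = ?B")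
    proof (rule set_eqI)
      fix x show "x \<in> ?A \<longleftrightarrow> x \<in> ?B"
        by (cases x; cases "fst x"; cases "snd x") (auto simp: image_iff)
    qed
    moreover have "finite S" using that finite_subset by blast
    moreover have "card ((\<lambda>j. (0::nat, Suc j)) ` S) = card S" by (rule card_image) (auto simp: inj_on_def)
    moreover have "card (map_prod Suc Suc ` {(i, j). i < j \<and> j \<in> S \<and> i \<notin> S}) = inv S"
      unfolding inv_def by (rule card_image) (auto simp: inj_on_def)
    moreover have "finite {(i, j). i < j \<and> j \<in> S \<and> i \<notin> S}" by (rule fin[OF that])
    moreover have "(\<lambda>j. (0::nat, Suc j)) ` S \<inter> map_prod Suc Suc ` T = {}" for T by auto
    ultimately show ?thesis
      unfolding inv_def[of "Suc ` S"] by (simp only: card_Un_disjoint finite_imageI)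
  qed
  have e1: "{j. Suc j \<in> insert 0 (Suc ` S)} = S" for S by auto
  have n1: "nths (a # as) (insert 0 (Suc ` S)) = a # nths as S" for S
    unfolding nths_Cons e1 by simp
  have e2: "{j. Suc j \<in> - insert 0 (Suc ` S)} = - S" for S by auto
  have n2: "nths (a # as) (- insert 0 (Suc ` S)) = nths as (- S)" for S
    unfolding nths_Cons e2 by simp
  have e3: "{j. Suc j \<in> Suc ` S} = S" for S by auto
  have n3: "nths (a # as) (Suc ` S) = nths as S" for S
    unfolding nths_Cons e3 by simp
  have e4: "{j. Suc j \<in> - Suc ` S} = - S" for S by auto
  have n4: "nths (a # as) (- Suc ` S) = a # nths as (- S)" for S
    unfolding nths_Cons e4 by auto
  have l: "length (nths as S) = card S" if "S \<subseteq> {..<?n}" for S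
  proof -
    have "{i. i < ?n \<and> i \<in> S} = S" using that by auto
    then show ?thesis by (simp add: length_nths)
  qed
  have "wedge s t (a # as) = (\<Sum>S\<in>Pow {..<?n}.
      (-1) ^ inv S * s (a # nths as S) * t (nths as (- S)) +
      (-1) ^ (card S + inv S) * s (nths as S) * t (a # nths as (- S)))"
    unfolding wedge_def length_Cons sum_Pow_lessThan_Suc inv_def[symmetric]
    by (rule sum.cong[OF refl]) (simp add: 1 2 n1 n2 n3 n4 del: Compl_insert)
  also have "\<dots> = wedge (slot a s) t as + wedge (sgnt s) (slot a t) as"
    unfolding wedge_def inv_def[symmetric] sum.distrib[symmetric] sgnt_def
    by (rule sum.cong[OF refl]) (simp add: l power_add)
  finally show ?thesis .
qed

lemma wedge_zero_left: "(\<And>as. s as = 0) \<Longrightarrow> wedge s t as = 0"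
  by (simp add: wedge_def)

lemma wedge_cmult_left: "wedge (\<lambda>as. c * s as) t as = c * wedge s t as"
  by (simp add: wedge_def sum_distrib_left algebra_simps)

lemma wedge_const_left:
  assumes "\<And>bs. bs \<noteq> [] \<Longrightarrow> s bs = 0"
  shows "wedge s t as = s [] * t as"
  using assms
proof (induction as arbitrary: s t)
  case Nil
  then show ?case by (simp add: wedge_Nil)
next
  case (Cons a as)
  have "wedge (sgnt s) (slot a t) as = sgnt s [] * slot a t as"
    by (rule Cons.IH) (simp add: Cons.prems sgnt_def)
  then show ?case
    by (simp add: wedge_Cons wedge_zero_left Cons.prems) (simp add: sgnt_def)
qed

lemma wedge_one_form:
  assumes "\<And>bs. length bs \<noteq> 1 \<Longrightarrow> s bs = 0"
  shows "wedge s t as = wedge1 (\<lambda>a. s [a]) t as"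
proof (induction as arbitrary: t)
  case Nil
  then show ?case by (simp add: wedge_Nil assms)
next
  case (Cons a as)
  have "sgnt s = (\<lambda>as. (-1) * s as)"
  proof
    fix bs show "sgnt s bs = (-1) * s bs"
      using assms[of bs] by (cases "length bs = 1") (simp_all add: sgnt_def)
  qed
  then have "wedge (sgnt s) (slot a t) as = - wedge1 (\<lambda>a. s [a]) (slot a t) as"
    by (simp only: wedge_cmult_left Cons.IH) (simp add: slot_def)
  moreover have "wedge (slot a s) t as = slot a s [] * t as"
    by (rule wedge_const_left) (simp add: assms)
  ultimately show ?case by (simp add: wedge_Cons wedge1_Cons)
qed

text \<open>In even degree the interior product passes the first factor without a sign.\<close>

lemma wedge_two_form_Cons:
  assumes "\<And>bs. length bs \<noteq> 2 \<Longrightarrow> s bs = 0"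
  shows "wedge s t (a # as) = wedge1 (\<lambda>b. s [a, b]) t as + wedge s (slot a t) as"
proof -
  have "sgnt s = s"
  proof
    fix bs show "sgnt s bs = s bs"
      using assms[of bs] by (cases "length bs = 2") (simp_all add: sgnt_def)
  qed
  moreover have "wedge (slot a s) t as = wedge1 (\<lambda>b. slot a s [b]) t as"
    by (rule wedge_one_form) (simp add: assms)
  ultimately show ?thesis by (simp add: wedge_Cons)
qed

section \<open>Pointwise inner products and the adjoints of wedge operators\<close>

lemma finite_lists_length [simp]: "finite {as :: 'a::finite list. length as = k}"
  using finite_lists_length_eq[of "UNIV :: 'a set" k] by simp

lemma sum_lists_Suc:
  fixes f :: "'a::finite list \<Rightarrow> 'b::comm_monoid_add"
  shows "(\<Sum>as | length as = Suc k. f as) = (\<Sum>a\<in>UNIV. \<Sum>as | length as = k. f (a # as))"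
proof -
  have "{as :: 'a list. length as = Suc k} = (\<lambda>(a, as). a # as) ` (UNIV \<times> {as. length as = k})"
    by (auto simp: length_Suc_conv image_iff)
  then have "(\<Sum>as | length as = Suc k. f as) = (\<Sum>(a, as)\<in>UNIV \<times> {as. length as = k}. f (a # as))"
    by (simp add: sum.reindex inj_on_def case_prod_unfold)
  then show ?thesis by (simp add: sum.cartesian_product)
qed

text \<open>The part of \<open>tip\<close> of degree \<open>k\<close>, before the division by
  \<open>fact k\<close>. Arbitrary coefficients \<open>g\<close> are allowed, since the adjunction
  formulas are identities of sums.\<close>

definition tp :: "('n::finite cidx \<Rightarrow> 'n cidx \<Rightarrow> complex) \<Rightarrow> nat \<Rightarrow> 'n tensor \<Rightarrow> 'n tensor \<Rightarrow> complex" where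
  "tp g k s t = (\<Sum>as | length as = k. \<Sum>bs | length bs = k.
      (\<Prod>m<k. g (as ! m) (bs ! m)) * s as * cnj (t bs))"

lemma tip_tp: "tip w s t = (\<Sum>k\<le>2 * CARD('n). tp (cometric w) k s t / fact k)"
  for w :: "'n::finite tensor"
  by (simp add: tip_def tp_def)

lemma tp_0: "tp g 0 s t = s [] * cnj (t [])"
  by (simp add: tp_def)

lemma tp_Suc: "tp g (Suc k) s t = (\<Sum>a\<in>UNIV. \<Sum>b\<in>UNIV. g a b * tp g k (slot a s) (slot b t))"
proof -
  have "tp g (Suc k) s t = (\<Sum>a\<in>UNIV. \<Sum>as | length as = k. \<Sum>b\<in>UNIV. \<Sum>bs | length bs = k.
      g a b * ((\<Prod>m<k. g (as ! m) (bs ! m)) * s (a # as) * cnj (t (b # bs))))"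
    unfolding tp_def sum_lists_Suc
    by (intro sum.cong refl) (simp add: prod.lessThan_Suc_shift mult.assoc del: prod.lessThan_Suc)
  also have "\<dots> = (\<Sum>a\<in>UNIV. \<Sum>b\<in>UNIV. \<Sum>as | length as = k. \<Sum>bs | length bs = k.
      g a b * ((\<Prod>m<k. g (as ! m) (bs ! m)) * s (a # as) * cnj (t (b # bs))))"
    by (intro sum.cong refl) (rule sum.swap)
  finally show ?thesis by (simp add: tp_def sum_distrib_left)
qed

lemma tp_cong:
  assumes "\<And>as. length as = k \<Longrightarrow> s as = s' as" "\<And>as. length as = k \<Longrightarrow> t as = t' as"
  shows "tp g k s t = tp g k s' t'"
  unfolding tp_def using assms by (intro sum.cong refl) auto

lemma tp_zero_right: "tp g k s (\<lambda>as. 0) = 0"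
  by (simp add: tp_def)

lemma tp_add_left: "tp g k (\<lambda>as. s as + s' as) t = tp g k s t + tp g k s' t"
  by (simp add: tp_def sum.distrib algebra_simps)

lemma tp_add_right: "tp g k s (\<lambda>as. t as + t' as) = tp g k s t + tp g k s t'"
  by (simp add: tp_def sum.distrib algebra_simps)

lemma tp_cmult_left: "tp g k (\<lambda>as. c * s as) t = c * tp g k s t"
  by (simp add: tp_def sum_distrib_left algebra_simps)

lemma tp_cmult_right: "tp g k s (\<lambda>as. c * t as) = cnj c * tp g k s t"
  by (simp add: tp_def sum_distrib_left algebra_simps)

lemma tp_sum_right: "tp g k s (\<lambda>as. \<Sum>i\<in>I. f i as) = (\<Sum>i\<in>I. tp g k s (f i))"
  by (induction I rule: infinite_finite_induct) (auto simp: tp_zero_right tp_add_right)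

lemma tp_diff_left: "tp g k (\<lambda>as. s as - s' as) t = tp g k s t - tp g k s' t"
  using tp_add_left[of g k s "\<lambda>as. (-1) * s' as" t] unfolding tp_cmult_left by simp

lemma tp_diff_right: "tp g k s (\<lambda>as. t as - t' as) = tp g k s t - tp g k s t'"
  using tp_add_right[of g k s t "\<lambda>as. (-1) * t' as"] unfolding tp_cmult_right by simp

text \<open>The vector metrically dual to the \<open>1\<close>-form \<sigma>. The conjugate reflects
  that the product is conjugate linear in the argument on which the adjoint acts.\<close>

definition sharp :: "('n::finite cidx \<Rightarrow> 'n cidx \<Rightarrow> complex) \<Rightarrow> ('n cidx \<Rightarrow> complex) \<Rightarrow> 'n cidx \<Rightarrow> complex" where
  "sharp g \<sigma> b = (\<Sum>a\<in>UNIV. cnj (g a b * \<sigma> a))"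

lemma contract_slot: "skew w \<Longrightarrow> contract X (slot b w) = (\<lambda>as. (-1) * slot b (contract X w) as)"
  unfolding contract_def slot_def by (rule ext) (simp add: skew_swap[of w b] sum_negf)

lemma tp_contract_right: "tp g k s (contract X w) = (\<Sum>b\<in>UNIV. cnj (X b) * tp g k s (slot b w))"
  unfolding contract_def by (simp add: tp_sum_right tp_cmult_right slot_def)

lemma tp_sharp: "tp g k s (contract (sharp g \<sigma>) w) = (\<Sum>a\<in>UNIV. \<Sum>b\<in>UNIV. g a b * (\<sigma> a * tp g k s (slot b w)))"
  unfolding tp_contract_right sharp_def cnj_sum complex_cnj_cnj sum_distrib_right
  by (subst sum.swap) (simp add: mult.assoc)

text \<open>The factor \<open>k + 1\<close> counts the positions that the index of \<sigma> can
  take, and turns \<open>fact (Suc k)\<close> into \<open>fact k\<close>. In the induction, the term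
  in which \<sigma> does not take the first index gets one sign from \<open>wedge1_Cons\<close> and
  another from \<open>contract_slot\<close>.\<close>

lemma tp_wedge1:
  assumes "skew w"
  shows "tp g (Suc k) (wedge1 \<sigma> t) w = of_nat (Suc k) * tp g k t (contract (sharp g \<sigma>) w)"
  using assms
proof (induction k arbitrary: t w)
  case 0
  then show ?case
    by (simp add: tp_Suc tp_sharp wedge1_Cons tp_0 algebra_simps)
next
  case (Suc k)
  have slot: "slot a (wedge1 \<sigma> t) = (\<lambda>as. \<sigma> a * t as - wedge1 \<sigma> (slot a t) as)" for a
    by (auto simp: wedge1_Cons)
  have "tp g (Suc (Suc k)) (wedge1 \<sigma> t) w = (\<Sum>a\<in>UNIV. \<Sum>b\<in>UNIV. g a b * (\<sigma> a * tp g (Suc k) t (slot b w)))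
      - (\<Sum>a\<in>UNIV. \<Sum>b\<in>UNIV. g a b * tp g (Suc k) (wedge1 \<sigma> (slot a t)) (slot b w))"
    by (subst tp_Suc) (simp add: slot tp_diff_left tp_cmult_left right_diff_distrib sum_subtractf)
  also have "(\<Sum>a\<in>UNIV. \<Sum>b\<in>UNIV. g a b * tp g (Suc k) (wedge1 \<sigma> (slot a t)) (slot b w))
      = (\<Sum>a\<in>UNIV. \<Sum>b\<in>UNIV. - of_nat (Suc k) * (g a b * tp g k (slot a t) (slot b (contract (sharp g \<sigma>) w))))"
    by (intro sum.cong refl) (simp only: Suc.IH[OF skew_slot[OF Suc.prems]] contract_slot[OF Suc.prems] tp_cmult_right, simp add: slot_def algebra_simps)
  also have "\<dots> = - of_nat (Suc k) * tp g (Suc k) t (contract (sharp g \<sigma>) w)"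
    by (subst tp_Suc) (simp only: sum_distrib_left)
  also have "(\<Sum>a\<in>UNIV. \<Sum>b\<in>UNIV. g a b * (\<sigma> a * tp g (Suc k) t (slot b w)))
      = tp g (Suc k) t (contract (sharp g \<sigma>) w)"
    by (rule tp_sharp[symmetric])
  finally show ?case by (simp add: algebra_simps)
qed

text \<open>
  The adjoint of \<open>\<omega> \<and> \<cdot>\<close>; the factor \<open>1/2\<close> appears because \<open>\<omega>\<close> is the sum of
  \<open>1/2 \<omega> [a, e] dw\<^sub>a \<and> dw\<^sub>e\<close> over all pairs of indices.
\<close>

definition Lambda_at :: "('n::finite cidx \<Rightarrow> 'n cidx \<Rightarrow> complex) \<Rightarrow> 'n tensor \<Rightarrow> 'n tensor \<Rightarrow> 'n tensor" where
  "Lambda_at g \<omega> w = (\<lambda>as. \<Sum>a\<in>UNIV. \<Sum>b\<in>UNIV.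
      cnj (g a b) / 2 * contract (sharp g (\<lambda>e. \<omega> [a, e])) (slot b w) as)"

lemma Lambda_at_skew: "skew w \<Longrightarrow> skew (Lambda_at g \<omega> w)"
  unfolding Lambda_at_def by (intro skew_sum skew_cmult contract_skew skew_slot)

text \<open>Carrying \<open>b\<close> past two indices is an even permutation.\<close>

lemma Lambda_at_slot:
  assumes "skew w"
  shows "Lambda_at g \<omega> (slot b w) = slot b (Lambda_at g \<omega> w)"
proof
  fix as
  have "w (b # b' # d # as) = w (b' # d # b # as)" for b' d
    using skew_swap[OF assms, of b b' "d # as"] skew_swap[OF skew_slot[OF assms, of b'], of b d as] by simp
  then show "Lambda_at g \<omega> (slot b w) as = slot b (Lambda_at g \<omega> w) as"
    by (simp add: Lambda_at_def contract_def)
qed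

lemma tp_Lambda_at: "tp g k t (Lambda_at g \<omega> w) = (\<Sum>a\<in>UNIV. \<Sum>b\<in>UNIV.
    g a b * tp g k t (contract (sharp g (\<lambda>e. \<omega> [a, e])) (slot b w))) / 2"
  unfolding Lambda_at_def by (simp only: tp_sum_right tp_cmult_right) (simp add: sum_divide_distrib)

text \<open>The factor is the quotient of \<open>fact (k + 2)\<close> by \<open>fact k\<close>. In
  the induction step the first index goes either to \<omega>, which contributes
  \<open>2 * (k + 2)\<close>, or to \<open>t\<close>, which contributes
  \<open>(k + 1) * (k + 2)\<close>; together they give \<open>(k + 2) * (k + 3)\<close>.\<close>

lemma tp_wedge_two_form:
  assumes "\<And>bs. length bs \<noteq> 2 \<Longrightarrow> \<omega> bs = 0" "skew w"
  shows "tp g (Suc (Suc k)) (wedge \<omega> t) w = of_nat ((k + 1) * (k + 2)) * tp g k t (Lambda_at g \<omega> w)"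
  using assms(2)
proof (induction k arbitrary: t w)
  case 0
  have slot: "slot a (wedge \<omega> t) = (\<lambda>as. wedge1 (\<lambda>e. \<omega> [a, e]) t as + wedge \<omega> (slot a t) as)" for a
    by (auto simp: wedge_two_form_Cons[OF assms(1)])
  have z: "wedge \<omega> t [a] = 0" for t a
    by (simp add: wedge_two_form_Cons[OF assms(1)] wedge_Nil assms(1))
  have "tp g 1 (wedge \<omega> t') w' = 0" for t' w'
    by (simp add: tp_Suc tp_0 z)
  then have "tp g (Suc (Suc 0)) (wedge \<omega> t) w =
      (\<Sum>a\<in>UNIV. \<Sum>b\<in>UNIV. g a b * tp g (Suc 0) (wedge1 (\<lambda>e. \<omega> [a, e]) t) (slot b w))"
    by (subst tp_Suc) (simp add: slot tp_add_left)
  also have "\<dots> = 2 * tp g 0 t (Lambda_at g \<omega> w)"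
    by (simp add: tp_Lambda_at tp_wedge1[OF skew_slot[OF 0]])
  finally show ?case by simp
next
  case (Suc k)
  have slot: "slot a (wedge \<omega> t) = (\<lambda>as. wedge1 (\<lambda>e. \<omega> [a, e]) t as + wedge \<omega> (slot a t) as)" for a
    by (auto simp: wedge_two_form_Cons[OF assms(1)])
  have "tp g (Suc (Suc (Suc k))) (wedge \<omega> t) w =
      (\<Sum>a\<in>UNIV. \<Sum>b\<in>UNIV. g a b * tp g (Suc (Suc k)) (wedge1 (\<lambda>e. \<omega> [a, e]) t) (slot b w)) +
      (\<Sum>a\<in>UNIV. \<Sum>b\<in>UNIV. g a b * tp g (Suc (Suc k)) (wedge \<omega> (slot a t)) (slot b w))"
    by (subst tp_Suc) (simp add: slot tp_add_left sum.distrib distrib_left)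
  also have "(\<Sum>a\<in>UNIV. \<Sum>b\<in>UNIV. g a b * tp g (Suc (Suc k)) (wedge1 (\<lambda>e. \<omega> [a, e]) t) (slot b w))
     = 2 * of_nat (k + 2) * tp g (Suc k) t (Lambda_at g \<omega> w)"
  proof -
    have *: "2 * tp g (Suc k) t (Lambda_at g \<omega> w) = (\<Sum>a\<in>UNIV. \<Sum>b\<in>UNIV.
        g a b * tp g (Suc k) t (contract (sharp g (\<lambda>e. \<omega> [a, e])) (slot b w)))"
      by (simp add: tp_Lambda_at)
    show ?thesis
      unfolding mult.assoc mult.left_commute[of 2] * sum_distrib_left tp_wedge1[OF skew_slot[OF Suc.prems]]
      by (intro sum.cong refl) (simp add: mult.left_commute)
  qed
  also have "(\<Sum>a\<in>UNIV. \<Sum>b\<in>UNIV. g a b * tp g (Suc (Suc k)) (wedge \<omega> (slot a t)) (slot b w))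
     = of_nat ((k + 1) * (k + 2)) * tp g (Suc k) t (Lambda_at g \<omega> w)"
    unfolding Suc.IH[OF skew_slot[OF Suc.prems]] Lambda_at_slot[OF Suc.prems] tp_Suc[of g k]
    by (simp only: sum_distrib_left mult.left_commute[of "g _ _"])
  finally show ?case by (simp add: algebra_simps)
qed

lemma skew_large_zero:
  fixes t :: "'n::finite tensor"
  shows "skew t \<Longrightarrow> length as > 2 * CARD('n) \<Longrightarrow> t as = 0"
  using skew_degree_bound(1)[of t as] by fastforce

lemma tip_wedge1:
  fixes w :: "'n::finite tensor"
  assumes "skew u"
  shows "tip w (wedge1 \<sigma> t) u = tip w t (contract (sharp (cometric w) \<sigma>) u)"
proof -
  define N where "N = 2 * CARD('n)"
  have "N > 0" by (simp add: N_def)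
  then obtain M where M: "N = Suc M" by (cases N) auto
  let ?g = "cometric w"
  \<comment> \<open>At the top degree the contraction reads components of degree
    \<open>N + 1\<close>, which vanish by skew symmetry; so the shift of the summation index loses
    nothing.\<close>
  have "tp ?g N t (contract (sharp ?g \<sigma>) u) = tp ?g N t (\<lambda>as. 0)"
    by (rule tp_cong) (simp_all add: contract_def skew_large_zero[OF assms] N_def)
  then have z: "tp ?g N t (contract (sharp ?g \<sigma>) u) = 0" by (simp add: tp_zero_right)
  have "tip w (wedge1 \<sigma> t) u = (\<Sum>k\<le>Suc M. tp ?g k (wedge1 \<sigma> t) u / fact k)"
    by (simp only: tip_tp N_def[symmetric] M)
  also have "\<dots> = (\<Sum>k\<le>M. tp ?g (Suc k) (wedge1 \<sigma> t) u / fact (Suc k))"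
    by (simp only: sum.atMost_Suc_shift) (simp add: tp_0)
  also have "\<dots> = (\<Sum>k\<le>M. tp ?g k t (contract (sharp ?g \<sigma>) u) / fact k)"
    unfolding tp_wedge1[OF assms] fact_Suc
    by (intro sum.cong refl mult_divide_mult_cancel_left) (simp del: of_nat_Suc)
  also have "\<dots> = (\<Sum>k\<le>Suc M. tp ?g k t (contract (sharp ?g \<sigma>) u) / fact k)"
    using z by (simp add: M)
  finally show ?thesis by (simp only: tip_tp N_def[symmetric] M)
qed

lemma tip_wedge_two_form:
  fixes w :: "'n::finite tensor"
  assumes "\<And>bs. length bs \<noteq> 2 \<Longrightarrow> \<omega> bs = 0" "skew u"
  shows "tip w (wedge \<omega> t) u = tip w t (Lambda_at (cometric w) \<omega> u)"
proof -
  define N where "N = 2 * CARD('n)"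
  have "N > 1" using zero_less_card_finite[where 'a='n] unfolding N_def by linarith
  then obtain M where M: "N = Suc (Suc M)" by (cases N; cases "N - 1") auto
  let ?g = "cometric w"
  \<comment> \<open>In degree \<open>k\<close> the adjoint reads components of \<open>u\<close> of
    degree \<open>k + 2\<close>, so the two top degrees contribute nothing.\<close>
  have z: "tp ?g k t (Lambda_at ?g \<omega> u) = 0" if "k + 2 > N" for k
  proof -
    have "tp ?g k t (Lambda_at ?g \<omega> u) = tp ?g k t (\<lambda>as. 0)"
      by (rule tp_cong) (use that in \<open>simp_all add: Lambda_at_def contract_def skew_large_zero[OF assms(2)] N_def\<close>)
    then show ?thesis by (simp add: tp_zero_right)
  qed
  have w0: "wedge \<omega> t [] = 0" "tp ?g 1 (wedge \<omega> t) u = 0"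
    by (simp_all add: wedge_Nil assms(1) tp_Suc tp_0 wedge_two_form_Cons[OF assms(1)])
  have "tip w (wedge \<omega> t) u = (\<Sum>k\<le>Suc (Suc M). tp ?g k (wedge \<omega> t) u / fact k)"
    by (simp only: tip_tp N_def[symmetric] M)
  also have "\<dots> = (\<Sum>k\<le>M. tp ?g (Suc (Suc k)) (wedge \<omega> t) u / fact (Suc (Suc k)))"
    using w0 by (simp only: sum.atMost_Suc_shift) (simp add: tp_0)
  also have "\<dots> = (\<Sum>k\<le>M. tp ?g k t (Lambda_at ?g \<omega> u) / fact k)"
  proof (rule sum.cong[OF refl])
    fix k
    have f: "fact (Suc (Suc k)) = of_nat ((k + 1) * (k + 2)) * (fact k :: complex)"
      by (simp add: algebra_simps)
    have e: "tp ?g (Suc (Suc k)) (wedge \<omega> t) u = of_nat ((k + 1) * (k + 2)) * tp ?g k t (Lambda_at ?g \<omega> u)"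
      by (rule tp_wedge_two_form[OF assms])
    show "tp ?g (Suc (Suc k)) (wedge \<omega> t) u / fact (Suc (Suc k)) = tp ?g k t (Lambda_at ?g \<omega> u) / fact k"
      unfolding e f by (rule mult_divide_mult_cancel_left) (simp only: of_nat_eq_0_iff, simp)
  qed
  also have "\<dots> = (\<Sum>k\<le>Suc (Suc M). tp ?g k t (Lambda_at ?g \<omega> u) / fact k)"
    using z by (simp add: M)
  finally show ?thesis by (simp only: tip_tp N_def[symmetric] M)
qed

section \<open>Hermitian metrics at a point\<close>

text \<open>The transformation rule in \<open>forms\<close>, for an arbitrary matrix in place of the
  Jacobian, so that it also serves for changes of coframe.\<close>

definition pull :: "('n::finite cidx \<Rightarrow> 'n cidx \<Rightarrow> complex) \<Rightarrow> 'n tensor \<Rightarrow> 'n tensor" where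
  "pull J U as = (\<Sum>bs | length bs = length as. (\<Prod>m<length as. J (bs ! m) (as ! m)) * U bs)"

lemma pull_Nil [simp]: "pull J U [] = U []"
  by (simp add: pull_def)

lemma pull_Cons: "pull J U (a # as) = (\<Sum>b\<in>UNIV. J b a * pull J (slot b U) as)"
  unfolding pull_def length_Cons sum_lists_Suc
  by (simp add: prod.lessThan_Suc_shift sum_distrib_left mult.assoc del: prod.lessThan_Suc)

lemma pull_sum: "pull J (\<lambda>as. \<Sum>i\<in>I. f i as) as = (\<Sum>i\<in>I. pull J (f i) as)"
  unfolding pull_def by (simp add: sum_distrib_left sum.swap[of _ I])

lemma pull_cmult: "pull J (\<lambda>as. c * U as) as = c * pull J U as"
  by (simp add: pull_def sum_distrib_left algebra_simps)

lemma pull_diff: "pull J (\<lambda>as. U as - V as) as = pull J U as - pull J V as"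
  by (simp add: pull_def sum_subtractf algebra_simps)

lemma slot_pull: "slot a (pull J U) = (\<lambda>as. \<Sum>b\<in>UNIV. J b a * pull J (slot b U) as)"
  by (auto simp: pull_Cons)

lemma pull_id: "pull (\<lambda>b a. if b = a then 1 else 0) U as = U as"
  by (induction as arbitrary: U) (simp_all add: pull_Cons if_distrib[of "\<lambda>x. x * _"] cong: if_cong)

lemma pull_comp: "pull K (pull J U) as = pull (\<lambda>c a. \<Sum>b\<in>UNIV. J c b * K b a) U as"
proof (induction as arbitrary: U)
  case (Cons a as)
  have "pull K (pull J U) (a # as) = (\<Sum>b\<in>UNIV. \<Sum>c\<in>UNIV. K b a * (J c b * pull K (pull J (slot c U)) as))"
    by (subst pull_Cons) (simp only: slot_pull pull_sum pull_cmult sum_distrib_left)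
  also have "\<dots> = (\<Sum>c\<in>UNIV. \<Sum>b\<in>UNIV. K b a * (J c b * pull K (pull J (slot c U)) as))"
    by (rule sum.swap)
  also have "\<dots> = pull (\<lambda>c a. \<Sum>b\<in>UNIV. J c b * K b a) U (a # as)"
    unfolding pull_Cons Cons.IH sum_distrib_right by (intro sum.cong refl) (simp add: mult_ac)
  finally show ?case .
qed simp

section \<open>Orthonormal coframes and definiteness\<close>

text \<open>A Gram factorization of \<open>g\<close> amounts to a change to an orthonormal coframe,
  in which the product is the standard one on components.\<close>

lemma tp_factor:
  fixes g :: "'n::finite cidx \<Rightarrow> 'n cidx \<Rightarrow> complex"
  assumes "\<And>a b. g a b = (\<Sum>c\<in>UNIV. E c a * cnj (E c b))"
  shows "tp g k s t = (\<Sum>cs | length cs = k. pull (\<lambda>a c. E c a) s cs * cnj (pull (\<lambda>a c. E c a) t cs))"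
proof (induction k arbitrary: s t)
  case 0
  then show ?case by (simp add: tp_0)
next
  case (Suc k)
  let ?p = "pull (\<lambda>a c. E c a)"
  let ?f = "\<lambda>a b c cs. (E c a * ?p (slot a s) cs) * cnj (E c b * ?p (slot b t) cs)"
  let ?L = "{cs :: 'n cidx list. length cs = k}"
  have "tp g (Suc k) s t = (\<Sum>a\<in>UNIV. \<Sum>b\<in>UNIV. \<Sum>c\<in>UNIV. \<Sum>cs\<in>?L. ?f a b c cs)"
    unfolding tp_Suc Suc.IH assms sum_distrib_left sum_distrib_right
    by (rule sum.cong[OF refl], rule sum.cong[OF refl], rule trans[OF sum.swap],
        intro sum.cong refl, simp add: mult_ac)
  also have "\<dots> = (\<Sum>a\<in>UNIV. \<Sum>c\<in>UNIV. \<Sum>b\<in>UNIV. \<Sum>cs\<in>?L. ?f a b c cs)"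
    by (rule sum.cong[OF refl], rule sum.swap)
  also have "\<dots> = (\<Sum>c\<in>UNIV. \<Sum>a\<in>UNIV. \<Sum>b\<in>UNIV. \<Sum>cs\<in>?L. ?f a b c cs)"
    by (rule sum.swap)
  also have "\<dots> = (\<Sum>c\<in>UNIV. \<Sum>a\<in>UNIV. \<Sum>cs\<in>?L. \<Sum>b\<in>UNIV. ?f a b c cs)"
    by (rule sum.cong[OF refl], rule sum.cong[OF refl], rule sum.swap)
  also have "\<dots> = (\<Sum>c\<in>UNIV. \<Sum>cs\<in>?L. \<Sum>a\<in>UNIV. \<Sum>b\<in>UNIV. ?f a b c cs)"
    by (rule sum.cong[OF refl], rule sum.swap)
  also have "\<dots> = (\<Sum>cs | length cs = Suc k. ?p s cs * cnj (?p t cs))"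
    unfolding sum_lists_Suc pull_Cons cnj_sum sum_product ..
  finally show ?case .
qed

text \<open>Cholesky factorization by induction on the index set: one index \<open>x\<close> is
  split off, and the induction hypothesis is applied to the Schur complement
  \<open>g'\<close>.\<close>

lemma cholesky:
  fixes g :: "'i \<Rightarrow> 'i \<Rightarrow> complex"
  assumes "finite I"
    and "\<And>a b. a \<in> I \<Longrightarrow> b \<in> I \<Longrightarrow> g b a = cnj (g a b)"
    and "\<And>z. \<exists>i\<in>I. z i \<noteq> 0 \<Longrightarrow> 0 < Re (\<Sum>a\<in>I. \<Sum>b\<in>I. g a b * z a * cnj (z b))"
  shows "\<exists>m. \<forall>a\<in>I. \<forall>b\<in>I. g a b = (\<Sum>c\<in>I. m c a * cnj (m c b))"
  using assms
proof (induction I arbitrary: g rule: finite_induct)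
  case empty
  then show ?case by simp
next
  case (insert x F)
  define d where "d = Re (g x x)"
  have gxx: "g x x = of_real d"
    using insert.prems(1)[of x x] by (simp add: d_def complex_eq_iff)
  have "0 < d"
  proof -
    let ?z = "\<lambda>i. if i = x then 1 else (0::complex)"
    have "(\<Sum>a\<in>insert x F. \<Sum>b\<in>insert x F. g a b * ?z a * cnj (?z b)) = g x x"
    proof -
      have "(\<Sum>b\<in>insert x F. g a b * ?z a * cnj (?z b)) = g a x * ?z a" for a
        using insert.hyps by (simp add: sum.delta' if_distrib cong: if_cong)
      then show ?thesis using insert.hyps by simp (auto intro!: sum.neutral)
    qed
    then show ?thesis using insert.prems(2)[of ?z] by (simp add: d_def)
  qed
  define g' where "g' a b = g a b - g a x * cnj (g b x) / of_real d" for a b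
  have "\<exists>m. \<forall>a\<in>F. \<forall>b\<in>F. g' a b = (\<Sum>c\<in>F. m c a * cnj (m c b))"
  proof (rule insert.IH)
    show "g' b a = cnj (g' a b)" if "a \<in> F" "b \<in> F" for a b
      using insert.prems(1)[of a b] that by (simp add: g'_def mult.commute)
    show "0 < Re (\<Sum>a\<in>F. \<Sum>b\<in>F. g' a b * z a * cnj (z b))" if z: "\<exists>i\<in>F. z i \<noteq> 0" for z
    proof -
      let ?Q = "(\<Sum>a\<in>F. \<Sum>b\<in>F. g a b * z a * cnj (z b))"
      define S where "S = (\<Sum>a\<in>F. g a x * z a)"
      \<comment> \<open>The coordinate at \<open>x\<close> that minimizes the quadratic form with
        the others fixed; the minimum is the value of the Schur complement at \<open>z\<close>,
        which is therefore positive.\<close>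
      define z' where "z' i = (if i = x then - S / of_real d else z i)" for i
      have z'F: "z' i = z i" if "i \<in> F" for i using that insert.hyps by (auto simp: z'_def)
      have gx: "g x b = cnj (g b x)" if "b \<in> F" for b using insert.prems(1)[of b x] that by simp
      have S': "(\<Sum>b\<in>F. g x b * cnj (z b)) = cnj S"
        unfolding S_def cnj_sum by (rule sum.cong) (auto simp: gx)
      have "(\<Sum>a\<in>insert x F. \<Sum>b\<in>insert x F. g a b * z' a * cnj (z' b)) =
          (g x x * z' x * cnj (z' x) + (\<Sum>b\<in>F. g x b * z' x * cnj (z b)))
          + (\<Sum>a\<in>F. g a x * z a * cnj (z' x) + (\<Sum>b\<in>F. g a b * z a * cnj (z b)))"
        using insert.hyps by (simp add: z'F cong: sum.cong)
      also have "(\<Sum>b\<in>F. g x b * z' x * cnj (z b)) = z' x * cnj S"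
        unfolding S'[symmetric] sum_distrib_left by (rule sum.cong) auto
      also have "(\<Sum>a\<in>F. g a x * z a * cnj (z' x) + (\<Sum>b\<in>F. g a b * z a * cnj (z b)))
          = S * cnj (z' x) + ?Q"
        unfolding S_def sum_distrib_right sum.distrib ..
      also have "g x x * z' x * cnj (z' x) + z' x * cnj S +
          (S * cnj (z' x) + ?Q)
          = ?Q - S * cnj S / of_real d"
        using \<open>0 < d\<close> by (simp add: z'_def gxx field_simps)
      also have "S * cnj S / of_real d = (\<Sum>a\<in>F. \<Sum>b\<in>F. g a x * cnj (g b x) / of_real d * z a * cnj (z b))"
        unfolding S_def cnj_sum sum_product sum_divide_distrib by (intro sum.cong refl) simp
      also have "?Q - \<dots> = (\<Sum>a\<in>F. \<Sum>b\<in>F. g' a b * z a * cnj (z b))"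
        unfolding sum_subtractf[symmetric] g'_def by (intro sum.cong refl) (simp add: algebra_simps)
      finally show ?thesis
        using insert.prems(2)[of z'] z z'F by force
    qed
  qed
  then obtain m where m: "\<forall>a\<in>F. \<forall>b\<in>F. g' a b = (\<Sum>c\<in>F. m c a * cnj (m c b))" by blast
  \<comment> \<open>The new row is the column of \<open>x\<close> scaled by
    \<open>1 / sqrt d\<close>; the old rows are extended by 0 at \<open>x\<close>.\<close>
  define m' where "m' c a = (if c = x then g a x / of_real (sqrt d) else if a = x then 0 else m c a)" for c a
  have sq: "complex_of_real (sqrt d) * complex_of_real (sqrt d) = of_real d"
    using \<open>0 < d\<close> by (simp flip: of_real_mult)
  have mF: "(\<Sum>c\<in>F. m' c a * cnj (m' c b)) = (if a = x \<or> b = x then 0 else (\<Sum>c\<in>F. m c a * cnj (m c b)))" for a b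
  proof -
    have "(\<Sum>c\<in>F. m' c a * cnj (m' c b)) = (\<Sum>c\<in>F. if a = x \<or> b = x then 0 else m c a * cnj (m c b))"
      using insert.hyps by (intro sum.cong refl) (auto simp: m'_def)
    then show ?thesis by simp
  qed
  have "g a b = (\<Sum>c\<in>insert x F. m' c a * cnj (m' c b))" if ab: "a \<in> insert x F" "b \<in> insert x F" for a b
  proof -
    have x: "m' x a * cnj (m' x b) = g a x * cnj (g b x) / of_real d"
      by (simp add: m'_def sq)
    have "(\<Sum>c\<in>insert x F. m' c a * cnj (m' c b)) = g a x * cnj (g b x) / of_real d +
        (if a = x \<or> b = x then 0 else (\<Sum>c\<in>F. m c a * cnj (m c b)))"
      using insert.hyps by (simp add: x mF)
    also have "\<dots> = g a b"
    proof (cases "a = x \<or> b = x")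
      case True
      then show ?thesis
        using \<open>0 < d\<close> insert.prems(1)[OF ab] gxx by auto
    next
      case False
      then have "a \<in> F" "b \<in> F" using ab by auto
      then show ?thesis using False m g'_def[of a b] by simp
    qed
    finally show ?thesis ..
  qed
  then show ?case by blast
qed

lemma wedge_cmult_right: "wedge s (\<lambda>as. c * t as) as = c * wedge s t as"
  by (simp add: wedge_def sum_distrib_left algebra_simps)

lemma wedge_sum_right: "wedge s (\<lambda>as. \<Sum>i\<in>I. f i as) as = (\<Sum>i\<in>I. wedge s (f i) as)"
  unfolding wedge_def by (simp add: sum_distrib_left sum.swap[of _ I])

text \<open>Lets the adjunction of \<open>wedge1\<close> be applied to \<open>wedge w r\<close> in
  the computation of the commutator.\<close>

lemma wedge_two_form_skew:
  assumes "\<And>bs. length bs \<noteq> 2 \<Longrightarrow> s bs = 0" "skew s" "skew t"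
  shows "skew (wedge s t)"
proof -
  have "skew_at n (wedge s t)" if "skew t" for n t
    using that
  proof (induction n arbitrary: t)
    case 0
    then show ?case by (simp add: skew_at_def)
  next
    case (Suc n)
    show ?case
    proof (rule skew_at_SucI)
      fix a
      have "skew_at n (wedge s (slot a t))" by (rule Suc.IH) (rule skew_slot[OF Suc.prems])
      moreover have "skew_at n (wedge1 (\<lambda>b. s [a, b]) t)"
        using wedge1_skew[OF Suc.prems] skew_iff_skew_at by blast
      ultimately show "skew_at n (slot a (wedge s t))"
        by (simp add: skew_at_def wedge_two_form_Cons[OF assms(1)])
    next
      fix a b :: "'a cidx" and as
      have "slot b (slot a t) = (\<lambda>cs. (-1) * slot a (slot b t) cs)"
        using skew_swap[OF Suc.prems, where a = a and b = b] by auto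
      then have "wedge s (slot b (slot a t)) as = - wedge s (slot a (slot b t)) as"
        by (simp only: wedge_cmult_right) (simp add: slot_def)
      then show "wedge s t (a # b # as) = - wedge s t (b # a # as)"
        using skew_swap[OF assms(2), of a b "[]"]
        by (simp add: wedge_two_form_Cons[OF assms(1)] wedge1_Cons)
    qed
  qed
  then show ?thesis using assms(3) by (simp add: skew_iff_skew_at)
qed

text \<open>The antiderivation rule for a general vector; there is no sign because \<open>s\<close>
  has even degree.\<close>

lemma contract_wedge_two_form:
  assumes "\<And>bs. length bs \<noteq> 2 \<Longrightarrow> s bs = 0"
  shows "contract Y (wedge s t) as = wedge1 (\<lambda>e. \<Sum>b\<in>UNIV. Y b * s [b, e]) t as + wedge s (contract Y t) as"
proof -
  have "wedge s (contract Y t) as = (\<Sum>b\<in>UNIV. Y b * wedge s (slot b t) as)"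
    unfolding contract_def by (simp add: wedge_sum_right wedge_cmult_right slot_def)
  moreover have "wedge1 (\<lambda>e. \<Sum>b\<in>UNIV. Y b * s [b, e]) t as = (\<Sum>b\<in>UNIV. Y b * wedge1 (\<lambda>e. s [b, e]) t as)"
    unfolding wedge1_def by (simp add: sum_distrib_right alt_sum mult.assoc alt_cmult)
  ultimately show ?thesis
    by (simp add: contract_def wedge_two_form_Cons[OF assms] sum.distrib distrib_left)
qed

locale hermitian_point =
  fixes w :: "'n::finite tensor"
  assumes pos: "pos_11 w" and skew_w: "skew w"
begin

abbreviation "h \<equiv> hmat w"
abbreviation "hi \<equiv> matrix_inv (hmat w)"

lemma two_form: "length bs \<noteq> 2 \<Longrightarrow> w bs = 0"
proof (rule ccontr)
  assume "length bs \<noteq> 2" "w bs \<noteq> 0"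
  then have "hdeg bs = 1" "adeg bs = 1" using pos by (auto simp: pos_11_def)
  moreover have "hdeg bs + adeg bs = length bs"
    unfolding hdeg_def adeg_def by (rule sum_length_filter_compl)
  ultimately show False using \<open>length bs \<noteq> 2\<close> by simp
qed

lemma w_comps:
  "w [Inl j, Inr k] = \<i> * h $ j $ k" "w [Inr k, Inl j] = - \<i> * h $ j $ k"
  "w [Inl j, Inl k] = 0" "w [Inr j, Inr k] = 0"
proof -
  show 1: "w [Inl j, Inr k] = \<i> * h $ j $ k" for j k by (simp add: hmat_def)
  show "w [Inr k, Inl j] = - \<i> * h $ j $ k"
    using skew_swap[OF skew_w, of "Inr k" "Inl j" "[]"] 1[of j k] by simp
  have "w as \<noteq> 0 \<Longrightarrow> hdeg as = 1" for as using pos by (auto simp: pos_11_def)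
  from this[of "[Inl j, Inl k]"] this[of "[Inr j, Inr k]"]
  show "w [Inl j, Inl k] = 0" "w [Inr j, Inr k] = 0" by (auto simp: hdeg_def)
qed

definition Q :: "complex^'n \<Rightarrow> complex^'n \<Rightarrow> complex" where
  "Q u v = (\<Sum>j\<in>UNIV. \<Sum>k\<in>UNIV. h $ j $ k * u $ j * cnj (v $ k))"

lemma Q_pos: "v \<noteq> 0 \<Longrightarrow> 0 < Re (Q v v)" and Q_real: "Im (Q v v) = 0"
proof -
  show "v \<noteq> 0 \<Longrightarrow> 0 < Re (Q v v)"
    using pos by (simp add: pos_11_def Q_def Let_def)
  show "Im (Q v v) = 0"
  proof (cases "v = 0")
    case True
    then show ?thesis by (simp add: Q_def)
  next
    case False
    then show ?thesis using pos by (simp add: pos_11_def Q_def Let_def complex_is_Real_iff)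
  qed
qed

lemma Q_axis: "Q (axis a x) (axis b y) = h $ a $ b * x * cnj y"
proof -
  have "(\<Sum>k\<in>UNIV. h $ j $ k * axis a x $ j * cnj (axis b y $ k)) = h $ j $ b * axis a x $ j * cnj y" for j
    by (simp add: axis_def if_distrib[of cnj] if_distrib[of "\<lambda>x. _ * x"] cong: if_cong)
  then show ?thesis
    by (simp add: Q_def) (simp add: axis_def if_distrib[of "\<lambda>x. _ * x"] if_distrib[of "\<lambda>x. x * _"] cong: if_cong)
qed

lemma Q_add: "Q (u + v) (u + v) = Q u u + Q u v + Q v u + Q v v"
  by (simp add: Q_def algebra_simps sum.distrib)

text \<open>\<open>pos_11\<close> only says that the quadratic form is real. Polarization along
  \<open>axis j 1 + axis k y\<close> with \<open>y\<close> equal to 1 and to \<i> gives the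
  imaginary and the real parts of Hermitian symmetry.\<close>

lemma h_hermitian: "h $ k $ j = cnj (h $ j $ k)"
proof -
  have 1: "Im (Q (axis j 1) (axis k y) + Q (axis k y) (axis j 1)) = 0" for y
    using Q_real[of "axis j 1 + axis k y"] Q_real[of "axis j 1"] Q_real[of "axis k y"]
    unfolding Q_add by simp
  show ?thesis
    using 1[of 1] 1[of \<i>] by (simp add: Q_axis complex_eq_iff)
qed

lemma h_factor: "\<exists>P :: complex^'n^'n. \<forall>j k. h $ j $ k = (\<Sum>c\<in>UNIV. P $ c $ j * cnj (P $ c $ k))"
proof -
  have "\<exists>m. \<forall>a\<in>UNIV. \<forall>b\<in>UNIV. h $ a $ b = (\<Sum>c\<in>(UNIV :: 'n set). m c a * cnj (m c b))"
  proof (rule cholesky)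
    fix z :: "'n \<Rightarrow> complex" assume "\<exists>i\<in>UNIV. z i \<noteq> 0"
    then have "(\<chi> i. z i) \<noteq> 0" by (auto simp: vec_eq_iff)
    from Q_pos[OF this] show "0 < Re (\<Sum>a\<in>UNIV. \<Sum>b\<in>UNIV. h $ a $ b * z a * cnj (z b))"
      by (simp add: Q_def)
  qed (rule finite, rule h_hermitian)
  then obtain m where "\<forall>a b. h $ a $ b = (\<Sum>c\<in>(UNIV :: 'n set). m c a * cnj (m c b))" by auto
  then show ?thesis by (intro exI[of _ "\<chi> c j. m c j"]) simp
qed

text \<open>The covectors \<zeta> = \<open>P dz\<close> form an orthonormal coframe of type (1,0):
  the metric is the sum of \<i> \<zeta> \<and> \<open>cnj\<close> \<zeta> over them.\<close>

definition P :: "complex^'n^'n" where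
  "P = (SOME P. \<forall>j k. h $ j $ k = (\<Sum>c\<in>UNIV. P $ c $ j * cnj (P $ c $ k)))"

lemma P: "h $ j $ k = (\<Sum>c\<in>UNIV. P $ c $ j * cnj (P $ c $ k))"
  using someI_ex[OF h_factor, folded P_def] by blast

lemma invertible_h: "invertible h"
proof -
  have "x = 0" if "h *v x = 0" for x
  proof (rule ccontr)
    assume "x \<noteq> 0"
    then have "(\<chi> i. cnj (x $ i)) \<noteq> 0" by (auto simp: vec_eq_iff)
    moreover have "Q (\<chi> i. cnj (x $ i)) (\<chi> i. cnj (x $ i)) = (\<Sum>j\<in>UNIV. cnj (x $ j) * (h *v x) $ j)"
      by (simp add: Q_def matrix_vector_mult_def sum_distrib_left mult_ac)
    ultimately show False using that Q_pos by force
  qed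
  then show ?thesis
    using matrix_left_invertible_ker invertible_left_inverse by blast
qed

lemma h_hi: "h ** hi = mat 1" and hi_h: "hi ** h = mat 1"
proof -
  have "h ** hi = mat 1 \<and> hi ** h = mat 1"
    unfolding matrix_inv_def by (rule someI_ex) (use invertible_h in \<open>simp add: invertible_def\<close>)
  then show "h ** hi = mat 1" "hi ** h = mat 1" by auto
qed

lemma h_hi_comp: "(\<Sum>k\<in>UNIV. h $ i $ k * hi $ k $ j) = (if i = j then 1 else 0)"
  using h_hi by (simp add: matrix_matrix_mult_def mat_def vec_eq_iff)

lemma hi_h_comp: "(\<Sum>k\<in>UNIV. hi $ i $ k * h $ k $ j) = (if i = j then 1 else 0)"
  using hi_h by (simp add: matrix_matrix_mult_def mat_def vec_eq_iff)

lemma h_P: "h = transpose P ** (\<chi> i j. cnj (P $ i $ j))"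
  by (simp add: vec_eq_iff matrix_matrix_mult_def transpose_def P)

lemma det_h_P: "det h = det P * cnj (det P)"
proof -
  have "det (\<chi> i j. cnj (P $ i $ j)) = cnj (det P)"
    by (simp add: det_def)
  then show ?thesis by (subst h_P) (simp add: det_mul)
qed

lemma P_invertible: "invertible P"
  using invertible_h by (auto simp: invertible_det_nz det_h_P)

text \<open>The squared modulus of \<open>det P\<close>; it makes the volume density
  positive.\<close>

lemma det_h: "\<exists>d>0. det h = complex_of_real d"
  using P_invertible complex_norm_square[of "det P"]
  by (intro exI[of _ "(norm (det P))^2"]) (simp add: invertible_det_nz det_h_P)

definition N :: "complex^'n^'n" where "N = matrix_inv P"

lemma P_N: "P ** N = mat 1" and N_P: "N ** P = mat 1"
proof -
  have "P ** N = mat 1 \<and> N ** P = mat 1"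
    unfolding N_def matrix_inv_def by (rule someI_ex) (use P_invertible in \<open>simp add: invertible_def\<close>)
  then show "P ** N = mat 1" "N ** P = mat 1" by auto
qed

lemma P_N_comp: "(\<Sum>k\<in>UNIV. P $ i $ k * N $ k $ j) = (if i = j then 1 else 0)"
  using P_N by (simp add: matrix_matrix_mult_def mat_def vec_eq_iff)

lemma N_P_comp: "(\<Sum>k\<in>UNIV. N $ i $ k * P $ k $ j) = (if i = j then 1 else 0)"
  using N_P by (simp add: matrix_matrix_mult_def mat_def vec_eq_iff)

lemma hi_factor: "hi $ j $ k = (\<Sum>c\<in>UNIV. cnj (N $ j $ c) * N $ k $ c)"
proof -
  let ?B = "\<chi> j k. \<Sum>c\<in>UNIV. cnj (N $ j $ c) * N $ k $ c"
  have Q: "?B = (\<chi> i j. cnj (N $ i $ j)) ** transpose N"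
    by (simp add: vec_eq_iff matrix_matrix_mult_def transpose_def)
  have "cnj (\<Sum>k\<in>UNIV. P $ i $ k * N $ k $ j) = (if i = j then 1 else 0)" for i j
    by (simp only: P_N_comp) simp
  then have C: "(\<chi> i j. cnj (P $ i $ j)) ** (\<chi> i j. cnj (N $ i $ j)) = mat 1"
    by (simp add: vec_eq_iff matrix_matrix_mult_def mat_def)
  have "h ** ?B = transpose P ** ((\<chi> i j. cnj (P $ i $ j)) ** (\<chi> i j. cnj (N $ i $ j))) ** transpose N"
    unfolding Q by (subst h_P) (simp add: matrix_mul_assoc)
  also have "\<dots> = transpose (N ** P)"
    unfolding C by (simp add: matrix_transpose_mul)
  finally have "h ** ?B = mat 1" by (simp add: N_P transpose_mat)
  then have "hi ** (h ** ?B) = hi" by simp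
  then have "?B = hi" by (simp add: matrix_mul_assoc hi_h)
  then show ?thesis by (simp add: vec_eq_iff)
qed

text \<open>\<open>E c a\<close> is the coefficient of the orthonormal covector with index
  \<open>c\<close> in the coordinate covector with index \<open>a\<close>; \<open>E'\<close> is the
  inverse change of coframe.\<close>

fun E :: "'n cidx \<Rightarrow> 'n cidx \<Rightarrow> complex" where
  "E (Inl c) (Inl j) = N $ j $ c"
| "E (Inr c) (Inr j) = cnj (N $ j $ c)"
| "E (Inl c) (Inr j) = 0"
| "E (Inr c) (Inl j) = 0"

fun E' :: "'n cidx \<Rightarrow> 'n cidx \<Rightarrow> complex" where
  "E' (Inl c) (Inl j) = P $ j $ c"
| "E' (Inr c) (Inr j) = cnj (P $ j $ c)"
| "E' (Inl c) (Inr j) = 0"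
| "E' (Inr c) (Inl j) = 0"

lemma cometric_factor: "cometric w a b = (\<Sum>c\<in>UNIV. E c a * cnj (E c b))"
  by (cases a; cases b) (simp_all add: sum_cidx hi_factor mult.commute)

lemma E_E': "(\<Sum>b\<in>UNIV. E b c * E' a b) = (if c = a then 1 else 0)"
proof -
  have "cnj (\<Sum>k\<in>UNIV. N $ i $ k * P $ k $ j) = (if i = j then 1 else 0)" for i j
    by (simp only: N_P_comp) simp
  then have "(\<Sum>k\<in>UNIV. cnj (N $ i $ k) * cnj (P $ k $ j)) = (if i = j then 1 else 0)" for i j
    by (simp only: cnj_sum complex_cnj_mult)
  then show ?thesis
    by (cases a; cases c) (simp_all add: sum_cidx N_P_comp)
qed

text \<open>Components with respect to the orthonormal coframe; in them \<open>tip\<close> of a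
  tensor with itself is a weighted sum of squares, see \<open>tip_self\<close>.\<close>

definition frame :: "'n tensor \<Rightarrow> 'n tensor" where
  "frame = pull (\<lambda>a c. E c a)"

lemma frame_injective:
  assumes "\<And>cs. length cs = k \<Longrightarrow> frame s cs = 0" "length as = k"
  shows "s as = 0"
proof -
  have "pull (\<lambda>b a. E' a b) (frame s) as = s as"
    unfolding frame_def pull_comp E_E' by (rule pull_id)
  moreover have "pull (\<lambda>b a. E' a b) (frame s) as = 0"
    unfolding pull_def using assms by (intro sum.neutral) auto
  ultimately show ?thesis by simp
qed

lemma tp_frame: "tp (cometric w) k s t = (\<Sum>cs | length cs = k. frame s cs * cnj (frame t cs))"
  unfolding frame_def by (rule tp_factor) (rule cometric_factor)

lemma tip_hermitian: "tip w t s = cnj (tip w s t)"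
  by (simp add: tip_tp tp_frame mult.commute)

lemma tip_self: "tip w s s = of_real (\<Sum>k\<le>2 * CARD('n). (\<Sum>cs | length cs = k. (cmod (frame s cs))^2) / fact k)"
  by (simp add: tip_tp tp_frame complex_norm_square flip: of_real_power)

lemma tip_self_nonneg: "0 \<le> Re (tip w s s)" "Im (tip w s s) = 0"
  by (simp_all only: tip_self Re_complex_of_real Im_complex_of_real)
    (intro sum_nonneg divide_nonneg_nonneg zero_le_power2 fact_ge_zero)

lemma tip_self_zero:
  assumes "tip w s s = 0" "length as \<le> 2 * CARD('n)"
  shows "s as = 0"
proof (rule frame_injective)
  fix cs :: "'n cidx list" assume cs: "length cs = length as"
  have "(\<Sum>k\<le>2 * CARD('n). (\<Sum>cs | length cs = k. (cmod (frame s cs))^2) / fact k) = 0"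
    using assms(1) unfolding tip_self of_real_eq_0_iff .
  then have "(\<Sum>cs | length cs = length as. (cmod (frame s cs))^2) / fact (length as) = 0"
    by (subst (asm) sum_nonneg_eq_0_iff)
      (use assms(2) in \<open>auto intro!: sum_nonneg divide_nonneg_nonneg\<close>)
  then have "(\<Sum>cs | length cs = length as. (cmod (frame s cs))^2) = 0" by simp
  then show "frame s cs = 0"
    by (subst (asm) sum_nonneg_eq_0_iff) (use cs in auto)
qed simp

text \<open>Positivity controls the degrees up to \<open>2n\<close>, which are all that
  \<open>tip\<close> sees; skew symmetry takes care of the others.\<close>

lemma skew_tip_self_zero:
  assumes "skew s" "tip w s s = 0"
  shows "s as = 0"
  using tip_self_zero[OF assms(2), of as] skew_large_zero[OF assms(1), of as] by linarith

end

lemma tip_diff_right: "tip w s (\<lambda>as. t as - t' as) = tip w s t - tip w s t'"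
  by (simp add: tip_tp tp_diff_right sum_subtractf diff_divide_distrib)

lemma tip_diff_left: "tip w (\<lambda>as. s as - s' as) t = tip w s t - tip w s' t"
  by (simp add: tip_tp tp_diff_left sum_subtractf diff_divide_distrib)

lemma tip_add_left: "tip w (\<lambda>as. s as + s' as) t = tip w s t + tip w s' t"
  by (simp add: tip_tp tp_add_left sum.distrib add_divide_distrib)

lemma tip_cmult_right: "tip w s (\<lambda>as. c * t as) = cnj c * tip w s t"
  by (simp add: tip_tp tp_cmult_right sum_distrib_left)

lemma tip_cmult_left: "tip w (\<lambda>as. c * s as) t = c * tip w s t"
  by (simp add: tip_tp tp_cmult_left sum_distrib_left)

section \<open>The operator \<Lambda> and its commutator with the wedge by a 1-form\<close>

context hermitian_point
begin

lemma skew_eqI: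
  assumes "skew s" "skew s'" "\<And>r. skew r \<Longrightarrow> tip w r s = tip w r s'"
  shows "s = s'"
proof
  fix as
  let ?r = "\<lambda>as. s as - s' as"
  have sk: "skew ?r" using assms by (simp add: skew_diff)
  then have "tip w ?r ?r = 0" using assms(3)[OF sk] by (simp add: tip_diff_right)
  from skew_tip_self_zero[OF sk this, of as] show "s as = s' as" by simp
qed

abbreviation "g \<equiv> cometric w"

text \<open>Existence comes from \<open>tip_wedge_two_form\<close> and uniqueness from definiteness;
  this resolves the definite description in \<open>Lambda_op\<close>.\<close>

lemma Lambda_at_unique:
  assumes "skew u"
  shows "(THE s. skew s \<and> (\<forall>r. skew r \<longrightarrow> tip w (wedge w r) u = tip w r s)) = Lambda_at g w u"
proof (rule the_equality)
  show "skew (Lambda_at g w u) \<and> (\<forall>r. skew r \<longrightarrow> tip w (wedge w r) u = tip w r (Lambda_at g w u))"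
    using Lambda_at_skew[OF assms] tip_wedge_two_form[where \<omega> = w, OF two_form assms] by blast
  show "s = Lambda_at g w u" if "skew s \<and> (\<forall>r. skew r \<longrightarrow> tip w (wedge w r) u = tip w r s)" for s
    using that tip_wedge_two_form[where \<omega> = w, OF two_form assms] Lambda_at_skew[OF assms]
    by (intro skew_eqI) auto
qed

lemma tip_wedge1_right:
  assumes "skew r"
  shows "tip w r (wedge1 \<sigma> u) = tip w (contract (sharp g \<sigma>) r) u"
  using tip_wedge1[OF assms, of w \<sigma> u] tip_hermitian by metis

text \<open>The coordinates of the vector field \<open>Y\<close> with \<open>i\<^sub>Y \<omega> = - \<tau>\<close>; see \<open>omega_dual_two_form\<close>.\<close>

fun omega_dual :: "('n cidx \<Rightarrow> complex) \<Rightarrow> 'n cidx \<Rightarrow> complex" where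
  "omega_dual \<tau> (Inl j) = \<i> * (\<Sum>k\<in>UNIV. hi $ k $ j * \<tau> (Inr k))"
| "omega_dual \<tau> (Inr k) = - \<i> * (\<Sum>j\<in>UNIV. hi $ k $ j * \<tau> (Inl j))"

lemma hi_hermitian: "cnj (hi $ j $ k) = hi $ k $ j"
  by (simp add: hi_factor mult.commute)

text \<open>The right side is the vector that the adjoint computation of the commutator produces.
  Contracting \<open>sharp g \<tau>\<close> into \<open>w\<close> exchanges the two types and leaves
  conjugates with factors \<i> and - \<i>; the second \<open>sharp\<close> removes the
  conjugates.\<close>

lemma omega_dual_eq:
  "omega_dual \<tau> = sharp g (\<lambda>e. \<Sum>b\<in>UNIV. sharp g \<tau> b * w [b, e])"
proof -
  have 1: "(\<Sum>b\<in>UNIV. sharp g \<tau> b * w [b, Inr k]) = \<i> * cnj (\<tau> (Inl k))" for k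
  proof -
    have "(\<Sum>b\<in>UNIV. sharp g \<tau> b * w [b, Inr k]) =
        (\<Sum>j\<in>UNIV. \<Sum>l\<in>UNIV. \<i> * (cnj (\<tau> (Inl l)) * (hi $ l $ j * h $ j $ k)))"
      by (simp add: sum_cidx sharp_def w_comps hi_hermitian sum_distrib_right sum_distrib_left mult_ac)
    also have "\<dots> = (\<Sum>l\<in>UNIV. \<i> * (cnj (\<tau> (Inl l)) * (\<Sum>j\<in>UNIV. hi $ l $ j * h $ j $ k)))"
      by (subst sum.swap) (simp add: sum_distrib_left)
    finally show ?thesis by (simp add: hi_h_comp if_distrib cong: if_cong)
  qed
  have 2: "(\<Sum>b\<in>UNIV. sharp g \<tau> b * w [b, Inl j]) = - \<i> * cnj (\<tau> (Inr j))" for j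
  proof -
    have "(\<Sum>b\<in>UNIV. sharp g \<tau> b * w [b, Inl j]) =
        (\<Sum>k\<in>UNIV. \<Sum>l\<in>UNIV. - \<i> * (cnj (\<tau> (Inr l)) * (h $ j $ k * hi $ k $ l)))"
      by (simp add: sum_cidx sharp_def w_comps hi_hermitian sum_distrib_right sum_distrib_left mult_ac flip: sum_negf)
    also have "\<dots> = (\<Sum>l\<in>UNIV. - \<i> * (cnj (\<tau> (Inr l)) * (\<Sum>k\<in>UNIV. h $ j $ k * hi $ k $ l)))"
      by (subst sum.swap) (simp add: sum_distrib_left flip: sum_negf)
    finally show ?thesis by (simp add: h_hi_comp if_distrib cong: if_cong)
  qed
  have *: "(\<lambda>e. \<Sum>b\<in>UNIV. sharp g \<tau> b * w [b, e])
      = case_sum (\<lambda>j. - \<i> * cnj (\<tau> (Inr j))) (\<lambda>k. \<i> * cnj (\<tau> (Inl k)))"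
  proof
    fix e show "(\<Sum>b\<in>UNIV. sharp g \<tau> b * w [b, e])
      = case_sum (\<lambda>j. - \<i> * cnj (\<tau> (Inr j))) (\<lambda>k. \<i> * cnj (\<tau> (Inl k))) e"
      by (cases e) (simp_all only: 1 2 sum.case)
  qed
  show ?thesis
  proof
    fix a show "omega_dual \<tau> a = sharp g (\<lambda>e. \<Sum>b\<in>UNIV. sharp g \<tau> b * w [b, e]) a"
      unfolding * by (cases a)
        (simp_all add: sharp_def sum_cidx hi_hermitian sum_distrib_left mult_ac sum_negf)
  qed
qed

lemma omega_dual_two_form: "(\<Sum>b\<in>UNIV. omega_dual \<tau> b * w [b, a]) = - \<tau> a"
proof (cases a)
  case (Inr k)
  have "(\<Sum>b\<in>UNIV. omega_dual \<tau> b * w [b, a]) = (\<Sum>j\<in>UNIV. \<Sum>l\<in>UNIV. - (\<tau> (Inr l) * (hi $ l $ j * h $ j $ k)))"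
    by (simp add: Inr sum_cidx w_comps sum_distrib_right sum_distrib_left mult_ac)
  also have "\<dots> = (\<Sum>l\<in>UNIV. - (\<tau> (Inr l) * (\<Sum>j\<in>UNIV. hi $ l $ j * h $ j $ k)))"
    by (subst sum.swap) (simp add: sum_distrib_left sum_negf)
  finally show ?thesis by (simp add: hi_h_comp if_distrib Inr cong: if_cong)
next
  case (Inl j)
  have "(\<Sum>b\<in>UNIV. omega_dual \<tau> b * w [b, a]) = (\<Sum>k\<in>UNIV. \<Sum>l\<in>UNIV. - (\<tau> (Inl l) * (h $ j $ k * hi $ k $ l)))"
    by (simp add: Inl sum_cidx w_comps sum_distrib_right sum_distrib_left mult_ac)
  also have "\<dots> = (\<Sum>l\<in>UNIV. - (\<tau> (Inl l) * (\<Sum>k\<in>UNIV. h $ j $ k * hi $ k $ l)))"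
    by (subst sum.swap) (simp add: sum_distrib_left sum_negf)
  finally show ?thesis by (simp add: h_hi_comp if_distrib Inl cong: if_cong)
qed

text \<open>Gives uniqueness of the vector with \<open>i_Y \<omega> = - \<tau>\<close>, from which
  the transformation law of \<open>field\<close> under changes of charts is derived.\<close>

lemma two_form_nondegenerate:
  assumes "\<And>a. (\<Sum>b\<in>UNIV. Z b * w [b, a]) = 0"
  shows "Z c = 0"
proof (cases c)
  case (Inl l)
  have z: "(\<Sum>j\<in>UNIV. Z (Inl j) * h $ j $ k) = 0" for k
    using assms[of "Inr k"] by (simp add: sum_cidx w_comps mult.left_commute[of _ \<i>] flip: sum_distrib_left)
  have "(\<Sum>k\<in>UNIV. (\<Sum>j\<in>UNIV. Z (Inl j) * h $ j $ k) * hi $ k $ l) = (\<Sum>j\<in>UNIV. Z (Inl j) * (\<Sum>k\<in>UNIV. h $ j $ k * hi $ k $ l))"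
    unfolding sum_distrib_right sum_distrib_left by (subst sum.swap) (simp add: mult.assoc)
  then show ?thesis unfolding z h_hi_comp using Inl by (simp add: if_distrib cong: if_cong)
next
  case (Inr l)
  have "(\<Sum>b\<in>UNIV. Z b * w [b, Inl j]) = - \<i> * (\<Sum>k\<in>UNIV. h $ j $ k * Z (Inr k))" for j
    by (simp add: sum_cidx w_comps sum_distrib_left mult_ac sum_negf)
  then have z: "(\<Sum>k\<in>UNIV. h $ j $ k * Z (Inr k)) = 0" for j
    using assms[of "Inl j"] by simp
  have "(\<Sum>j\<in>UNIV. hi $ l $ j * (\<Sum>k\<in>UNIV. h $ j $ k * Z (Inr k))) = (\<Sum>k\<in>UNIV. (\<Sum>j\<in>UNIV. hi $ l $ j * h $ j $ k) * Z (Inr k))"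
    unfolding sum_distrib_right sum_distrib_left by (subst sum.swap) (simp add: mult.assoc)
  then show ?thesis unfolding z hi_h_comp using Inr by (simp add: if_distrib[of "\<lambda>x. x * _"] cong: if_cong)
qed

text \<open>Tested against \<open>r\<close>, the commutator turns into its adjoint
  \<open>[i_S, \<omega> \<and> \<cdot>]\<close> with \<open>S = sharp g \<tau>\<close>. By the
  antiderivation rule this is the wedge with the \<open>1\<close>-form \<open>i_S \<omega>\<close>,
  and the adjoint of that wedge is a contraction again.\<close>

lemma Lambda_at_wedge1_commutator:
  assumes u: "skew u"
  shows "Lambda_at g w (wedge1 \<tau> u) as - wedge1 \<tau> (Lambda_at g w u) as = contract (omega_dual \<tau>) u as"
proof -
  let ?c = "\<lambda>as. Lambda_at g w (wedge1 \<tau> u) as - wedge1 \<tau> (Lambda_at g w u) as"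
  have "?c = contract (omega_dual \<tau>) u"
  proof (rule skew_eqI)
    show "skew ?c" by (intro skew_diff Lambda_at_skew wedge1_skew u)
    show "skew (contract (omega_dual \<tau>) u)" by (rule contract_skew[OF u])
    fix r :: "'n tensor" assume r: "skew r"
    have "tip w r ?c = tip w (wedge w r) (wedge1 \<tau> u) - tip w (contract (sharp g \<tau>) r) (Lambda_at g w u)"
      by (simp add: tip_diff_right tip_wedge_two_form[where \<omega> = w, OF two_form wedge1_skew[OF u]] tip_wedge1_right[OF r])
    also have "\<dots> = tip w (contract (sharp g \<tau>) (wedge w r)) u - tip w (wedge w (contract (sharp g \<tau>) r)) u"
      by (simp add: tip_wedge1_right[OF wedge_two_form_skew[where s = w, OF two_form skew_w r]]
          tip_wedge_two_form[where \<omega> = w, OF two_form u])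
    also have "\<dots> = tip w (wedge1 (\<lambda>e. \<Sum>b\<in>UNIV. sharp g \<tau> b * w [b, e]) r) u"
    proof -
      have "contract (sharp g \<tau>) (wedge w r) as - wedge w (contract (sharp g \<tau>) r) as
          = wedge1 (\<lambda>e. \<Sum>b\<in>UNIV. sharp g \<tau> b * w [b, e]) r as" for as
        using contract_wedge_two_form[where s = w, OF two_form, of "sharp g \<tau>" r as] by simp
      then show ?thesis unfolding tip_diff_left[symmetric] by simp
    qed
    also have "\<dots> = tip w r (contract (omega_dual \<tau>) u)"
      by (simp add: tip_wedge1[OF u] omega_dual_eq)
    finally show "tip w r ?c = tip w r (contract (omega_dual \<tau>) u)" .
  qed
  then show ?thesis by metis
qed

text \<open>The metric pairs the two types, so the holomorphic components take the coefficient
  \<open>b\<close> of the antiholomorphic part of \<tau> and conversely; the factors \<i> and - \<i>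
  multiply to 1. The first assumption says that \<sigma> is real.\<close>

lemma omega_dual_sharp:
  assumes "\<And>j. \<sigma> (Inr j) = cnj (\<sigma> (Inl j))"
    "\<And>j. \<tau> (Inl j) = \<i> * (a * \<sigma> (Inl j))" "\<And>j. \<tau> (Inr j) = - \<i> * (b * \<sigma> (Inr j))"
  shows "omega_dual \<tau> (Inl j) = b * sharp g \<sigma> (Inl j)" "omega_dual \<tau> (Inr j) = a * sharp g \<sigma> (Inr j)"
  by (simp_all add: sharp_def sum_cidx hi_hermitian assms sum_distrib_left mult_ac sum_negf)

end

section \<open>Forms on a complex manifold\<close>

lemma alt_lincomb: "alt (\<lambda>a as. \<Sum>i\<in>I. c i * F i a as) as = (\<Sum>i\<in>I. c i * alt (F i) as)"
  by (simp add: alt_sum alt_cmult)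

text \<open>Antisymmetrization commutes with pullback: the part of the chart independence of
  \<open>d\<close> that involves only first derivatives of the transition map.\<close>

lemma alt_pull:
  "alt (\<lambda>a as. \<Sum>b\<in>UNIV. J b a * pull J (V b) as) as = pull J (alt V) as"
proof (induction as arbitrary: V)
  case (Cons c as)
  have 1: "alt (\<lambda>a. slot c (\<lambda>as. \<Sum>b\<in>UNIV. J b a * pull J (V b) as)) as
      = (\<Sum>e\<in>UNIV. J e c * pull J (alt (\<lambda>b. slot e (V b))) as)"
  proof -
    have "slot c (\<lambda>as. \<Sum>b\<in>UNIV. J b a * pull J (V b) as) bs =
        (\<Sum>e\<in>UNIV. J e c * (\<Sum>b\<in>UNIV. J b a * pull J (slot e (V b)) bs))" for a bs
      unfolding slot_apply pull_Cons sum_distrib_left by (subst sum.swap) (simp add: mult.left_commute)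
    then show ?thesis
      unfolding Cons.IH[symmetric] alt_lincomb[symmetric] by (rule alt_cong)
  qed
  have "pull J (alt V) (c # as) = (\<Sum>e\<in>UNIV. J e c * (pull J (V e) as - pull J (alt (\<lambda>b. slot e (V b))) as))"
  proof -
    have "slot e (alt V) = (\<lambda>as. V e as - alt (\<lambda>b. slot e (V b)) as)" for e
      by (auto simp: alt_Cons)
    then show ?thesis by (simp add: pull_Cons pull_diff)
  qed
  then show ?case
    by (simp add: alt_Cons[of _ c] 1 right_diff_distrib sum_subtractf)
qed simp

text \<open>The derivative of \<open>pull J U\<close> when \<open>J\<close> moves with velocity \<open>K\<close>.\<close>

fun pull_deriv :: "('n::finite cidx \<Rightarrow> 'n cidx \<Rightarrow> complex) \<Rightarrow> ('n cidx \<Rightarrow> 'n cidx \<Rightarrow> complex) \<Rightarrow>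
    'n tensor \<Rightarrow> 'n tensor" where
  "pull_deriv J K U [] = 0"
| "pull_deriv J K U (a # as) =
    (\<Sum>b\<in>UNIV. K b a * pull J (slot b U) as) + (\<Sum>b\<in>UNIV. J b a * pull_deriv J K (slot b U) as)"

text \<open>In a skew tensor the index that meets the moving factor \<open>K\<close> can be brought
  to the front, which turns the product rule into a sum of wedges with the \<open>1\<close>-forms
  \<open>K b\<close>.\<close>

lemma pull_deriv_wedge1:
  assumes "skew U"
  shows "pull_deriv J K U as = (\<Sum>b\<in>UNIV. wedge1 (K b) (pull J (slot b U)) as)"
  using assms
proof (induction as arbitrary: U)
  case (Cons a as)
  have "wedge1 (K b) (slot a (pull J (slot b U))) as = - (\<Sum>c\<in>UNIV. J c a * wedge1 (K b) (pull J (slot b (slot c U))) as)" for b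
  proof -
    have "slot c (slot b U) = (\<lambda>as. (-1) * slot b (slot c U) as)" for c
      using skew_swap[OF Cons.prems, of b c] by auto
    then have "slot a (pull J (slot b U)) = (\<lambda>as. \<Sum>c\<in>UNIV. (- J c a) * pull J (slot b (slot c U)) as)"
      by (simp only: slot_pull pull_cmult) (simp add: slot_def)
    then show ?thesis by (simp only: wedge1_sum_right wedge1_cmult_right) (simp add: sum_negf)
  qed
  then have "(\<Sum>b\<in>UNIV. wedge1 (K b) (pull J (slot b U)) (a # as)) =
      (\<Sum>b\<in>UNIV. K b a * pull J (slot b U) as) + (\<Sum>b\<in>UNIV. \<Sum>c\<in>UNIV. J c a * wedge1 (K b) (pull J (slot b (slot c U))) as)"
    by (simp add: wedge1_Cons sum.distrib slot_def)
  also have "(\<Sum>b\<in>UNIV. \<Sum>c\<in>UNIV. J c a * wedge1 (K b) (pull J (slot b (slot c U))) as) = (\<Sum>c\<in>UNIV. J c a * pull_deriv J K (slot c U) as)"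
    unfolding Cons.IH[OF skew_slot[OF Cons.prems]] sum_distrib_left by (rule sum.swap)
  finally show ?case by (simp add: slot_def)
qed simp

text \<open>
  Applied to the second derivatives \<open>K a b c\<close> of the \<open>b\<close>-th coordinate of a transition map, this
  is why the exterior derivative commutes with changes of charts.
\<close>

lemma alt_pull_deriv:
  assumes "skew U" "\<And>a b c. K a b c = K c b a"
  shows "alt (\<lambda>a. pull_deriv J (K a) U) as = 0"
  using assms(1)
proof (induction as arbitrary: U)
  case (Cons c as)
  have "alt (\<lambda>a. slot c (pull_deriv J (K a) U)) as =
      alt (\<lambda>a as. (\<Sum>b\<in>UNIV. K c b a * pull J (slot b U) as) + (\<Sum>b\<in>UNIV. J b c * pull_deriv J (K a) (slot b U) as)) as"
    by (rule alt_cong) (simp add: assms(2)[of _ _ c])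
  also have "\<dots> = (\<Sum>b\<in>UNIV. wedge1 (K c b) (pull J (slot b U)) as)"
    by (simp only: alt_add alt_sum alt_cmult Cons.IH[OF skew_slot[OF Cons.prems]] wedge1_def) simp
  finally show ?case by (simp add: alt_Cons pull_deriv_wedge1[OF Cons.prems, of J "K c"])
qed simp

lemma pull_differentiable:
  assumes "\<And>b a. (\<lambda>z. J z b a) differentiable (at y)" "\<And>as. (\<lambda>z. U z as) differentiable (at y)"
  shows "(\<lambda>z. pull (J z) (U z) as) differentiable (at y)"
  using assms(2)
proof (induction as arbitrary: U)
  case (Cons a as)
  have "(\<lambda>z. pull (J z) (slot b (U z)) as) differentiable (at y)" for b
    by (rule Cons.IH) (simp add: Cons.prems)
  then show ?case unfolding pull_Cons
    by (intro differentiable_sum ballI differentiable_mult assms(1)) auto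
qed simp

lemma pd_pull:
  assumes "\<And>b a. (\<lambda>z. J z b a) differentiable (at y)" "\<And>as. (\<lambda>z. U z as) differentiable (at y)"
  shows "pd e (\<lambda>z. pull (J z) (U z) as) y =
    pull_deriv (J y) (\<lambda>b a. pd e (\<lambda>z. J z b a) y) (U y) as + pull (J y) (\<lambda>bs. pd e (\<lambda>z. U z bs) y) as"
  using assms(2)
proof (induction as arbitrary: U)
  case (Cons a as)
  have U: "(\<lambda>z. slot b (U z) as) differentiable (at y)" for b as using Cons.prems by simp
  have d: "(\<lambda>z. pull (J z) (slot b (U z)) as) differentiable (at y)" for b
    by (rule pull_differentiable) (rule assms(1), rule U)
  have "pd e (\<lambda>z. pull (J z) (U z) (a # as)) y = (\<Sum>b\<in>UNIV. pd e (\<lambda>z. J z b a) y * pull (J y) (slot b (U y)) as +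
      J y b a * pd e (\<lambda>z. pull (J z) (slot b (U z)) as) y)"
    unfolding pull_Cons by (subst pd_sum; intro differentiable_mult assms(1) d sum.cong refl pd_mult)
  then show ?case
    by (simp add: Cons.IH[OF U] pull_Cons sum.distrib distrib_left) (simp add: slot_def)
qed simp

lemma hdeg_isl: "map isl (as :: 'a cidx list) = map isl (bs :: 'a cidx list) \<Longrightarrow> hdeg as = hdeg bs"
proof -
  have e: "hdeg as = length (filter id (map isl as))" for as :: "('a + 'a) list"
    unfolding hdeg_def by (simp add: filter_map o_def)
  show "map isl as = map isl bs \<Longrightarrow> hdeg as = hdeg bs" unfolding e by (rule arg_cong)
qed

lemma adeg_isl: "map isl (as :: 'a cidx list) = map isl (bs :: 'a cidx list) \<Longrightarrow> adeg as = adeg bs"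
proof -
  have e: "adeg as = length (filter Not (map isl as))" for as :: "('a + 'a) list"
    unfolding adeg_def by (simp add: filter_map o_def)
  show "map isl as = map isl bs \<Longrightarrow> adeg as = adeg bs" unfolding e by (rule arg_cong)
qed

lemma
  assumes "i < j" "j < length as"
  shows hdeg_swap: "hdeg (as[i := as ! j, j := as ! i]) = hdeg as"
    and adeg_swap: "adeg (as[i := as ! j, j := as ! i]) = adeg as"
proof -
  have m: "mset (as[i := as ! j, j := as ! i]) = mset as"
    using assms by (intro mset_swap) auto
  have "hdeg bs = size (filter_mset isl (mset bs))" "adeg bs = size (filter_mset (\<lambda>a. \<not> isl a) (mset bs))"
    for bs :: "('a + 'a) list"
    by (simp_all add: hdeg_def adeg_def flip: mset_filter)
  with m show "hdeg (as[i := as ! j, j := as ! i]) = hdeg as"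
    "adeg (as[i := as ! j, j := as ! i]) = adeg as" by simp_all
qed

text \<open>Block diagonal coefficients pair only index lists with the same pattern of types. For
  \<open>jac\<close> this makes the bidegree independent of the chart, for \<open>cometric\<close>
  it makes different bidegrees orthogonal.\<close>

lemma prod_isl:
  fixes as bs :: "'a cidx list"
  assumes "(\<Prod>m<length as. J (bs ! m) (as ! m)) \<noteq> (0::complex)" "length bs = length as"
    "\<And>a b. isl a \<noteq> isl b \<Longrightarrow> J b a = 0"
  shows "hdeg bs = hdeg as" "adeg bs = adeg as"
proof -
  have "isl (bs ! m) = isl (as ! m)" if "m < length as" for m
  proof -
    have "J (bs ! m) (as ! m) \<noteq> 0" using assms(1) that by simp
    then show ?thesis using assms(3)[of "as ! m" "bs ! m"] by auto
  qed
  then have "map isl bs = map isl as"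
    using assms(2) by (intro nth_equalityI) auto
  then show "hdeg bs = hdeg as" "adeg bs = adeg as" by (rule hdeg_isl, rule adeg_isl)
qed

lemma pull_weight:
  assumes "\<And>a b. isl a \<noteq> isl b \<Longrightarrow> J b a = 0"
  shows "pull J (\<lambda>bs. \<phi> (hdeg bs) (adeg bs) * U bs) as = \<phi> (hdeg as) (adeg as) * pull J U as"
  unfolding pull_def sum_distrib_left
proof (rule sum.cong[OF refl])
  fix bs :: "'a cidx list" assume "bs \<in> {bs. length bs = length as}"
  then show "(\<Prod>m<length as. J (bs ! m) (as ! m)) * (\<phi> (hdeg bs) (adeg bs) * U bs) =
      \<phi> (hdeg as) (adeg as) * ((\<Prod>m<length as. J (bs ! m) (as ! m)) * U bs)"
    using prod_isl[where J = J and as = as and bs = bs, OF _ _ assms] by (cases "(\<Prod>m<length as. J (bs ! m) (as ! m)) = 0") auto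
qed

lemma skew_weight: "skew t \<Longrightarrow> skew (\<lambda>as. \<phi> (hdeg as) (adeg as) * t as)"
  by (simp add: skew_def hdeg_swap adeg_swap)

lemma bounded_linear_coord: "bounded_linear (coord e)"
proof (cases e)
  case (Inl j)
  then have "coord e = (\<lambda>z. z $ j)" by auto
  then show ?thesis by (simp add: bounded_linear_vec_nth)
next
  case (Inr j)
  then have "coord e = (\<lambda>z. cnj (z $ j))" by auto
  then show ?thesis by (simp add: bounded_linear_compose[OF bounded_linear_cnj bounded_linear_vec_nth])
qed

lemma pd_coord: "pd a (coord e) y = (if a = e then 1 else 0)"
  unfolding pd_eqI[OF bounded_linear_imp_has_derivative[OF bounded_linear_coord]]
  by (cases a; cases e) (auto simp: axis_def)

section \<open>Global forms and changes of charts\<close>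

locale cmanifold =
  fixes X :: "'x topology" and A :: "('x, 'n::finite) chart set"
  assumes cm: "complex_manifold X A"
begin

lemma open_cimg: "c \<in> A \<Longrightarrow> open (cimg c)"
  using cm by (auto simp: complex_manifold_def)

lemma chart_homeo: "c \<in> A \<Longrightarrow>
    homeomorphic_map (subtopology X (cdom c)) (top_of_set (cimg c)) (cmap c)"
  using cm by (auto simp: complex_manifold_def)

lemma openin_cdom: "c \<in> A \<Longrightarrow> openin X (cdom c)"
  using cm by (auto simp: complex_manifold_def)

lemma cdom_subset: "c \<in> A \<Longrightarrow> cdom c \<subseteq> topspace X"
  using openin_cdom openin_subset by blast

lemma inj_cmap: "c \<in> A \<Longrightarrow> inj_on (cmap c) (cdom c)"
  using homeomorphic_imp_injective_map[OF chart_homeo] cdom_subset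
  by (metis inf.absorb_iff2 topspace_subtopology)

lemma cmap_in: "x \<in> cdom c \<Longrightarrow> cmap c x \<in> cimg c"
  by (simp add: cimg_def)

lemma cinv_cmap: "c \<in> A \<Longrightarrow> x \<in> cdom c \<Longrightarrow> cinv c (cmap c x) = x"
  by (simp add: cinv_def inj_cmap)

lemma cinv_in: "y \<in> cimg c \<Longrightarrow> cinv c y \<in> cdom c"
  by (simp add: cinv_def cimg_def inv_into_into)

lemma cmap_cinv: "y \<in> cimg c \<Longrightarrow> cmap c (cinv c y) = y"
  by (simp add: cinv_def cimg_def f_inv_into_f)

lemma cinv_topspace: "c \<in> A \<Longrightarrow> y \<in> cimg c \<Longrightarrow> cinv c y \<in> topspace X"
  using cinv_in cdom_subset by blast

lemma open_cmap_image:
  assumes "c \<in> A" "openin X U" "U \<subseteq> cdom c"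
  shows "open (cmap c ` U)"
proof -
  have "openin (subtopology X (cdom c)) U"
    using assms by (meson openin_subtopology_Int2 openin_open_subtopology openin_cdom)
  then have "openin (top_of_set (cimg c)) (cmap c ` U)"
    using homeomorphic_imp_open_map[OF chart_homeo[OF assms(1)]] by (simp add: open_map_def)
  then show ?thesis using open_cimg[OF assms(1)] openin_open_trans by blast
qed

definition overlap :: "('x, 'n) chart \<Rightarrow> ('x, 'n) chart \<Rightarrow> (complex^'n) set" where
  "overlap c c' = cmap c ` (cdom c \<inter> cdom c')"

lemma open_overlap: "c \<in> A \<Longrightarrow> c' \<in> A \<Longrightarrow> open (overlap c c')"
  unfolding overlap_def by (intro open_cmap_image openin_Int openin_cdom) auto

lemma transition_cmap: "c \<in> A \<Longrightarrow> x \<in> cdom c \<Longrightarrow> transition c c' (cmap c x) = cmap c' x"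
  by (simp add: transition_def cinv_cmap)

lemma smooth_coord_transition:
  assumes "c \<in> A" "c' \<in> A"
  shows "smooth_on (overlap c c') (\<lambda>y. coord b (transition c c' y))"
proof -
  have *: "smooth_on (overlap c c') (\<lambda>y. transition c c' y $ j)" for j
    using cm assms unfolding complex_manifold_def holomorphic_map_on_def overlap_def by blast
  show ?thesis
    using * smooth_on_bounded_linear[OF open_overlap[OF assms] bounded_linear_cnj *] by (cases b) auto
qed

lemma transition_differentiable:
  assumes "c \<in> A" "c' \<in> A" "y \<in> overlap c c'"
  shows "transition c c' differentiable (at y)"
proof -
  have d: "((\<lambda>y. transition c c' y $ j) has_derivative
      frechet_derivative (\<lambda>y. transition c c' y $ j) (at y)) (at y)" for j
    using smooth_on_has_derivative[OF smooth_coord_transition[OF assms(1,2), of "Inl j"] assms(3)] by simp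
  have bl: "bounded_linear (axis j :: complex \<Rightarrow> complex^'n)" for j
    by (intro linear_conv_bounded_linear[THEN iffD1] linearI) (auto simp: vec_eq_iff axis_def)
  have "((\<lambda>y. \<Sum>j\<in>UNIV. axis j (transition c c' y $ j)) has_derivative
      (\<lambda>v. \<Sum>j\<in>UNIV. axis j (frechet_derivative (\<lambda>y. transition c c' y $ j) (at y) v))) (at y)"
    by (rule has_derivative_sum) (rule bounded_linear.has_derivative[OF bl d])
  moreover have "(\<lambda>y. \<Sum>j\<in>UNIV. axis j (transition c c' y $ j)) = transition c c'"
    by (rule ext) (simp add: vec_eq_iff axis_def if_distrib if_distribR cong: if_cong)
  ultimately show ?thesis by (auto simp: differentiable_def)
qed

lemma smooth_jac:
  assumes "c \<in> A" "c' \<in> A"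
  shows "smooth_on (overlap c c') (\<lambda>y. jac c c' y b a)"
  unfolding jac_def by (rule smooth_on_pd[OF open_overlap smooth_coord_transition]) (use assms in auto)

text \<open>One off-diagonal block is the Cauchy-Riemann equation. The other is its conjugate, since
  the derivative of \<open>cnj f\<close> by a coordinate is the conjugate of the derivative of
  \<open>f\<close> by the conjugate coordinate.\<close>

lemma jac_block:
  assumes "c \<in> A" "c' \<in> A" "y \<in> overlap c c'" "isl a \<noteq> isl b"
  shows "jac c c' y b a = 0"
proof -
  have h: "pd (Inr k) (\<lambda>z. transition c c' z $ j) y = 0" for j k
    using cm assms unfolding complex_manifold_def holomorphic_map_on_def overlap_def by blast
  let ?F = "\<lambda>j. frechet_derivative (\<lambda>y. transition c c' y $ j) (at y)"
  have d: "((\<lambda>y. transition c c' y $ j) has_derivative ?F j) (at y)" for j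
    using smooth_on_has_derivative[OF smooth_coord_transition[OF assms(1,2), of "Inl j"] assms(3)] by simp
  have "pd (Inl k) (\<lambda>z. cnj (transition c c' z $ j)) y = cnj (pd (Inr k) (\<lambda>z. transition c c' z $ j) y)" for j k
    unfolding pd_eqI[OF bounded_linear.has_derivative[OF bounded_linear_cnj d]] pd_eqI[OF d] by simp
  then show ?thesis using h assms(4) by (cases a; cases b) (auto simp: jac_def)
qed

text \<open>The chain rule for the composition of the two transition maps, which is the identity
  near the point.\<close>

lemma jac_inverse:
  assumes "c \<in> A" "c' \<in> A" "x \<in> cdom c \<inter> cdom c'"
  shows "(\<Sum>b\<in>UNIV. jac c c' (cmap c x) b a * jac c' c (cmap c' x) e b) = (if a = e then 1 else 0)"
proof -
  let ?y = "cmap c x"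
  have y: "?y \<in> overlap c c'" "cmap c' x \<in> overlap c' c" using assms by (auto simp: overlap_def)
  have t: "transition c c' ?y = cmap c' x" using assms by (simp add: transition_cmap)
  have "pd a (\<lambda>z. coord e (transition c' c (transition c c' z))) ?y = pd a (coord e) ?y"
  proof (rule pd_cong[symmetric, OF open_overlap[OF assms(1,2)] y(1)])
    show "coord e z = coord e (transition c' c (transition c c' z))" if "z \<in> overlap c c'" for z
      using that assms by (auto simp: overlap_def transition_cmap)
    show "coord e differentiable at ?y"
      by (rule bounded_linear_imp_differentiable[OF bounded_linear_coord])
  qed
  moreover have "pd a (\<lambda>z. coord e (transition c' c (transition c c' z))) ?y =
      (\<Sum>b\<in>UNIV. pd a (\<lambda>z. coord b (transition c c' z)) ?y *
         pd b (\<lambda>z. coord e (transition c' c z)) (transition c c' ?y))"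
    by (rule pd_chain[where f="\<lambda>z. coord e (transition c' c z)"])
      (use y t smooth_on_differentiable[OF smooth_coord_transition[OF assms(2,1)]]
         transition_differentiable[OF assms(1,2)] in auto)
  ultimately show ?thesis by (simp add: jac_def t pd_coord)
qed

lemma formsD:
  assumes "u \<in> forms A k"
  shows "\<not> (c \<in> A \<and> y \<in> cimg c \<and> length as = k) \<Longrightarrow> u c y as = 0" "skew (u c y)"
    "c \<in> A \<Longrightarrow> smooth_on (cimg c) (\<lambda>y. u c y as)"
    "c \<in> A \<Longrightarrow> c' \<in> A \<Longrightarrow> x \<in> cdom c \<inter> cdom c' \<Longrightarrow>
      u c (cmap c x) as = pull (jac c c' (cmap c x)) (u c' (cmap c' x)) as"
  using assms unfolding forms_def pull_def by blast+

lemma formsI: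
  assumes "\<And>c y as. \<not> (c \<in> A \<and> y \<in> cimg c \<and> length as = k) \<Longrightarrow> u c y as = 0"
    "\<And>c y. c \<in> A \<Longrightarrow> y \<in> cimg c \<Longrightarrow> skew (u c y)"
    "\<And>c as. c \<in> A \<Longrightarrow> smooth_on (cimg c) (\<lambda>y. u c y as)"
    "\<And>c c' x as. c \<in> A \<Longrightarrow> c' \<in> A \<Longrightarrow> x \<in> cdom c \<inter> cdom c' \<Longrightarrow>
      u c (cmap c x) as = pull (jac c c' (cmap c x)) (u c' (cmap c' x)) as"
  shows "u \<in> forms A k"
proof -
  have "skew (u c y)" for c y
  proof (cases "c \<in> A \<and> y \<in> cimg c")
    case False
    then have "u c y = (\<lambda>as. 0)" using assms(1) by blast
    then show ?thesis by (simp add: skew_zero)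
  qed (use assms(2) in auto)
  then show ?thesis unfolding forms_def using assms(1,3,4) unfolding pull_def by blast
qed

lemma forms_zero: "0 \<in> forms A k"
  by (rule formsI) (simp_all add: skew_def smooth_on_const pull_def)

lemma forms_add: "u \<in> forms A k \<Longrightarrow> v \<in> forms A k \<Longrightarrow> u + v \<in> forms A k"
proof (rule formsI)
  assume u: "u \<in> forms A k" and v: "v \<in> forms A k"
  note D = formsD[OF u] formsD[OF v]
  show "\<not> (c \<in> A \<and> y \<in> cimg c \<and> length as = k) \<Longrightarrow> (u + v) c y as = 0" for c y as using D by simp
  show "skew ((u + v) c y)" for c y using D skew_add[of "u c y" "v c y"] by (simp add: plus_fun_def)
  show "smooth_on (cimg c) (\<lambda>y. (u + v) c y as)" if "c \<in> A" for c as
    using D that open_cimg[OF that] by (simp add: smooth_on_add)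
  show "(u + v) c (cmap c x) as = pull (jac c c' (cmap c x)) ((u + v) c' (cmap c' x)) as"
    if "c \<in> A" "c' \<in> A" "x \<in> cdom c \<inter> cdom c'" for c c' x as
    using D(4)[OF that] D(8)[OF that] by (simp add: pull_def distrib_left sum.distrib)
qed

text \<open>Multiplication by functions that may depend on the bidegree. Scalars, bidegree
  projections, the powers of \<eta> and the passage from the differential of \<eta> to
  \<open>tau_form\<close> are instances, so that \<open>forms_weigh\<close> covers them all.\<close>

definition weigh :: "(nat \<Rightarrow> nat \<Rightarrow> 'x \<Rightarrow> complex) \<Rightarrow> ('x, 'n) form \<Rightarrow> ('x, 'n) form" where
  "weigh \<phi> u = (\<lambda>c y as. \<phi> (hdeg as) (adeg as) (cinv c y) * u c y as)"

lemma forms_weigh: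
  assumes u: "u \<in> forms A k"
    and "\<And>c p q. c \<in> A \<Longrightarrow> smooth_on (cimg c) (\<lambda>y. \<phi> p q (cinv c y))"
  shows "weigh \<phi> u \<in> forms A k"
proof (rule formsI)
  note D = formsD[OF u]
  show "\<not> (c \<in> A \<and> y \<in> cimg c \<and> length as = k) \<Longrightarrow> weigh \<phi> u c y as = 0" for c y as using D by (simp add: weigh_def)
  show "skew (weigh \<phi> u c y)" for c y
    using skew_weight[OF D(2)[of c y], of "\<lambda>p q. \<phi> p q (cinv c y)"] by (simp add: weigh_def)
  show "smooth_on (cimg c) (\<lambda>y. weigh \<phi> u c y as)" if "c \<in> A" for c as
    using D(3)[OF that] assms(2)[OF that] open_cimg[OF that] by (simp add: weigh_def smooth_on_mult)
  show "weigh \<phi> u c (cmap c x) as = pull (jac c c' (cmap c x)) (weigh \<phi> u c' (cmap c' x)) as"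
    if "c \<in> A" "c' \<in> A" "x \<in> cdom c \<inter> cdom c'" for c c' x as
  proof -
    have "cmap c x \<in> overlap c c'" using that by (auto simp: overlap_def)
    then have b: "isl a \<noteq> isl b \<Longrightarrow> jac c c' (cmap c x) b a = 0" for a b
      using jac_block that by blast
    show ?thesis
      using pull_weight[OF b, where \<phi> = "\<lambda>p q. \<phi> p q x" and U = "u c' (cmap c' x)" and as = as] that D(4)[OF that]
      by (simp add: weigh_def cinv_cmap)
  qed
qed

lemma forms_cscale: "u \<in> forms A k \<Longrightarrow> cscale a u \<in> forms A k"
  using forms_weigh[of u k "\<lambda>p q x. a"] by (simp add: weigh_def cscale_def smooth_on_const)

lemma forms_diff: "u \<in> forms A k \<Longrightarrow> v \<in> forms A k \<Longrightarrow> u - v \<in> forms A k"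
  using forms_add[of u k "cscale (-1) v"] forms_cscale[of v k "-1"]
  by (simp add: cscale_def plus_fun_def fun_diff_def)

lemma forms_sum: "(\<And>i. i \<in> I \<Longrightarrow> f i \<in> forms A k) \<Longrightarrow> (\<Sum>i\<in>I. f i) \<in> forms A k"
  by (induction I rule: infinite_finite_induct) (auto simp: forms_zero forms_add)

lemma forms_bideg: "u \<in> forms A k \<Longrightarrow> bideg p q u \<in> forms A k"
proof -
  assume "u \<in> forms A k"
  then have "weigh (\<lambda>p' q' x. if p' = p \<and> q' = q then 1 else 0) u \<in> forms A k"
    by (rule forms_weigh) (rule smooth_on_const)
  moreover have "weigh (\<lambda>p' q' x. if p' = p \<and> q' = q then 1 else 0) u = bideg p q u"
    by (auto simp: weigh_def bideg_def fun_eq_iff)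
  ultimately show ?thesis by simp
qed

lemma ext_d_alt:
  "c \<in> A \<Longrightarrow> y \<in> cimg c \<Longrightarrow> ext_d A u c y as = alt (\<lambda>a bs. pd a (\<lambda>z. u c z bs) y) as"
  by (simp add: ext_d_def alt_def)

lemma forms_ext_d:
  assumes u: "u \<in> forms A k"
  shows "ext_d A u \<in> forms A (Suc k)"
proof (rule formsI)
  note D = formsD[OF u]
  have df: "(\<lambda>z. u c z as) differentiable (at y)" if "c \<in> A" "y \<in> cimg c" for c y as
    by (rule smooth_on_differentiable[OF D(3)[OF that(1)] that(2)])
  show "ext_d A u c y as = 0" if n: "\<not> (c \<in> A \<and> y \<in> cimg c \<and> length as = Suc k)" for c y as
  proof (cases "c \<in> A \<and> y \<in> cimg c")
    case True
    have "pd (as ! m) (\<lambda>z. u c z (take m as @ drop (Suc m) as)) y = 0" if "m < length as" for m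
    proof -
      have "length (take m as @ drop (Suc m) as) \<noteq> k" using n True that by auto
      then have "(\<lambda>z. u c z (take m as @ drop (Suc m) as)) = (\<lambda>z. 0)" using D(1) by blast
      then show ?thesis by (simp add: pd_const)
    qed
    then show ?thesis by (simp add: ext_d_def)
  qed (auto simp: ext_d_def)
  show "skew (ext_d A u c y)" if cy: "c \<in> A" "y \<in> cimg c" for c y
  proof -
    have "skew (\<lambda>bs. pd a (\<lambda>z. u c z bs) y)" for a
      unfolding skew_def
    proof (intro allI impI)
      fix as :: "'n cidx list" and i j
      assume "i < j \<and> j < length as"
      then have "(\<lambda>z. u c z (as[i := as ! j, j := as ! i])) = (\<lambda>z. (-1) * u c z as)"
        using D(2) by (auto simp: skew_def)
      then show "pd a (\<lambda>z. u c z (as[i := as ! j, j := as ! i])) y = - pd a (\<lambda>z. u c z as) y"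
        using pd_cmult[OF df[OF cy], of a "-1" as] by simp
    qed
    then have "skew (alt (\<lambda>a bs. pd a (\<lambda>z. u c z bs) y))" by (rule alt_skew)
    moreover have "ext_d A u c y = alt (\<lambda>a bs. pd a (\<lambda>z. u c z bs) y)"
      using ext_d_alt[OF cy] by blast
    ultimately show ?thesis by simp
  qed
  show "smooth_on (cimg c) (\<lambda>y. ext_d A u c y as)" if c: "c \<in> A" for c as
  proof (rule smooth_on_cong[OF open_cimg[OF c]])
    show "smooth_on (cimg c) (\<lambda>y. \<Sum>m<length as. (-1) ^ m * pd (as ! m) (\<lambda>z. u c z (take m as @ drop (Suc m) as)) y)"
      by (rule smooth_on_sum[OF open_cimg[OF c]], rule smooth_on_mult[OF open_cimg[OF c] smooth_on_const],
          rule smooth_on_pd[OF open_cimg[OF c] D(3)[OF c]])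
  qed (use c in \<open>simp add: ext_d_def\<close>)
  show "ext_d A u c (cmap c x) as = pull (jac c c' (cmap c x)) (ext_d A u c' (cmap c' x)) as"
    if c: "c \<in> A" "c' \<in> A" and x: "x \<in> cdom c \<inter> cdom c'" for c c' x as
  proof -
    let ?y = "cmap c x" and ?y' = "cmap c' x" and ?t = "transition c c'"
    let ?J = "jac c c' ?y"
    have y: "?y \<in> overlap c c'" "?y \<in> cimg c" "?y' \<in> cimg c'" using x cmap_in[of x c] cmap_in[of x c'] by (auto simp: overlap_def)
    have t: "?t ?y = ?y'" using c x by (simp add: transition_cmap)
    define V where "V b bs = pd b (\<lambda>z. u c' z bs) ?y'" for b bs
    define K where "K e b a = pd e (\<lambda>z. jac c c' z b a) ?y" for e b a
    have dJ: "(\<lambda>z. jac c c' z b a) differentiable (at ?y)" for b a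
      by (rule smooth_on_differentiable[OF smooth_jac[OF c] y(1)])
    have dt: "?t differentiable (at ?y)" by (rule transition_differentiable[OF c y(1)])
    have du: "(\<lambda>z. u c' (?t z) bs) differentiable (at ?y)" for bs
      using differentiable_chain_at[OF dt, of "\<lambda>z. u c' z bs"] df[OF c(2) y(3)] by (simp add: t o_def)
    \<comment> \<open>Differentiating the transformation rule of \<open>u\<close> gives two terms:
      second derivatives of the transition map, inside \<open>pull_deriv\<close>, and pulled back
      first derivatives of \<open>u c'\<close>. Antisymmetrization kills the former and turns the
      latter into the pullback of \<open>d\<close>.\<close>
    have "pd e (\<lambda>z. u c z bs) ?y = pull_deriv ?J (K e) (u c' ?y') bs + (\<Sum>b\<in>UNIV. ?J b e * pull ?J (V b) bs)" for e bs
    proof -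
      have "pd e (\<lambda>z. u c z bs) ?y = pd e (\<lambda>z. pull (jac c c' z) (u c' (?t z)) bs) ?y"
      proof (rule pd_cong[OF open_overlap[OF c] y(1)])
        show "u c z bs = pull (jac c c' z) (u c' (?t z)) bs" if "z \<in> overlap c c'" for z
          using that D(4)[OF c] c by (auto simp: overlap_def transition_cmap)
      qed (rule df[OF c(1) y(2)])
      also have "\<dots> = pull_deriv ?J (K e) (u c' ?y') bs + pull ?J (\<lambda>bs. pd e (\<lambda>z. u c' (?t z) bs) ?y) bs"
        unfolding K_def by (subst pd_pull[OF dJ du]) (simp add: t)
      also have "(\<lambda>bs. pd e (\<lambda>z. u c' (?t z) bs) ?y) = (\<lambda>bs. \<Sum>b\<in>UNIV. ?J b e * V b bs)"
      proof
        fix bs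
        have "pd e (\<lambda>z. u c' (?t z) bs) ?y =
          (\<Sum>b\<in>UNIV. pd e (\<lambda>z. coord b (?t z)) ?y * pd b (\<lambda>z. u c' z bs) (?t ?y))"
          by (rule pd_chain[where f="\<lambda>z. u c' z bs"]) (use dt df[OF c(2) y(3)] t in auto)
        then show "pd e (\<lambda>z. u c' (?t z) bs) ?y = (\<Sum>b\<in>UNIV. ?J b e * V b bs)"
          by (simp add: jac_def V_def t)
      qed
      finally show ?thesis by (simp add: pull_sum pull_cmult)
    qed
    then have "ext_d A u c ?y as = alt (\<lambda>e bs. pull_deriv ?J (K e) (u c' ?y') bs + (\<Sum>b\<in>UNIV. ?J b e * pull ?J (V b) bs)) as"
      unfolding ext_d_alt[OF c(1) y(2)] by (rule alt_cong)
    also have "\<dots> = alt (\<lambda>e. pull_deriv ?J (K e) (u c' ?y')) as + pull ?J (alt V) as"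
      by (simp only: alt_add alt_pull)
    also have "alt (\<lambda>e. pull_deriv ?J (K e) (u c' ?y')) as = 0"
    proof (rule alt_pull_deriv[OF D(2)])
      show "K a b e = K e b a" for a b e
        unfolding K_def jac_def
        by (rule pd_pd_commute[OF open_overlap[OF c] smooth_coord_transition[OF c] y(1)])
    qed
    also have "alt V = ext_d A u c' ?y'"
      unfolding V_def[abs_def] by (rule ext) (simp only: ext_d_alt[OF c(2) y(3)])
    finally show ?thesis by simp
  qed
qed

text \<open>Assumption \<open>J\<close> is the transformation law of a vector field; the Jacobian
  attached to the contracted index of \<open>u\<close> is absorbed by it.\<close>

lemma forms_contract:
  assumes u: "u \<in> forms A (Suc k)"
    and sm: "\<And>c b. c \<in> A \<Longrightarrow> smooth_on (cimg c) (\<lambda>y. Y c y b)"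
    and J: "\<And>c c' x b. c \<in> A \<Longrightarrow> c' \<in> A \<Longrightarrow> x \<in> cdom c \<inter> cdom c' \<Longrightarrow>
      Y c' (cmap c' x) b = (\<Sum>a\<in>UNIV. jac c c' (cmap c x) b a * Y c (cmap c x) a)"
  shows "(\<lambda>c y. contract (Y c y) (u c y)) \<in> forms A k"
proof (rule formsI)
  note D = formsD[OF u]
  show "contract (Y c y) (u c y) as = 0" if "\<not> (c \<in> A \<and> y \<in> cimg c \<and> length as = k)" for c y as
    using that D(1)[of c y "_ # as"] by (simp add: contract_def)
  show "skew (contract (Y c y) (u c y))" for c y by (rule contract_skew[OF D(2)])
  show "smooth_on (cimg c) (\<lambda>y. contract (Y c y) (u c y) as)" if c: "c \<in> A" for c as
    unfolding contract_def
    by (rule smooth_on_sum[OF open_cimg[OF c]], rule smooth_on_mult[OF open_cimg[OF c] sm[OF c] D(3)[OF c]])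
  show "contract (Y c (cmap c x)) (u c (cmap c x)) as =
      pull (jac c c' (cmap c x)) (contract (Y c' (cmap c' x)) (u c' (cmap c' x))) as"
    if c: "c \<in> A" "c' \<in> A" and x: "x \<in> cdom c \<inter> cdom c'" for c c' x as
  proof -
    let ?J = "jac c c' (cmap c x)" and ?u = "u c' (cmap c' x)"
    have "contract (Y c (cmap c x)) (u c (cmap c x)) as =
        (\<Sum>a\<in>UNIV. \<Sum>b\<in>UNIV. Y c (cmap c x) a * (?J b a * pull ?J (slot b ?u) as))"
      unfolding contract_def D(4)[OF c x] pull_Cons sum_distrib_left ..
    also have "\<dots> = (\<Sum>b\<in>UNIV. (\<Sum>a\<in>UNIV. ?J b a * Y c (cmap c x) a) * pull ?J (slot b ?u) as)"
      unfolding sum_distrib_right by (subst sum.swap) (simp add: mult_ac)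
    also have "\<dots> = (\<Sum>b\<in>UNIV. Y c' (cmap c' x) b * pull ?J (slot b ?u) as)"
      by (simp only: J[OF c x])
    also have "\<dots> = pull ?J (contract (Y c' (cmap c' x)) ?u) as"
      unfolding contract_def by (simp only: pull_sum pull_cmult slot_def)
    finally show ?thesis .
  qed
qed

end

section \<open>Integration and nondegeneracy\<close>

lemma smooth_on_det:
  fixes M :: "'a::real_normed_vector \<Rightarrow> complex^'n^'n"
  assumes "open S" "\<And>i j. smooth_on S (\<lambda>y. M y $ i $ j)"
  shows "smooth_on S (\<lambda>y. det (M y))"
  unfolding det_def
  by (rule smooth_on_sum[OF assms(1)], rule smooth_on_mult[OF assms(1) smooth_on_const],
      rule smooth_on_prod[OF assms(1) assms(2)])

context hermitian_point
begin

text \<open>Cramer's rule writes the entries of the inverse as quotients of polynomials in the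
  entries of \<open>h\<close>, which is how their smoothness is obtained.\<close>

lemma hi_cramer: "hi $ j $ k = det (\<chi> a b. if b = j then axis k 1 $ a else h $ a $ b) / det h"
proof -
  have "det h \<noteq> 0" using invertible_h by (simp add: invertible_det_nz)
  moreover have "h *v (hi *v axis k 1) = axis k 1"
    by (simp add: matrix_vector_mul_assoc h_hi)
  ultimately have "hi *v axis k 1 = (\<chi> j. det (\<chi> a b. if b = j then axis k 1 $ a else h $ a $ b) / det h)"
    using cramer by blast
  moreover have "(hi *v axis k 1) $ j = hi $ j $ k"
    by (simp add: matrix_vector_mult_def axis_def if_distrib cong: if_cong)
  ultimately show ?thesis by simp
qed

lemma cometric_block: "isl a \<noteq> isl b \<Longrightarrow> cometric w a b = 0"
  by (cases a; cases b) auto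

text \<open>A real factor depending on the bidegree is self-adjoint, because different bidegrees are
  orthogonal.\<close>

lemma tip_weight:
  "tip w (\<lambda>as. of_real (\<phi> (hdeg as) (adeg as)) * s as) t = tip w s (\<lambda>as. of_real (\<phi> (hdeg as) (adeg as)) * t as)"
proof -
  have "tp (cometric w) k (\<lambda>as. of_real (\<phi> (hdeg as) (adeg as)) * s as) t =
      tp (cometric w) k s (\<lambda>as. of_real (\<phi> (hdeg as) (adeg as)) * t as)" for k
    unfolding tp_def
  proof (intro sum.cong refl)
    fix as bs :: "'n cidx list"
    assume l: "as \<in> {as. length as = k}" "bs \<in> {bs. length bs = k}"
    show "(\<Prod>m<k. cometric w (as ! m) (bs ! m)) * (of_real (\<phi> (hdeg as) (adeg as)) * s as) * cnj (t bs) =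
        (\<Prod>m<k. cometric w (as ! m) (bs ! m)) * s as * cnj (of_real (\<phi> (hdeg bs) (adeg bs)) * t bs)"
    proof (cases "(\<Prod>m<k. cometric w (as ! m) (bs ! m)) = 0")
      case False
      then have "hdeg as = hdeg bs" "adeg as = adeg bs"
        using prod_isl[where J = "cometric w" and as = bs and bs = as] l cometric_block by auto
      then show ?thesis by simp
    qed simp
  qed
  then show ?thesis by (simp add: tip_tp)
qed

end

locale hermitian_manifold = cmanifold X A
  for X :: "'x topology" and A :: "('x, 'n::finite) chart set" +
  fixes \<omega> :: "('x, 'n) form"
  assumes compact: "compact_space X" and metric: "hermitian_metric A \<omega>"
begin

lemma \<omega>_form: "\<omega> \<in> forms A 2"
  using metric by (simp add: hermitian_metric_def)

lemma hermitian_point: "c \<in> A \<Longrightarrow> y \<in> cimg c \<Longrightarrow> hermitian_point (\<omega> c y)"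
  using metric formsD(2)[OF \<omega>_form] by (simp add: hermitian_point_def hermitian_metric_def)

lemma smooth_hmat: "c \<in> A \<Longrightarrow> smooth_on (cimg c) (\<lambda>y. hmat (\<omega> c y) $ i $ j)"
proof -
  assume c: "c \<in> A"
  have "smooth_on (cimg c) (\<lambda>y. (- \<i>) * \<omega> c y [Inl i, Inr j])"
    by (rule smooth_on_mult[OF open_cimg[OF c] smooth_on_const formsD(3)[OF \<omega>_form c]])
  then show ?thesis by (simp add: hmat_def)
qed

lemma smooth_det_hmat: "c \<in> A \<Longrightarrow> smooth_on (cimg c) (\<lambda>y. det (hmat (\<omega> c y)))"
  by (rule smooth_on_det[OF open_cimg smooth_hmat])

lemma smooth_inverse_hmat:
  assumes c: "c \<in> A"
  shows "smooth_on (cimg c) (\<lambda>y. matrix_inv (hmat (\<omega> c y)) $ i $ j)"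
proof (rule smooth_on_cong[OF open_cimg[OF c]])
  let ?M = "\<lambda>y. (\<chi> a b. if b = i then axis j 1 $ a else hmat (\<omega> c y) $ a $ b) :: complex^'n^'n"
  show "smooth_on (cimg c) (\<lambda>y. det (?M y) / det (hmat (\<omega> c y)))"
  proof (rule smooth_on_divide[OF open_cimg[OF c] _ smooth_on_det[OF open_cimg[OF c]] smooth_det_hmat[OF c]])
    show "det (hmat (\<omega> c y)) \<noteq> 0" if "y \<in> cimg c" for y
      using hermitian_point.det_h[OF hermitian_point[OF c that]] by auto
    show "smooth_on (cimg c) (\<lambda>y. ?M y $ a $ b)" for a b
      using smooth_hmat[OF c] by (cases "b = i") (simp_all add: smooth_on_const)
  qed
qed (simp add: hermitian_point.hi_cramer[OF hermitian_point[OF c]])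

lemma continuous_tip:
  assumes c: "c \<in> A" and u: "u \<in> forms A k" and v: "v \<in> forms A l"
  shows "continuous_on (cimg c) (\<lambda>y. tip (\<omega> c y) (u c y) (v c y))"
proof -
  have g: "continuous_on (cimg c) (\<lambda>y. cometric (\<omega> c y) a b)" for a b
    using smooth_on_continuous[OF smooth_inverse_hmat[OF c]] by (cases a; cases b) auto
  show ?thesis
    unfolding tip_def
    by (intro continuous_on_sum continuous_on_mult continuous_on_divide continuous_on_const
        continuous_on_prod continuous_on_cnj g smooth_on_continuous
        formsD(3)[OF u c] formsD(3)[OF v c]) auto
qed

text \<open>\<open>vol_integral\<close> uses an unspecified partition, about which nothing is known
  until one exists. A compact Hausdorff space is regular, which yields open sets with closure inside
  a chart domain; a finite subcover is made disjoint by removing the earlier sets.\<close>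

lemma chart_partition_exists: "\<exists>P. chart_partition X A P"
proof -
  let ?\<U> = "{U. openin X U \<and> (\<exists>c\<in>A. U \<subseteq> cdom c \<and> X closure_of U \<subseteq> cdom c)}"
  have haus: "Hausdorff_space X" and cover: "(\<Union>c\<in>A. cdom c) = topspace X"
    using cm by (auto simp: complex_manifold_def)
  have nbhd: "\<exists>U\<in>?\<U>. x \<in> U" if x: "x \<in> topspace X" for x
  proof -
    obtain c where c: "c \<in> A" "x \<in> cdom c" using x cover by blast
    have nb: "neighbourhood_base_of (closedin X) X"
      using compact haus by (simp add: neighbourhood_base_of_closedin compact_Hausdorff_imp_regular_space)
    then obtain U V where UV: "openin X U" "closedin X V" "x \<in> U" "U \<subseteq> V" "V \<subseteq> cdom c"
      using nb[unfolded neighbourhood_base_of, rule_format, of "cdom c" x] openin_cdom[OF c(1)] c(2) by auto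
    then have "X closure_of U \<subseteq> cdom c" using closure_of_minimal by blast
    then show ?thesis using UV c by blast
  qed
  have "topspace X \<subseteq> \<Union> ?\<U>"
  proof
    fix x assume "x \<in> topspace X"
    from nbhd[OF this] show "x \<in> \<Union> ?\<U>" by (elim bexE) (rule UnionI)
  qed
  then have "\<exists>\<F>. finite \<F> \<and> \<F> \<subseteq> ?\<U> \<and> topspace X \<subseteq> \<Union> \<F>"
    by (intro compact[unfolded compact_space_alt, rule_format] conjI) simp_all
  then obtain \<F> where F: "finite \<F>" "\<F> \<subseteq> ?\<U>" "topspace X \<subseteq> \<Union> \<F>"
    by (elim exE conjE)
  obtain U where U: "bij_betw U {0..<card \<F>} \<F>"
    using ex_bij_betw_nat_finite[OF F(1)] by blast
  let ?n = "card \<F>"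
  have U\<U>: "U i \<in> ?\<U>" if "i < ?n" for i
  proof -
    have "U i \<in> \<F>" using bij_betwE[OF U] that by simp
    then show ?thesis by (rule subsetD[OF F(2)])
  qed
  have "\<forall>i\<in>{..<?n}. \<exists>c. c \<in> A \<and> U i \<subseteq> cdom c \<and> X closure_of (U i) \<subseteq> cdom c"
    using U\<U> unfolding mem_Collect_eq Bex_def by simp
  from bchoice[OF this] obtain ch
    where ch': "\<forall>i\<in>{..<?n}. ch i \<in> A \<and> U i \<subseteq> cdom (ch i) \<and> X closure_of (U i) \<subseteq> cdom (ch i)" ..
  have ch: "ch i \<in> A" "U i \<subseteq> cdom (ch i)" "X closure_of (U i) \<subseteq> cdom (ch i)" if "i < ?n" for i
    using ch' that by simp_all
  have openU: "openin X (U i)" if "i < ?n" for i using U\<U>[OF that] by simp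
  define V where "V i = U i - (\<Union>j<i. U j)" for i
  have VU: "V i \<subseteq> U i" for i by (auto simp: V_def)
  have "chart_partition X A ((\<lambda>i. (ch i, V i)) ` {..<?n})"
    unfolding chart_partition_def
  proof (intro conjI)
    show "finite ((\<lambda>i. (ch i, V i)) ` {..<?n})" by simp
    have "ch i \<in> A \<and> V i \<subseteq> cdom (ch i) \<and> X closure_of V i \<subseteq> cdom (ch i) \<and> cmap (ch i) ` V i \<in> sets borel"
      if i: "i < ?n" for i
    proof -
      \<comment> \<open>A difference of two open sets in the chart, hence a Borel set.\<close>
      have "cmap (ch i) ` V i = cmap (ch i) ` U i - cmap (ch i) ` (U i \<inter> (\<Union>j<i. U j))"
      proof -
        have "V i = U i - U i \<inter> (\<Union>j<i. U j)" by (auto simp: V_def)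
        then show ?thesis
          using inj_on_image_set_diff[OF inj_cmap[OF ch(1)[OF i]], of "U i" "U i \<inter> (\<Union>j<i. U j)"] ch(2)[OF i]
          by (simp add: subset_iff)
      qed
      moreover have "open (cmap (ch i) ` U i)" "open (cmap (ch i) ` (U i \<inter> (\<Union>j<i. U j)))"
        by (intro open_cmap_image openin_Int openin_Union ch[OF i] openU[OF i] le_infI1;
            use i openU in force)+
      ultimately have "cmap (ch i) ` V i \<in> sets borel" by simp
      then show ?thesis
        using ch[OF i] VU[of i] closure_of_mono[OF VU[of i], of X] by (intro conjI) (blast | assumption)+
    qed
    then show "\<forall>(c, V)\<in>(\<lambda>i. (ch i, V i)) ` {..<?n}.
        c \<in> A \<and> V \<subseteq> cdom c \<and> X closure_of V \<subseteq> cdom c \<and> cmap c ` V \<in> sets borel"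
      by auto
    show "disjoint_family_on snd ((\<lambda>i. (ch i, V i)) ` {..<?n})"
    proof -
      have "V i \<inter> V j = {}" if "i < j" for i j using that by (auto simp: V_def)
      then have dis: "V i \<inter> V j = {}" if "i \<noteq> j" for i j
        using that Int_commute[of "V i" "V j"] by (cases i j rule: linorder_cases) auto
      show ?thesis
        unfolding disjoint_family_on_def
      proof (intro ballI impI)
        fix p q
        assume pq: "p \<in> (\<lambda>i. (ch i, V i)) ` {..<?n}" "q \<in> (\<lambda>i. (ch i, V i)) ` {..<?n}" "p \<noteq> q"
        then obtain i j where ij: "p = (ch i, V i)" "q = (ch j, V j)" by blast
        with pq(3) have "i \<noteq> j" by auto
        then show "snd p \<inter> snd q = {}" by (simp add: ij dis)
      qed
    qed
    have "x \<in> (\<Union>i<?n. V i)" if x: "x \<in> topspace X" for x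
    proof -
      define i where "i = (LEAST i. i < ?n \<and> x \<in> U i)"
      have "\<exists>i. i < ?n \<and> x \<in> U i" proof -
        obtain W where "W \<in> \<F>" "x \<in> W" using x F(3) by blast
        moreover have "W \<in> U ` {0..<?n}" using bij_betw_imp_surj_on[OF U] \<open>W \<in> \<F>\<close> by simp
        ultimately show ?thesis by (elim imageE) auto
      qed
      then have i: "i < ?n \<and> x \<in> U i" unfolding i_def by (rule LeastI_ex)
      have "x \<notin> U j" if "j < i" for j
        using not_less_Least[of j "\<lambda>i. i < ?n \<and> x \<in> U i"] that i unfolding i_def by linarith
      then show ?thesis using i by (auto simp: V_def)
    qed
    moreover have "V i \<subseteq> topspace X" if "i < ?n" for i
      using VU[of i] openin_subset[OF openU[OF that]] by blast
    ultimately show "(\<Union>(c, V)\<in>(\<lambda>i. (ch i, V i)) ` {..<?n}. V) = topspace X" by auto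
  qed
  then show ?thesis ..
qed

definition pieces :: "(('x, 'n) chart \<times> 'x set) set" where
  "pieces = (SOME P. chart_partition X A P)"

lemma pieces: "chart_partition X A pieces"
  unfolding pieces_def by (rule someI_ex[OF chart_partition_exists])

lemma finite_pieces: "finite pieces"
  using pieces by (simp add: chart_partition_def)

lemma piecesD:
  assumes "(c, V) \<in> pieces"
  shows "c \<in> A" "V \<subseteq> cdom c" "X closure_of V \<subseteq> cdom c" "cmap c ` V \<in> sets borel" "cmap c ` V \<subseteq> cimg c"
  using assms pieces unfolding chart_partition_def cimg_def by blast+

lemma pieces_cover: "x \<in> topspace X \<Longrightarrow> \<exists>c V. (c, V) \<in> pieces \<and> x \<in> V"
  using pieces unfolding chart_partition_def by blast

definition density :: "(('x, 'n) chart \<Rightarrow> complex^'n \<Rightarrow> complex) \<Rightarrow> ('x, 'n) chart \<Rightarrow> complex^'n \<Rightarrow> complex" where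
  "density f c y = f c y * 2 ^ CARD('n) * det (hmat (\<omega> c y))"

lemma vol_integral_pieces:
  "vol_integral X A \<omega> f = (\<Sum>(c, V)\<in>pieces. set_lebesgue_integral lborel (cmap c ` V) (density f c))"
  unfolding vol_integral_def pieces_def density_def ..

text \<open>The class of integrands on which the integral is shown to be linear; continuity in each
  chart makes every piece integrable.\<close>

definition chartwise_continuous :: "(('x, 'n) chart \<Rightarrow> complex^'n \<Rightarrow> complex) \<Rightarrow> bool" where
  "chartwise_continuous f \<longleftrightarrow> (\<forall>c\<in>A. continuous_on (cimg c) (f c))"

text \<open>The piece itself may fail to be compact; its closure is compact and stays inside the
  chart domain, where \<open>f\<close> is continuous.\<close>

lemma piece_integrable:
  fixes f :: "complex^'n \<Rightarrow> complex"
  assumes "(c, V) \<in> pieces" "continuous_on (cimg c) f"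
  shows "set_integrable lborel (cmap c ` V) f"
proof -
  note D = piecesD[OF assms(1)]
  let ?K = "X closure_of V"
  have "compactin X ?K" by (rule closedin_compact_space[OF compact closedin_closure_of])
  then have "compactin (subtopology X (cdom c)) ?K" using D(3) by (simp add: compactin_subtopology)
  then have "compactin (top_of_set (cimg c)) (cmap c ` ?K)"
    by (rule image_compactin[OF _ homeomorphic_imp_continuous_map[OF chart_homeo[OF D(1)]]])
  then have K: "compact (cmap c ` ?K)" "cmap c ` ?K \<subseteq> cimg c" by (auto simp: compactin_subtopology)
  have i: "set_integrable lborel (cmap c ` ?K) f"
    unfolding set_integrable_def
    by (rule borel_integrable_compact[OF K(1) continuous_on_subset[OF assms(2) K(2)]])
  have "V \<subseteq> topspace X" using D(1,2) cdom_subset by blast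
  then have "cmap c ` V \<subseteq> cmap c ` ?K" using closure_of_subset by blast
  then show ?thesis using set_integrable_subset[OF i] D(4) by simp
qed

lemma density_continuous:
  "chartwise_continuous f \<Longrightarrow> c \<in> A \<Longrightarrow> continuous_on (cimg c) (density f c)"
  unfolding density_def chartwise_continuous_def
  by (intro continuous_on_mult continuous_on_const smooth_on_continuous[OF smooth_det_hmat]) auto

lemma vol_integral_cong:
  assumes "\<And>c y. c \<in> A \<Longrightarrow> y \<in> cimg c \<Longrightarrow> f c y = f' c y"
  shows "vol_integral X A \<omega> f = vol_integral X A \<omega> f'"
  unfolding vol_integral_pieces
proof (rule sum.cong[OF refl], clarify)
  fix c V assume p: "(c, V) \<in> pieces"
  note D = piecesD[OF p]
  show "set_lebesgue_integral lborel (cmap c ` V) (density f c) = set_lebesgue_integral lborel (cmap c ` V) (density f' c)"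
  proof (rule set_lebesgue_integral_cong)
    show "\<forall>y. y \<in> cmap c ` V \<longrightarrow> density f c y = density f' c y"
      using assms[OF D(1)] subsetD[OF D(5)] by (simp add: density_def)
  qed (use D(4) in simp)
qed

lemma vol_integral_add:
  assumes "chartwise_continuous f" "chartwise_continuous f'"
  shows "vol_integral X A \<omega> (\<lambda>c y. f c y + f' c y) = vol_integral X A \<omega> f + vol_integral X A \<omega> f'"
proof -
  have "set_lebesgue_integral lborel (cmap c ` V) (density (\<lambda>c y. f c y + f' c y) c) =
      set_lebesgue_integral lborel (cmap c ` V) (density f c) + set_lebesgue_integral lborel (cmap c ` V) (density f' c)"
    if p: "(c, V) \<in> pieces" for c V
  proof -
    have "density (\<lambda>c y. f c y + f' c y) c = (\<lambda>y. density f c y + density f' c y)"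
      by (auto simp: density_def algebra_simps)
    then show ?thesis
      using set_integral_add(2)[OF piece_integrable[OF p density_continuous] piece_integrable[OF p density_continuous]]
        assms piecesD(1)[OF p] by simp
  qed
  then show ?thesis
    unfolding vol_integral_pieces sum.distrib[symmetric] by (intro sum.cong refl) auto
qed

lemma vol_integral_cmult:
  "vol_integral X A \<omega> (\<lambda>c y. a * f c y) = a * vol_integral X A \<omega> f"
proof -
  have "density (\<lambda>c y. a * f c y) c = (\<lambda>y. a * density f c y)" for c
    by (auto simp: density_def algebra_simps)
  then show ?thesis
    unfolding vol_integral_pieces sum_distrib_left by (intro sum.cong refl) auto
qed

lemma chartwise_continuous_sum:
  "(\<And>i. i \<in> I \<Longrightarrow> chartwise_continuous (f i)) \<Longrightarrow> chartwise_continuous (\<lambda>c y. \<Sum>i\<in>I. f i c y)"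
  by (simp add: chartwise_continuous_def continuous_on_sum)

lemma vol_integral_sum:
  assumes "\<And>i. i \<in> I \<Longrightarrow> chartwise_continuous (f i)"
  shows "vol_integral X A \<omega> (\<lambda>c y. \<Sum>i\<in>I. f i c y) = (\<Sum>i\<in>I. vol_integral X A \<omega> (f i))"
  using assms
proof (induction I rule: infinite_finite_induct)
  case (insert i I)
  then show ?case by (simp add: vol_integral_add chartwise_continuous_sum)
qed (use vol_integral_cmult[of 0 "\<lambda>c y. 0"] in simp_all)

lemma chartwise_continuous_tip:
  "u \<in> forms A k \<Longrightarrow> v \<in> forms A l \<Longrightarrow> chartwise_continuous (\<lambda>c y. tip (\<omega> c y) (u c y) (v c y))"
  by (simp add: chartwise_continuous_def continuous_tip)

lemma l2_diff_right:
  assumes "u \<in> forms A k" "v \<in> forms A k" "v' \<in> forms A k"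
  shows "l2 X A \<omega> u (v - v') = l2 X A \<omega> u v - l2 X A \<omega> u v'"
proof -
  have "l2 X A \<omega> u (v - v') = vol_integral X A \<omega> (\<lambda>c y. tip (\<omega> c y) (u c y) (v c y) + (-1) * tip (\<omega> c y) (u c y) (v' c y))"
    unfolding l2_def by (rule vol_integral_cong) (simp add: fun_diff_def tip_diff_right)
  also have "\<dots> = l2 X A \<omega> u v + vol_integral X A \<omega> (\<lambda>c y. (-1) * tip (\<omega> c y) (u c y) (v' c y))"
    unfolding l2_def using assms
    by (intro vol_integral_add chartwise_continuous_tip)
      (auto simp: chartwise_continuous_def intro!: continuous_on_minus continuous_tip)
  finally show ?thesis by (simp only: vol_integral_cmult l2_def) simp
qed

section \<open>Definiteness of the \<open>L\<^sup>2\<close> product on smooth forms\<close>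

text \<open>A nonnegative density with zero integral vanishes almost everywhere on each piece.
  Pieces may have no interior, so continuity cannot be used piece by piece. Instead, in a fixed
  chart, the open set where a component of \<open>b\<close> is nonzero is covered by finitely many
  images of null sets under differentiable transition maps, and a negligible open set is
  empty.\<close>

lemma l2_nondegenerate:
  assumes b: "b \<in> forms A k" and z: "l2 X A \<omega> b b = 0"
  shows "b = 0"
proof -
  note D = formsD[OF b]
  define f where "f c y = tip (\<omega> c y) (b c y) (b c y)" for c y
  have fc: "chartwise_continuous f" unfolding f_def by (rule chartwise_continuous_tip[OF b b])
  have pos: "0 \<le> Re (density f c y)" and zero: "Re (density f c y) = 0 \<Longrightarrow> b c y as = 0"
    if c: "c \<in> A" "y \<in> cimg c" for c y as
  proof -
    interpret hermitian_point "\<omega> c y" by (rule hermitian_point[OF c])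
    obtain d where d: "d > 0" "det h = of_real d" using det_h by blast
    have r: "Re (density f c y) = Re (f c y) * 2 ^ CARD('n) * d"
      by (simp add: density_def d f_def tip_self_nonneg(2) flip: of_real_power)
    then show "0 \<le> Re (density f c y)" using tip_self_nonneg(1)[of "b c y"] d(1) by (simp add: f_def)
    assume "Re (density f c y) = 0"
    then have "Re (f c y) = 0" using r d(1) by simp
    then have "f c y = 0" using tip_self_nonneg(2) by (simp add: f_def complex_eq_iff)
    then show "b c y as = 0" unfolding f_def by (rule skew_tip_self_zero[OF D(2)])
  qed
  define N where "N c V = {y \<in> cmap c ` V. Re (density f c y) \<noteq> 0}" for c and V :: "'x set"
  have neg: "negligible (N c V)" if p: "(c, V) \<in> pieces" for c V
  proof -
    define F where "F c V y = indicator (cmap c ` V) y *\<^sub>R Re (density f c y)" for c V y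
    have int: "integrable lborel (F c V)" and
      re: "Re (set_lebesgue_integral lborel (cmap c ` V) (density f c)) = integral\<^sup>L lborel (F c V)" and
      nn: "0 \<le> F c V y" if p: "(c, V) \<in> pieces" for c V y
    proof -
      have i: "integrable lborel (\<lambda>y. indicator (cmap c ` V) y *\<^sub>R density f c y)"
        using piece_integrable[OF p density_continuous[OF fc piecesD(1)[OF p]]] by (simp add: set_integrable_def)
      have e: "F c V = (\<lambda>y. Re (indicator (cmap c ` V) y *\<^sub>R density f c y))" by (auto simp: F_def)
      show "integrable lborel (F c V)"
        unfolding e by (rule integrable_bounded_linear[OF bounded_linear_Re i])
      show "Re (set_lebesgue_integral lborel (cmap c ` V) (density f c)) = integral\<^sup>L lborel (F c V)"
        unfolding e set_lebesgue_integral_def by (rule integral_bounded_linear[OF bounded_linear_Re i, symmetric])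
      show "0 \<le> F c V y"
        using pos[of c y] piecesD(1,5)[OF p] by (cases "y \<in> cmap c ` V") (auto simp: F_def)
    qed
    have "0 = Re (l2 X A \<omega> b b)" by (simp add: z)
    also have "\<dots> = (\<Sum>(c, V)\<in>pieces. integral\<^sup>L lborel (F c V))"
      unfolding l2_def vol_integral_pieces f_def[symmetric] Re_sum
      by (rule sum.cong[OF refl], clarify) (rule re)
    finally have "(\<Sum>(c, V)\<in>pieces. integral\<^sup>L lborel (F c V)) = 0" by simp
    then have "integral\<^sup>L lborel (F c V) = 0"
      by (subst (asm) sum_nonneg_eq_0_iff) (use finite_pieces p nn in \<open>auto intro!: integral_nonneg_AE\<close>)
    then have ae: "AE y in lborel. F c V y = 0"
      using integral_nonneg_eq_0_iff_AE[OF int[OF p]] nn[OF p] by auto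
    have N: "N c V = {y \<in> space lborel. \<not> F c V y = 0}" by (auto simp: N_def F_def indicator_def)
    have "F c V \<in> borel_measurable lborel" using int[OF p] by (rule borel_measurable_integrable)
    then have "N c V \<in> sets lborel" unfolding N by measurable
    then have "N c V \<in> null_sets lborel" using ae N by (simp add: AE_iff_measurable null_sets_def)
    then show ?thesis by (simp add: negligible_iff_null_sets null_sets_completionI)
  qed
  have *: "b c0 y0 as = 0" if c0: "c0 \<in> A" "y0 \<in> cimg c0" for c0 y0 as
  proof -
    define Z where "Z = {y \<in> cimg c0. b c0 y as \<noteq> 0}"
    have "open (cimg c0 \<inter> (\<lambda>y. b c0 y as) -` (- {0}))"
      by (rule continuous_open_preimage[OF smooth_on_continuous[OF D(3)[OF c0(1)]] open_cimg[OF c0(1)]]) (simp add: open_Compl)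
    moreover have "cimg c0 \<inter> (\<lambda>y. b c0 y as) -` (- {0}) = Z" by (auto simp: Z_def)
    ultimately have "open Z" by simp
    have "Z \<subseteq> (\<Union>(c, V)\<in>pieces. transition c c0 ` (N c V \<inter> overlap c c0))"
    proof
      fix y assume y: "y \<in> Z"
      define x where "x = cinv c0 y"
      have yc: "y \<in> cimg c0" and yx: "cmap c0 x = y" and x: "x \<in> cdom c0" "x \<in> topspace X"
        using y cinv_in[of y c0] cmap_cinv[of y c0] cdom_subset[OF c0(1)] unfolding Z_def x_def by blast+
      obtain c V where cV: "(c, V) \<in> pieces" "x \<in> V" using pieces_cover[OF x(2)] by blast
      note P = piecesD[OF cV(1)]
      have xc: "x \<in> cdom c" using P(2) cV(2) by blast
      \<comment> \<open>Vanishing at a point does not depend on the chart, by the transformation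
        rule; so the nonzero component seen in \<open>c0\<close> forces a nonzero one in the chart
        of the piece.\<close>
      have "b c (cmap c x) \<noteq> (\<lambda>_. 0)"
      proof
        assume "b c (cmap c x) = (\<lambda>_. 0)"
        then have "b c0 y as = 0" using D(4)[OF c0(1) P(1), of x as] x xc yx by (simp add: pull_def)
        then show False using y by (simp add: Z_def)
      qed
      then have "Re (density f c (cmap c x)) \<noteq> 0" using zero[OF P(1) cmap_in[OF xc]] by blast
      then have "cmap c x \<in> N c V \<inter> overlap c c0" using cV(2) xc x by (auto simp: N_def overlap_def)
      moreover have "transition c c0 (cmap c x) = y" using transition_cmap[OF P(1) xc] yx by simp
      ultimately have "y \<in> transition c c0 ` (N c V \<inter> overlap c c0)" by (metis imageI)
      then show "y \<in> (\<Union>(c, V)\<in>pieces. transition c c0 ` (N c V \<inter> overlap c c0))"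
        using cV(1) by (intro UN_I[of "(c, V)"]) simp_all
    qed
    moreover have "negligible (\<Union>(c, V)\<in>pieces. transition c c0 ` (N c V \<inter> overlap c c0))"
    proof (intro negligible_Union finite_imageI finite_pieces, clarify)
      fix c V assume p: "(c, V) \<in> pieces"
      show "negligible (transition c c0 ` (N c V \<inter> overlap c c0))"
      proof (rule negligible_differentiable_image_negligible[OF order_refl])
        show "negligible (N c V \<inter> overlap c c0)" using neg[OF p] by (rule negligible_subset) blast
        show "transition c c0 differentiable_on (N c V \<inter> overlap c c0)"
          unfolding differentiable_on_def
          using transition_differentiable[OF piecesD(1)[OF p] c0(1)] differentiable_at_withinI by blast
      qed
    qed
    ultimately have "negligible Z" using negligible_subset by blast
    then have "Z = {}" using open_not_negligible[OF \<open>open Z\<close>] by blast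
    then show ?thesis using c0 by (auto simp: Z_def)
  qed
  have "b c y as = 0" for c y as
    using *[of c y as] D(1)[of c y as] by blast
  then show ?thesis by (intro ext) simp
qed

end

section \<open>The twisted adjoint\<close>

lemma tip_sum_right: "tip w s (\<lambda>as. \<Sum>i\<in>I. f i as) = (\<Sum>i\<in>I. tip w s (f i))"
  by (simp add: tip_tp tp_sum_right sum_divide_distrib sum.swap[of _ I])

lemma tip_scale_right: "tip w s (\<lambda>as. complex_of_real r * t as) = of_real r * tip w s t"
  using tip_cmult_right[of w s "of_real r" t] by simp

lemma sum_single_bidegree:
  assumes "p \<le> n" "q \<le> m"
  shows "(\<Sum>p'\<le>n. \<Sum>q'\<le>m. if p = p' \<and> q = q' then f p' q' else (0::complex)) = f (p::nat) (q::nat)"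
proof -
  have "(\<Sum>q'\<le>m. if p = p' \<and> q = q' then f p' q' else 0) = (if p = p' then f p' q else 0)" for p'
    using assms by (cases "p = p'") simp_all
  then show ?thesis using assms by simp
qed

lemma form_sum_apply: "(\<Sum>i\<in>I. f i) c y as = (\<Sum>i\<in>I. (f i :: ('x, 'n) form) c y as)"
  by (induction I rule: infinite_finite_induct) simp_all

locale twisted_manifold = hermitian_manifold X A \<omega>
  for X :: "'x topology" and A :: "('x, 'n::finite) chart set" and \<omega> :: "('x, 'n) form" +
  fixes \<eta> :: "'x \<Rightarrow> real"
  assumes smooth_\<eta>: "smooth_fun A \<eta>" and \<eta>_pos: "\<forall>x\<in>topspace X. 0 < \<eta> x"
begin

lemma loc_pos: "c \<in> A \<Longrightarrow> y \<in> cimg c \<Longrightarrow> 0 < loc \<eta> c y"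
  using \<eta>_pos cinv_topspace by (simp add: loc_def)

lemma smooth_loc: "c \<in> A \<Longrightarrow> smooth_on (cimg c) (\<lambda>y. complex_of_real (loc \<eta> c y))"
  using smooth_\<eta> unfolding smooth_fun_def by (blast intro: smooth_on_of_real open_cimg)

lemma smooth_loc_powi:
  assumes c: "c \<in> A"
  shows "smooth_on (cimg c) (\<lambda>y. complex_of_real (loc \<eta> c y powi k))"
proof (cases "k \<ge> 0")
  case True
  then show ?thesis
    using smooth_on_power[OF open_cimg[OF c] smooth_loc[OF c], of "nat k"] by (simp add: power_int_def)
next
  case False
  have "smooth_on (cimg c) (\<lambda>y. inverse (complex_of_real (loc \<eta> c y) ^ nat (- k)))"
    by (rule smooth_on_inverse[OF open_cimg[OF c] _ smooth_on_power[OF open_cimg[OF c] smooth_loc[OF c]]])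
      (use loc_pos[OF c] in force)
  then show ?thesis using False by (simp add: power_int_def power_inverse)
qed

section \<open>Powers of \<eta> and the twisted inner product\<close>

text \<open>\<theta>, its inverse, the weights of the twisted product and the prefactors in
  \<open>T_star\<close> are all of this kind; composing them adds exponents, for which integers are
  used.\<close>

definition eta_pow :: "(nat \<Rightarrow> int) \<Rightarrow> ('x, 'n) form \<Rightarrow> ('x, 'n) form" where
  "eta_pow k u = (\<lambda>c y as. complex_of_real (loc \<eta> c y powi k (hdeg as)) * u c y as)"

lemma forms_eta_pow:
  assumes "u \<in> forms A j"
  shows "eta_pow k u \<in> forms A j"
proof -
  have "weigh (\<lambda>p q x. complex_of_real (\<eta> x powi k p)) u \<in> forms A j"
    by (rule forms_weigh[OF assms]) (use smooth_loc_powi in \<open>simp add: loc_def\<close>)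
  then show ?thesis by (simp add: weigh_def eta_pow_def loc_def)
qed

lemma forms_outside: "u \<in> forms A j \<Longrightarrow> \<not> (c \<in> A \<and> y \<in> cimg c) \<Longrightarrow> u c y = (\<lambda>as. 0)"
  using formsD(1) by blast

lemma eta_pow_eta_pow:
  assumes "u \<in> forms A j"
  shows "eta_pow k (eta_pow l u) = eta_pow (\<lambda>p. k p + l p) u"
proof (intro ext)
  fix c y as
  show "eta_pow k (eta_pow l u) c y as = eta_pow (\<lambda>p. k p + l p) u c y as"
  proof (cases "c \<in> A \<and> y \<in> cimg c")
    case True
    then have "loc \<eta> c y \<noteq> 0" using loc_pos by fastforce
    then show ?thesis by (simp add: eta_pow_def power_int_add)
  qed (use forms_outside[OF assms] in \<open>simp add: eta_pow_def\<close>)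
qed

lemma eta_pow_0: "eta_pow (\<lambda>p. 0) u = u"
  by (simp add: eta_pow_def)

lemma theta_eta_pow: "theta \<eta> u = eta_pow int u"
  by (simp add: theta_def eta_pow_def)

lemma theta_inv_eta_pow: "theta_inv \<eta> u = eta_pow (\<lambda>p. - int p) u"
  by (simp add: theta_inv_def eta_pow_def power_int_minus divide_inverse mult.commute)

lemma theta_theta_inv: "u \<in> forms A j \<Longrightarrow> theta \<eta> (theta_inv \<eta> u) = u"
  unfolding theta_eta_pow theta_inv_eta_pow by (subst eta_pow_eta_pow) (simp_all add: eta_pow_0)

lemma theta_inv_theta: "u \<in> forms A j \<Longrightarrow> theta_inv \<eta> (theta \<eta> u) = u"
  unfolding theta_eta_pow theta_inv_eta_pow by (subst eta_pow_eta_pow) (simp_all add: eta_pow_0)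

lemma forms_theta: "u \<in> forms A j \<Longrightarrow> theta \<eta> u \<in> forms A j"
  by (simp add: theta_eta_pow forms_eta_pow)

lemma forms_theta_inv: "u \<in> forms A j \<Longrightarrow> theta_inv \<eta> u \<in> forms A j"
  by (simp add: theta_inv_eta_pow forms_eta_pow)

lemma theta_add: "theta \<eta> (u + v) = theta \<eta> u + theta \<eta> v"
  by (simp add: theta_def plus_fun_def algebra_simps)

lemma theta_inv_add: "theta_inv \<eta> (u + v) = theta_inv \<eta> u + theta_inv \<eta> v"
  by (simp add: theta_inv_def plus_fun_def add_divide_distrib)

lemma theta_cscale: "theta \<eta> (cscale a u) = cscale a (theta \<eta> u)"
  by (simp add: theta_def cscale_def mult.left_commute)

lemma theta_inv_cscale: "theta_inv \<eta> (cscale a u) = cscale a (theta_inv \<eta> u)"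
  by (simp add: theta_inv_def cscale_def)

lemma theta_zero: "theta \<eta> 0 = 0" and theta_inv_zero: "theta_inv \<eta> 0 = 0"
  by (simp_all add: theta_def theta_inv_def zero_fun_def)

lemma l2_eta_pow: "l2 X A \<omega> (eta_pow k u) v = l2 X A \<omega> u (eta_pow k v)"
  unfolding l2_def
proof (rule vol_integral_cong)
  fix c y assume cy: "c \<in> A" "y \<in> cimg c"
  show "tip (\<omega> c y) (eta_pow k u c y) (v c y) = tip (\<omega> c y) (u c y) (eta_pow k v c y)"
    using hermitian_point.tip_weight[OF hermitian_point[OF cy], where \<phi> = "\<lambda>p q. loc \<eta> c y powi k p"]
    by (simp add: eta_pow_def)
qed

lemma forms_hdeg_bound:
  assumes "u \<in> forms A j" "u c y as \<noteq> 0"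
  shows "hdeg as \<le> CARD('n)" "adeg as \<le> CARD('n)"
  using skew_degree_bound(2,3)[OF formsD(2)[OF assms(1)] assms(2)] .

lemma bideg_decomposition:
  assumes "u \<in> forms A j"
  shows "u = (\<Sum>p\<le>CARD('n). \<Sum>q\<le>CARD('n). bideg p q u)"
proof (intro ext)
  fix c y as
  have "(\<Sum>p\<le>CARD('n). \<Sum>q\<le>CARD('n). bideg p q u) c y as =
      (\<Sum>p\<le>CARD('n). \<Sum>q\<le>CARD('n). if hdeg as = p \<and> adeg as = q then u c y as else 0)"
    unfolding form_sum_apply bideg_def ..
  also have "\<dots> = u c y as"
  proof (cases "u c y as = 0")
    case False
    then show ?thesis
      using sum_single_bidegree[OF forms_hdeg_bound[OF assms False], of "\<lambda>p q. u c y as"] by simp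
  qed (simp cong: if_cong)
  finally show "u c y as = (\<Sum>p\<le>CARD('n). \<Sum>q\<le>CARD('n). bideg p q u) c y as" ..
qed

text \<open>The weights are real and the bidegree projections are self-adjoint, so both can be moved
  into the second argument, where the weight is read off from the holomorphic degree of each index
  list.\<close>

lemma l2_twisted_eq:
  assumes u: "u \<in> forms A j" and v: "v \<in> forms A j"
  shows "l2_twisted X A \<omega> \<eta> u v = l2 X A \<omega> u (eta_pow (\<lambda>r. - 2 * (int CARD('n) - int r)) v)"
proof -
  let ?k = "\<lambda>r. - 2 * (int CARD('n) - int r)"
  let ?v = "\<lambda>p q. eta_pow ?k (bideg p q v)"
  have v': "?v p q \<in> forms A j" for p q by (intro forms_eta_pow forms_bideg v)
  have e: "vol_integral X A \<omega> (\<lambda>c y. complex_of_real (loc \<eta> c y powi ?k p) *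
          tip (\<omega> c y) (bideg p q u c y) (bideg p q v c y)) =
      vol_integral X A \<omega> (\<lambda>c y. tip (\<omega> c y) (u c y) (?v p q c y))" for p q
  proof (rule vol_integral_cong)
    fix c y assume cy: "c \<in> A" "y \<in> cimg c"
    let ?r = "complex_of_real (loc \<eta> c y powi ?k p)"
    let ?i = "\<lambda>as. complex_of_real (if hdeg as = p \<and> adeg as = q then 1 else 0)"
    have "?r * tip (\<omega> c y) (bideg p q u c y) (bideg p q v c y)
      = ?r * tip (\<omega> c y) (\<lambda>as. ?i as * u c y as) (bideg p q v c y)"
      by (simp add: bideg_def if_distrib[of "\<lambda>x. x * _"] if_distrib[of complex_of_real] cong: if_cong)
    also have "\<dots> = tip (\<omega> c y) (u c y) (\<lambda>as. ?r * (?i as * bideg p q v c y as))"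
      unfolding hermitian_point.tip_weight[OF hermitian_point[OF cy],
          where \<phi> = "\<lambda>p' q'. if p' = p \<and> q' = q then 1 else 0"] tip_scale_right ..
    also have "(\<lambda>as. ?r * (?i as * bideg p q v c y as)) = ?v p q c y"
      by (auto simp: eta_pow_def bideg_def)
    finally show "?r * tip (\<omega> c y) (bideg p q u c y) (bideg p q v c y)
      = tip (\<omega> c y) (u c y) (?v p q c y)" .
  qed
  have "l2_twisted X A \<omega> \<eta> u v =
      vol_integral X A \<omega> (\<lambda>c y. \<Sum>p\<le>CARD('n). \<Sum>q\<le>CARD('n). tip (\<omega> c y) (u c y) (?v p q c y))"
    unfolding l2_twisted_def e
    by (subst vol_integral_sum, (intro chartwise_continuous_sum chartwise_continuous_tip[OF u v'])[1])
      (subst vol_integral_sum, (rule chartwise_continuous_tip[OF u v'])[1], rule refl)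
  also have "\<dots> = vol_integral X A \<omega> (\<lambda>c y. tip (\<omega> c y) (u c y) (eta_pow ?k v c y))"
  proof (rule vol_integral_cong)
    fix c y
    have "eta_pow ?k v c y = (\<lambda>as. \<Sum>p\<le>CARD('n). \<Sum>q\<le>CARD('n). ?v p q c y as)"
    proof
      fix as
      have "v c y as = (\<Sum>p\<le>CARD('n). \<Sum>q\<le>CARD('n). bideg p q v c y as)"
        by (subst bideg_decomposition[OF v]) (simp only: form_sum_apply)
      then show "eta_pow ?k v c y as = (\<Sum>p\<le>CARD('n). \<Sum>q\<le>CARD('n). ?v p q c y as)"
        by (simp add: eta_pow_def sum_distrib_left)
    qed
    then show "(\<Sum>p\<le>CARD('n). \<Sum>q\<le>CARD('n). tip (\<omega> c y) (u c y) (?v p q c y)) = tip (\<omega> c y) (u c y) (eta_pow ?k v c y)"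
      by (simp add: tip_sum_right)
  qed
  finally show ?thesis by (simp add: l2_def)
qed

definition d\<eta> :: "('x, 'n) chart \<Rightarrow> complex^'n \<Rightarrow> 'n cidx \<Rightarrow> complex" where
  "d\<eta> c y a = pd a (\<lambda>z. complex_of_real (loc \<eta> c z)) y"

lemma forms_fun_form: "fun_form A \<eta> \<in> forms A 0"
proof (rule formsI)
  show "skew (fun_form A \<eta> c y)" for c y
    by (auto simp: skew_def fun_form_def)
  show "smooth_on (cimg c) (\<lambda>y. fun_form A \<eta> c y as)" if c: "c \<in> A" for c as
  proof (rule smooth_on_cong[OF open_cimg[OF c]])
    show "smooth_on (cimg c) (\<lambda>y. if as = [] then complex_of_real (loc \<eta> c y) else 0)"
      using smooth_loc[OF c] by (cases "as = []") (simp_all add: smooth_on_const)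
  qed (use c in \<open>auto simp: fun_form_def\<close>)
  show "fun_form A \<eta> c (cmap c x) as = pull (jac c c' (cmap c x)) (fun_form A \<eta> c' (cmap c' x)) as"
    if c: "c \<in> A" "c' \<in> A" and x: "x \<in> cdom c \<inter> cdom c'" for c c' x as
  proof (cases as)
    case Nil
    then show ?thesis using c x cmap_in[of x c] cmap_in[of x c'] by (simp add: fun_form_def loc_def cinv_cmap)
  next
    case (Cons a bs)
    then show ?thesis by (auto simp: fun_form_def pull_def intro!: sum.neutral)
  qed
qed (auto simp: fun_form_def)

lemma ext_d_fun_form: "c \<in> A \<Longrightarrow> y \<in> cimg c \<Longrightarrow> ext_d A (fun_form A \<eta>) c y [a] = d\<eta> c y a"
proof -
  assume c: "c \<in> A" "y \<in> cimg c"
  have "ext_d A (fun_form A \<eta>) c y [a] = pd a (\<lambda>z. fun_form A \<eta> c z []) y"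
    using c by (simp add: ext_d_def)
  also have "\<dots> = d\<eta> c y a"
    unfolding d\<eta>_def
    using smooth_on_differentiable[OF formsD(3)[OF forms_fun_form c(1)] c(2)]
    by (intro pd_cong[OF open_cimg[OF c(1)] c(2)]) (use c in \<open>simp add: fun_form_def\<close>)
  finally show ?thesis .
qed

text \<open>The derivative of the real function \<eta> takes real values; this provides the reality
  assumption of \<open>omega_dual_sharp\<close>.\<close>

lemma d\<eta>_real:
  assumes "c \<in> A" "y \<in> cimg c"
  shows "d\<eta> c y (Inr j) = cnj (d\<eta> c y (Inl j))"
proof -
  have "smooth_on (cimg c) (loc \<eta> c)" using smooth_\<eta> assms by (simp add: smooth_fun_def)
  from smooth_on_has_derivative[OF this assms(2)]
  have *: "((\<lambda>z. complex_of_real (loc \<eta> c z)) has_derivative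
      (\<lambda>v. complex_of_real (frechet_derivative (loc \<eta> c) (at y) v))) (at y)"
    by (rule bounded_linear.has_derivative[OF bounded_linear_of_real])
  show ?thesis unfolding d\<eta>_def pd_eqI[OF *] by simp
qed

lemma tau_form_components:
  assumes "c \<in> A" "y \<in> cimg c"
  shows "tau_form A \<eta> c y [Inl j] = \<i> * (of_real (1 / loc \<eta> c y) * d\<eta> c y (Inl j))"
    "tau_form A \<eta> c y [Inr j] = - \<i> * (of_real (loc \<eta> c y) * d\<eta> c y (Inr j))"
    "length as \<noteq> 1 \<Longrightarrow> tau_form A \<eta> c y as = 0"
proof -
  show "tau_form A \<eta> c y [Inl j] = \<i> * (of_real (1 / loc \<eta> c y) * d\<eta> c y (Inl j))"
    "tau_form A \<eta> c y [Inr j] = - \<i> * (of_real (loc \<eta> c y) * d\<eta> c y (Inr j))"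
    by (simp_all add: tau_form_def del_fun_def delbar_fun_def bideg_def hdeg_def adeg_def
        ext_d_fun_form[OF assms])
  have "hdeg as + adeg as = length as"
    unfolding hdeg_def adeg_def by (rule sum_length_filter_compl)
  then show "length as \<noteq> 1 \<Longrightarrow> tau_form A \<eta> c y as = 0"
    by (auto simp: tau_form_def del_fun_def delbar_fun_def bideg_def)
qed

text \<open>Up to factors depending on the bidegree this is the differential of \<eta>, so
  \<open>forms_weigh\<close> applies.\<close>

lemma forms_tau: "tau_form A \<eta> \<in> forms A 1"
proof -
  let ?\<phi> = "\<lambda>p q x. if p = 1 \<and> q = 0 then \<i> * of_real (\<eta> x powi (-1))
      else if p = 0 \<and> q = 1 then - \<i> * of_real (\<eta> x powi 1) else 0"
  have "weigh ?\<phi> (ext_d A (fun_form A \<eta>)) \<in> forms A 1"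
  proof (rule forms_weigh)
    show "ext_d A (fun_form A \<eta>) \<in> forms A 1" using forms_ext_d[OF forms_fun_form] by simp
    show "smooth_on (cimg c) (\<lambda>y. ?\<phi> p q (cinv c y))" if c: "c \<in> A" for c p q
    proof -
      have if_smooth: "smooth_on S f \<Longrightarrow> smooth_on S f' \<Longrightarrow> smooth_on S (\<lambda>y. if b then f y else f' y)"
        for S b and f f' :: "complex^'n \<Rightarrow> complex" by (cases b) simp_all
      note sm = smooth_on_mult[OF open_cimg[OF c] smooth_on_const smooth_loc_powi[OF c]]
      show ?thesis
        unfolding loc_def[symmetric] by (rule if_smooth[OF sm if_smooth[OF sm smooth_on_const]])
    qed
  qed
  also have "weigh ?\<phi> (ext_d A (fun_form A \<eta>)) = tau_form A \<eta>"
    by (intro ext) (auto simp: weigh_def tau_form_def del_fun_def delbar_fun_def bideg_def loc_def power_int_minus divide_inverse)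
  finally show ?thesis .
qed

section \<open>The vector field \<open>Y\<close> and the contraction with it\<close>

definition field :: "('x, 'n) chart \<Rightarrow> complex^'n \<Rightarrow> 'n cidx \<Rightarrow> complex" where
  "field c y = hermitian_point.omega_dual (\<omega> c y) (\<lambda>a. tau_form A \<eta> c y [a])"

lemma field_smooth:
  assumes c: "c \<in> A"
  shows "smooth_on (cimg c) (\<lambda>y. field c y b)"
proof (rule smooth_on_cong[OF open_cimg[OF c]])
  let ?s = "case b of Inl j \<Rightarrow> (\<lambda>y. \<i> * (\<Sum>k\<in>UNIV. matrix_inv (hmat (\<omega> c y)) $ k $ j * tau_form A \<eta> c y [Inr k]))
      | Inr k \<Rightarrow> (\<lambda>y. - \<i> * (\<Sum>j\<in>UNIV. matrix_inv (hmat (\<omega> c y)) $ k $ j * tau_form A \<eta> c y [Inl j]))"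
  note o = open_cimg[OF c]
  have *: "smooth_on (cimg c) (\<lambda>y. a * (\<Sum>k\<in>UNIV. matrix_inv (hmat (\<omega> c y)) $ f k $ g k * tau_form A \<eta> c y [i k]))"
    for a f g and i :: "'n \<Rightarrow> 'n cidx"
    by (rule smooth_on_mult[OF o smooth_on_const smooth_on_sum[OF o
            smooth_on_mult[OF o smooth_inverse_hmat[OF c] formsD(3)[OF forms_tau c]]]])
  show "smooth_on (cimg c) ?s"
  proof (cases b)
    case (Inl j)
    then show ?thesis using *[of "\<i>" "\<lambda>k. k" "\<lambda>k. j" Inr] by simp
  next
    case (Inr k)
    then show ?thesis using *[of "- \<i>" "\<lambda>j. k" "\<lambda>j. j" Inl] by simp
  qed
  show "?s y = field c y b" if "y \<in> cimg c" for y
    unfolding field_def by (cases b) (simp_all add: hermitian_point.omega_dual.simps[OF hermitian_point[OF c that]])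
qed

text \<open>The law is derived from uniqueness instead of the formula with inverse matrices: the
  image of \<open>field\<close> under the Jacobian solves \<open>i_Y \<omega> = - \<tau>\<close> in
  the chart \<open>c'\<close>, because \<omega> and \<tau> are global forms.\<close>

lemma field_transform:
  assumes c: "c \<in> A" "c' \<in> A" and x: "x \<in> cdom c \<inter> cdom c'"
  shows "field c' (cmap c' x) b = (\<Sum>a\<in>UNIV. jac c c' (cmap c x) b a * field c (cmap c x) a)"
proof -
  let ?y = "cmap c x" and ?y' = "cmap c' x" and ?J = "jac c c' (cmap c x)"
  let ?w = "\<omega> c ?y" and ?w' = "\<omega> c' ?y'"
  let ?t = "\<lambda>a. tau_form A \<eta> c ?y [a]" and ?t' = "\<lambda>a. tau_form A \<eta> c' ?y' [a]"
  have y: "?y \<in> cimg c" "?y' \<in> cimg c'" using x cmap_in[of x c] cmap_in[of x c'] by auto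
  define Y where "Y b = (\<Sum>a\<in>UNIV. ?J b a * field c ?y a)" for b
  have w: "?w [b, a] = (\<Sum>b'\<in>UNIV. \<Sum>a'\<in>UNIV. ?J b' b * (?J a' a * ?w' [b', a']))" for a b
    using formsD(4)[OF \<omega>_form c x] by (simp add: pull_Cons sum_distrib_left)
  have t: "?t a = (\<Sum>a'\<in>UNIV. ?J a' a * ?t' a')" for a
    using formsD(4)[OF forms_tau c x] by (simp add: pull_Cons)
  \<comment> \<open>The defining equation in the chart \<open>c\<close>, with \<omega> and \<tau>
    expressed through \<open>c'\<close>; a Jacobian remains on both sides.\<close>
  have Jeq: "(\<Sum>a'\<in>UNIV. ?J a' a * (\<Sum>b'\<in>UNIV. Y b' * ?w' [b', a'])) = (\<Sum>a'\<in>UNIV. ?J a' a * - ?t' a')" for a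
  proof -
    let ?f = "\<lambda>a' b' e. ?J a' a * (?J b' e * field c ?y e * ?w' [b', a'])"
    have "(\<Sum>a'\<in>UNIV. ?J a' a * (\<Sum>b'\<in>UNIV. Y b' * ?w' [b', a']))
        = (\<Sum>a'\<in>UNIV. \<Sum>b'\<in>UNIV. \<Sum>e\<in>UNIV. ?f a' b' e)"
      by (simp add: Y_def sum_distrib_left sum_distrib_right)
    also have "\<dots> = (\<Sum>a'\<in>UNIV. \<Sum>e\<in>UNIV. \<Sum>b'\<in>UNIV. ?f a' b' e)"
      by (rule sum.cong[OF refl], rule sum.swap)
    also have "\<dots> = (\<Sum>e\<in>UNIV. \<Sum>a'\<in>UNIV. \<Sum>b'\<in>UNIV. ?f a' b' e)"
      by (rule sum.swap)
    also have "\<dots> = (\<Sum>e\<in>UNIV. \<Sum>b'\<in>UNIV. \<Sum>a'\<in>UNIV. ?f a' b' e)"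
      by (rule sum.cong[OF refl], rule sum.swap)
    also have "\<dots> = (\<Sum>e\<in>UNIV. field c ?y e * ?w [e, a])"
      unfolding w sum_distrib_left by (intro sum.cong refl) (simp add: mult_ac)
    also have "\<dots> = - ?t a"
      unfolding field_def by (rule hermitian_point.omega_dual_two_form[OF hermitian_point[OF c(1) y(1)]])
    also have "\<dots> = (\<Sum>a'\<in>UNIV. ?J a' a * - ?t' a')" by (simp add: t sum_negf)
    finally show ?thesis .
  qed
  \<comment> \<open>The Jacobian of the opposite transition removes the one that remains in
    \<open>Jeq\<close>.\<close>
  have Yw: "(\<Sum>b'\<in>UNIV. Y b' * ?w' [b', e]) = - ?t' e" for e
  proof -
    let ?K = "jac c' c ?y'"
    have inv: "(\<Sum>a\<in>UNIV. ?K a e * (\<Sum>a'\<in>UNIV. ?J a' a * Z a')) = Z e" for Z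
    proof -
      have "(\<Sum>a\<in>UNIV. ?K a e * (\<Sum>a'\<in>UNIV. ?J a' a * Z a')) = (\<Sum>a'\<in>UNIV. (\<Sum>a\<in>UNIV. ?K a e * ?J a' a) * Z a')"
        unfolding sum_distrib_left sum_distrib_right by (subst sum.swap) (simp add: mult_ac)
      also have "\<dots> = (\<Sum>a'\<in>UNIV. (if e = a' then 1 else 0) * Z a')"
        by (simp only: jac_inverse[OF c(2,1) x[unfolded Int_commute[of "cdom c"]]])
      also have "\<dots> = Z e" by (simp add: if_distrib[of "\<lambda>x. x * _"] cong: if_cong)
      finally show ?thesis .
    qed
    show ?thesis
      using inv[of "\<lambda>a'. \<Sum>b'\<in>UNIV. Y b' * ?w' [b', a']"] inv[of "\<lambda>a'. - ?t' a'"] unfolding Jeq by simp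
  qed
  have "field c' ?y' b - Y b = 0"
  proof (rule hermitian_point.two_form_nondegenerate[OF hermitian_point[OF c(2) y(2)]])
    fix a
    show "(\<Sum>b\<in>UNIV. (field c' ?y' b - Y b) * ?w' [b, a]) = 0"
      using hermitian_point.omega_dual_two_form[OF hermitian_point[OF c(2) y(2)], of ?t' a]
      by (simp add: left_diff_distrib sum_subtractf Yw field_def)
  qed
  then show ?thesis by (simp add: Y_def)
qed

definition contract_field :: "('x, 'n) form \<Rightarrow> ('x, 'n) form" where
  "contract_field u = (\<lambda>c y. contract (field c y) (u c y))"

lemma forms_contract_field: "u \<in> forms A (Suc k) \<Longrightarrow> contract_field u \<in> forms A k"
  unfolding contract_field_def by (rule forms_contract) (auto intro: field_smooth field_transform)

lemma contract_field_function: "u \<in> forms A 0 \<Longrightarrow> contract_field u = 0"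
  using formsD(1)[of u 0 _ _ "_ # _"] by (intro ext) (simp add: contract_field_def contract_def)

lemma Lambda_op_eq:
  assumes "c \<in> A" "y \<in> cimg c" "skew (u c y)"
  shows "Lambda_op A \<omega> u c y = Lambda_at (cometric (\<omega> c y)) (\<omega> c y) (u c y)"
  using assms hermitian_point.Lambda_at_unique[OF hermitian_point[OF assms(1,2)] assms(3)]
  by (simp add: Lambda_op_def)

text \<open>The degrees -2 and 1 have even product, so the graded commutator is the plain
  difference. Identifying it with a contraction is what shows that it preserves smooth global forms.
  Outside the charts both sides are 0.\<close>

lemma gcomm_eq:
  assumes u: "u \<in> forms A k"
  shows "gcomm (-2) 1 (Lambda_op A \<omega>) (wedgef (tau_form A \<eta>)) u = contract_field u"
proof (intro ext)
  fix c y as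
  show "gcomm (-2) 1 (Lambda_op A \<omega>) (wedgef (tau_form A \<eta>)) u c y as = contract_field u c y as"
  proof (cases "c \<in> A \<and> y \<in> cimg c")
    case True
    then have c: "c \<in> A" "y \<in> cimg c" by auto
    let ?t = "\<lambda>a. tau_form A \<eta> c y [a]"
    have w: "wedgef (tau_form A \<eta>) v c y = wedge1 ?t (v c y)" for v
      unfolding wedgef_def
      by (rule ext) (rule wedge_one_form[OF tau_form_components(3)[OF c]])
    have s: "skew (u c y)" by (rule formsD(2)[OF u])
    have "Lambda_op A \<omega> (wedgef (tau_form A \<eta>) u) c y = Lambda_at (cometric (\<omega> c y)) (\<omega> c y) (wedge1 ?t (u c y))"
      using Lambda_op_eq[of c y "wedgef (tau_form A \<eta>) u", OF c] wedge1_skew[OF s] by (simp add: w)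
    moreover have "wedgef (tau_form A \<eta>) (Lambda_op A \<omega> u) c y = wedge1 ?t (Lambda_at (cometric (\<omega> c y)) (\<omega> c y) (u c y))"
      by (simp add: w Lambda_op_eq[of c y u, OF c s])
    ultimately show ?thesis
      using hermitian_point.Lambda_at_wedge1_commutator[OF hermitian_point[OF c] s, of ?t as]
      by (simp add: gcomm_def cscale_def contract_field_def field_def)
  next
    case False
    then show ?thesis
      using forms_outside[OF u] by (auto simp: gcomm_def cscale_def contract_field_def contract_def Lambda_op_def wedgef_def wedge_def)
  qed
qed

text \<open>By \<open>pure\<close>, only lists \<open>b # as\<close> of holomorphic degree
  \<open>p\<close> count, so the type of the removed index \<open>b\<close> decides the exponent: -2
  if it is holomorphic, 0 otherwise. \<open>omega_dual_sharp\<close> provides the matching factor of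
  \<open>field\<close>.\<close>

lemma contract_field_sharp:
  assumes c: "c \<in> A" "y \<in> cimg c" and pure: "\<And>bs. t bs \<noteq> 0 \<Longrightarrow> hdeg bs = p"
  shows "of_real (loc \<eta> c y powi (2 * int (hdeg as) - 2 * int p)) * contract (field c y) t as =
    of_real (1 / loc \<eta> c y) * contract (sharp (cometric (\<omega> c y)) (d\<eta> c y)) t as"
  unfolding contract_def sum_distrib_left
proof (rule sum.cong[OF refl])
  fix b
  interpret hermitian_point "\<omega> c y" by (rule hermitian_point[OF c])
  let ?e = "loc \<eta> c y"
  have e: "?e \<noteq> 0" using loc_pos[OF c] by simp
  note S = omega_dual_sharp[where \<sigma> = "d\<eta> c y" and \<tau> = "\<lambda>a. tau_form A \<eta> c y [a]", OF d\<eta>_real[OF c]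
      tau_form_components(1,2)[OF c]]
  show "of_real (?e powi (2 * int (hdeg as) - 2 * int p)) * (field c y b * t (b # as)) =
      of_real (1 / ?e) * (sharp g (d\<eta> c y) b * t (b # as))"
  proof (cases "t (b # as) = 0")
    case False
    then have p: "hdeg (b # as) = p" by (rule pure)
    show ?thesis
    proof (cases b)
      case (Inl j)
      then have k: "2 * int (hdeg as) - 2 * int p = - 2" using p by (simp add: hdeg_def)
      have f: "field c y (Inl j) = of_real ?e * sharp g (d\<eta> c y) (Inl j)"
        unfolding field_def by (rule S(1))
      show ?thesis unfolding Inl k f using e by (simp add: power_int_minus power2_eq_square field_simps)
    next
      case (Inr j)
      then have "2 * int (hdeg as) - 2 * int p = 0" using p by (simp add: hdeg_def)
      moreover have "field c y (Inr j) = of_real (1 / ?e) * sharp g (d\<eta> c y) (Inr j)"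
        unfolding field_def by (rule S(2))
      ultimately show ?thesis by (simp add: Inr)
    qed
  qed simp
qed

section \<open>Conjugating the exterior derivative by powers of \<eta>\<close>

text \<open>At \<open>N = 0\<close> the truncated exponent \<open>N - 1\<close> is harmless, since
  its term carries the factor \<open>of_nat N\<close>.\<close>

lemma pd_loc_power:
  assumes c: "c \<in> A" "y \<in> cimg c"
  shows "pd a (\<lambda>z. complex_of_real (loc \<eta> c z) ^ N) y = of_nat N * of_real (loc \<eta> c y) ^ (N - 1) * d\<eta> c y a"
proof (induction N)
  case 0
  then show ?case by (simp add: pd_const)
next
  case (Suc N)
  have d: "(\<lambda>z. complex_of_real (loc \<eta> c z)) differentiable (at y)"
    by (rule smooth_on_differentiable[OF smooth_loc[OF c(1)] c(2)])
  have dN: "(\<lambda>z. complex_of_real (loc \<eta> c z) ^ N) differentiable (at y)"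
    by (rule smooth_on_differentiable[OF smooth_on_power[OF open_cimg[OF c(1)] smooth_loc[OF c(1)]] c(2)])
  show ?case
    unfolding power_Suc pd_mult[OF d dN] Suc d\<eta>_def[symmetric]
    by (cases N) (simp_all add: algebra_simps)
qed

lemma ext_d_power:
  assumes u: "u \<in> forms A k" and c: "c \<in> A" "y \<in> cimg c"
  shows "ext_d A (eta_pow (\<lambda>r. int N) u) c y as =
    of_real (loc \<eta> c y) ^ N * ext_d A u c y as + of_nat N * of_real (loc \<eta> c y) ^ (N - 1) * wedge1 (d\<eta> c y) (u c y) as"
proof -
  have dN: "(\<lambda>z. complex_of_real (loc \<eta> c z) ^ N) differentiable (at y)"
    by (rule smooth_on_differentiable[OF smooth_on_power[OF open_cimg[OF c(1)] smooth_loc[OF c(1)]] c(2)])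
  have du: "(\<lambda>z. u c z bs) differentiable (at y)" for bs
    by (rule smooth_on_differentiable[OF formsD(3)[OF u c(1)] c(2)])
  have "pd a (\<lambda>z. eta_pow (\<lambda>r. int N) u c z bs) y = of_real (loc \<eta> c y) ^ N * pd a (\<lambda>z. u c z bs) y +
      (of_nat N * of_real (loc \<eta> c y) ^ (N - 1)) * (d\<eta> c y a * u c y bs)" for a bs
    using pd_mult[OF dN du, of a bs] by (simp add: eta_pow_def pd_loc_power[OF c] algebra_simps)
  then show ?thesis
    unfolding ext_d_alt[OF c] wedge1_def by (simp only: alt_add alt_cmult)
qed

lemma ext_d_conjugate:
  assumes u: "u \<in> forms A k" and c: "c \<in> A" "y \<in> cimg c"
  shows "eta_pow (\<lambda>r. - int N) (ext_d A (eta_pow (\<lambda>r. int N) u)) c y as =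
    ext_d A u c y as + of_nat N * (of_real (1 / loc \<eta> c y) * wedge1 (d\<eta> c y) (u c y) as)"
proof -
  define e where "e = complex_of_real (loc \<eta> c y)"
  have e: "e \<noteq> 0" using loc_pos[OF c] by (simp add: e_def)
  have 1: "complex_of_real (loc \<eta> c y powi - int N) = inverse (e ^ N)"
    by (simp add: e_def power_int_minus)
  have 2: "inverse (e ^ N) * e ^ N = 1" "of_nat N * (inverse (e ^ N) * e ^ (N - 1)) = of_nat N * (1 / e)"
    using e by (simp, cases N) (simp_all add: field_simps)
  have "inverse (e ^ N) * (e ^ N * x + of_nat N * e ^ (N - 1) * z) =
      (inverse (e ^ N) * e ^ N) * x + of_nat N * (inverse (e ^ N) * e ^ (N - 1)) * z" for x z
    by (simp add: algebra_simps)
  then show ?thesis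
    unfolding eta_pow_def[of "\<lambda>r. - int N"] ext_d_power[OF u c] 1 e_def[symmetric] 2
    by (simp add: e_def)
qed

lemma eta_pow_pure:
  assumes "\<And>c y as. u c y as \<noteq> 0 \<Longrightarrow> hdeg as = p"
  shows "eta_pow k u = eta_pow (\<lambda>r. k p) u"
proof (intro ext)
  fix c y as
  show "eta_pow k u c y as = eta_pow (\<lambda>r. k p) u c y as"
    using assms[of c y as] by (cases "u c y as = 0") (simp_all add: eta_pow_def)
qed

lemma l2_add_right:
  assumes "u \<in> forms A k" "v \<in> forms A k" "v' \<in> forms A k"
  shows "l2 X A \<omega> u (v + v') = l2 X A \<omega> u v + l2 X A \<omega> u v'"
  using l2_diff_right[OF assms(1) forms_add[OF assms(2,3)] assms(3)] by simp

lemma l2_cscale_right: "l2 X A \<omega> u (cscale a v) = cnj a * l2 X A \<omega> u v"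
  unfolding l2_def cscale_def tip_cmult_right vol_integral_cmult ..

lemma l2_sum_right:
  assumes "u \<in> forms A k" "\<And>i. i \<in> I \<Longrightarrow> f i \<in> forms A k"
  shows "l2 X A \<omega> u (\<Sum>i\<in>I. f i) = (\<Sum>i\<in>I. l2 X A \<omega> u (f i))"
  using assms(2)
proof (induction I rule: infinite_finite_induct)
  case (insert i I)
  have IH: "l2 X A \<omega> u (sum f I) = (\<Sum>i\<in>I. l2 X A \<omega> u (f i))"
    by (rule insert.IH) (use insert.prems in auto)
  have *: "l2 X A \<omega> u (f i + sum f I) = l2 X A \<omega> u (f i) + l2 X A \<omega> u (sum f I)"
    by (rule l2_add_right[OF assms(1)]) (use insert.prems in \<open>auto intro: forms_sum\<close>)
  show ?case unfolding sum.insert[OF insert.hyps(1,2)] * IH ..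
qed (use l2_cscale_right[of u 0 0] in \<open>simp_all add: cscale_def zero_fun_def\<close>)

lemma l2_right_eqI:
  assumes "v \<in> forms A k" "v' \<in> forms A k" "\<And>u. u \<in> forms A k \<Longrightarrow> l2 X A \<omega> u v = l2 X A \<omega> u v'"
  shows "v = v'"
proof -
  have d: "v - v' \<in> forms A k" by (rule forms_diff[OF assms(1,2)])
  then have "l2 X A \<omega> (v - v') (v - v') = 0"
    using l2_diff_right[OF d assms(1,2)] assms(3) by simp
  from l2_nondegenerate[OF d this] show ?thesis by simp
qed

end

section \<open>The conjugate of \<open>T_star\<close> as the adjoint of \<open>D_op\<close>\<close>

locale twisted_adjoints = twisted_manifold X A \<omega> \<eta>
  for X :: "'x topology" and A :: "('x, 'n::finite) chart set" and \<omega> :: "('x, 'n) form" and \<eta> +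
  fixes D_star d_star :: "('x, 'n) form \<Rightarrow> ('x, 'n) form"
  assumes D_star: "formal_adjoint A (l2 X A \<omega>) (D_op A \<eta>) D_star"
    and d_star: "formal_adjoint A (l2_twisted X A \<omega> \<eta>) (ext_d A) d_star"
begin

lemma d_star_function: "v \<in> forms A 0 \<Longrightarrow> d_star v = 0"
  and forms_d_star: "v \<in> forms A (Suc k) \<Longrightarrow> d_star v \<in> forms A k"
  and d_star_adjoint: "v \<in> forms A (Suc k) \<Longrightarrow> u \<in> forms A k \<Longrightarrow>
    l2_twisted X A \<omega> \<eta> (ext_d A u) v = l2_twisted X A \<omega> \<eta> u (d_star v)"
  using d_star unfolding formal_adjoint_def by blast+

lemma D_star_function: "v \<in> forms A 0 \<Longrightarrow> D_star v = 0"
  and forms_D_star: "v \<in> forms A (Suc k) \<Longrightarrow> D_star v \<in> forms A k"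
  and D_star_adjoint: "v \<in> forms A (Suc k) \<Longrightarrow> u \<in> forms A k \<Longrightarrow>
    l2 X A \<omega> (D_op A \<eta> u) v = l2 X A \<omega> u (D_star v)"
  using D_star unfolding formal_adjoint_def by blast+

lemma forms_D_op: "u \<in> forms A k \<Longrightarrow> D_op A \<eta> u \<in> forms A (Suc k)"
  unfolding D_op_def by (intro forms_theta forms_ext_d forms_theta_inv)

text \<open>The test form is \<open>a\<close> multiplied by \<eta> to the power
  \<open>N = 2 * (n - p)\<close>. On the side of \<open>d_star\<close> the exponents add up to
  \<open>N - 2 * (n - r) = 2 * r - 2 * p\<close>, which is \<psi>. On the other side the weight on
  \<open>w\<close> has exponent \<open>- N\<close>; moved across, it conjugates
  \<open>ext_d\<close>, and the resulting error term is the correction by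
  \<open>contract_field\<close>.\<close>

lemma twisted_adjoint_pure:
  assumes w: "w \<in> forms A (Suc k)" and pure: "\<And>c y as. w c y as \<noteq> 0 \<Longrightarrow> hdeg as = p"
    and p: "p \<le> CARD('n)" and a: "a \<in> forms A k"
  defines "\<psi> \<equiv> \<lambda>r. 2 * int r - 2 * int p"
  shows "l2 X A \<omega> a (eta_pow \<psi> (d_star w - cscale (2 * (of_nat CARD('n) - of_nat p)) (contract_field w)))
    = l2 X A \<omega> (ext_d A a) w"
proof -
  \<comment> \<open>A natural exponent, as \<open>ext_d_conjugate\<close> requires; the subtraction
    does not truncate because \<open>p\<close> is at most the dimension.\<close>
  define N where "N = 2 * (CARD('n) - p)"
  let ?\<mu> = "\<lambda>r. - 2 * (int CARD('n) - int r)"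
  let ?a = "eta_pow (\<lambda>r. int N) a"
  have N: "int N = 2 * (int CARD('n) - int p)" "of_nat N = (2 * (of_nat CARD('n) - of_nat p) :: complex)"
    using p by (simp_all add: N_def of_nat_diff)
  note ds = forms_d_star[OF w] and cf = forms_contract_field[OF w]
  have "l2_twisted X A \<omega> \<eta> (ext_d A ?a) w = l2_twisted X A \<omega> \<eta> ?a (d_star w)"
    by (rule d_star_adjoint[OF w forms_eta_pow[OF a]])
  moreover have "l2_twisted X A \<omega> \<eta> ?a (d_star w) = l2 X A \<omega> a (eta_pow \<psi> (d_star w))"
    unfolding l2_twisted_eq[OF forms_eta_pow[OF a] ds] l2_eta_pow eta_pow_eta_pow[OF ds] \<psi>_def N(1)
    by (simp add: algebra_simps)
  moreover have "l2_twisted X A \<omega> \<eta> (ext_d A ?a) w = l2 X A \<omega> (ext_d A a) w + of_nat N * l2 X A \<omega> a (eta_pow \<psi> (contract_field w))"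
  proof -
    have "eta_pow ?\<mu> w = eta_pow (\<lambda>r. - int N) w"
      using eta_pow_pure[of w p ?\<mu>, OF pure] by (simp add: N(1))
    then have "l2_twisted X A \<omega> \<eta> (ext_d A ?a) w = l2 X A \<omega> (eta_pow (\<lambda>r. - int N) (ext_d A ?a)) w"
      unfolding l2_twisted_eq[OF forms_ext_d[OF forms_eta_pow[OF a]] w] l2_eta_pow by simp
    also have "\<dots> = vol_integral X A \<omega> (\<lambda>c y. tip (\<omega> c y) (ext_d A a c y) (w c y)
        + of_nat N * tip (\<omega> c y) (a c y) (eta_pow \<psi> (contract_field w) c y))"
      unfolding l2_def
    proof (rule vol_integral_cong)
      fix c y assume c: "c \<in> A" "y \<in> cimg c"
      have "eta_pow (\<lambda>r. - int N) (ext_d A ?a) c y =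
          (\<lambda>as. ext_d A a c y as + of_nat N * (of_real (1 / loc \<eta> c y) * wedge1 (d\<eta> c y) (a c y) as))"
        by (rule ext) (rule ext_d_conjugate[OF a c])
      moreover have "of_real (1 / loc \<eta> c y) * tip (\<omega> c y) (wedge1 (d\<eta> c y) (a c y)) (w c y) =
          tip (\<omega> c y) (a c y) (eta_pow \<psi> (contract_field w) c y)"
      proof -
        have "eta_pow \<psi> (contract_field w) c y = (\<lambda>as. complex_of_real (1 / loc \<eta> c y) *
            contract (sharp (cometric (\<omega> c y)) (d\<eta> c y)) (w c y) as)"
          unfolding eta_pow_def contract_field_def \<psi>_def by (rule ext) (rule contract_field_sharp[OF c pure])
        then show ?thesis
          by (simp only: tip_wedge1[OF formsD(2)[OF w]] tip_scale_right)
      qed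
      ultimately show "tip (\<omega> c y) (eta_pow (\<lambda>r. - int N) (ext_d A ?a) c y) (w c y) =
          tip (\<omega> c y) (ext_d A a c y) (w c y) + of_nat N * tip (\<omega> c y) (a c y) (eta_pow \<psi> (contract_field w) c y)"
        by (simp only: tip_add_left tip_cmult_left)
    qed
    also have "\<dots> = l2 X A \<omega> (ext_d A a) w + vol_integral X A \<omega> (\<lambda>c y. of_nat N * tip (\<omega> c y) (a c y) (eta_pow \<psi> (contract_field w) c y))"
      unfolding l2_def
    proof (rule vol_integral_add)
      show "chartwise_continuous (\<lambda>c y. of_nat N * tip (\<omega> c y) (a c y) (eta_pow \<psi> (contract_field w) c y))"
        using chartwise_continuous_tip[OF a forms_eta_pow[OF cf], of \<psi>]
        unfolding chartwise_continuous_def by (intro ballI continuous_on_mult_left) (rule bspec)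
    qed (rule chartwise_continuous_tip[OF forms_ext_d[OF a] w])
    finally show ?thesis by (simp add: vol_integral_cmult l2_def)
  qed
  moreover have "eta_pow \<psi> (d_star w - cscale (of_nat N) (contract_field w)) = eta_pow \<psi> (d_star w) - cscale (of_nat N) (eta_pow \<psi> (contract_field w))"
    by (simp add: eta_pow_def cscale_def fun_diff_def algebra_simps)
  ultimately show ?thesis
    unfolding N(2)[symmetric]
    using l2_diff_right[OF a forms_eta_pow[OF ds] forms_cscale[OF forms_eta_pow[OF cf]], of \<psi> "of_nat N" \<psi>]
    by (simp add: l2_cscale_right diff_eq_eq)
qed

lemma T_star_p_eq:
  assumes u: "u \<in> forms A k"
  shows "T_star_p A \<omega> \<eta> d_star p u = eta_pow (\<lambda>r. - 2 * int p)
    (d_star (theta \<eta> (theta \<eta> u)) - cscale (2 * (of_nat CARD('n) - of_nat p)) (contract_field (theta \<eta> (theta \<eta> u))))"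
proof -
  have "x powi (- 2 * int p) = 1 / x ^ (2 * p)" for x :: real
    using power_int_of_nat[of x "2 * p"] by (simp add: power_int_minus divide_inverse)
  then show ?thesis
    unfolding T_star_p_def Let_def gcomm_eq[OF forms_theta[OF forms_theta[OF u]]] eta_pow_def by (simp only:)
qed

lemma T_star_p_function:
  assumes u: "u \<in> forms A 0"
  shows "T_star_p A \<omega> \<eta> d_star p u = 0"
proof -
  have "theta \<eta> (theta \<eta> u) \<in> forms A 0" by (intro forms_theta u)
  then show ?thesis
    unfolding T_star_p_eq[OF u] by (simp add: d_star_function contract_field_function cscale_def eta_pow_def zero_fun_def fun_diff_def)
qed

lemma forms_T_star_p: "u \<in> forms A (Suc k) \<Longrightarrow> T_star_p A \<omega> \<eta> d_star p u \<in> forms A k"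
  by (subst T_star_p_eq, assumption)
    (intro forms_eta_pow forms_diff forms_cscale forms_d_star forms_contract_field forms_theta)

lemma forms_T_star: "u \<in> forms A (Suc k) \<Longrightarrow> T_star A \<omega> \<eta> d_star u \<in> forms A k"
  unfolding T_star_def by (intro forms_sum forms_T_star_p forms_bideg)

text \<open>By self-adjointness both factors \<theta> move to the second argument. Together with the
  prefactor of \<open>T_star_p\<close> they form the power \<psi> of
  \<open>twisted_adjoint_pure\<close>, while the square of \<theta> inside \<open>T_star_p\<close>
  supplies its \<open>w\<close>.\<close>

lemma T_star_p_adjoint:
  assumes u: "u \<in> forms A (Suc k)" and pure: "\<And>c y as. u c y as \<noteq> 0 \<Longrightarrow> hdeg as = p"
    and p: "p \<le> CARD('n)" and a: "a \<in> forms A k"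
  shows "l2 X A \<omega> (theta \<eta> a) (theta \<eta> (T_star_p A \<omega> \<eta> d_star p u))
    = l2 X A \<omega> (theta \<eta> (ext_d A a)) (theta \<eta> u)"
proof -
  let ?w = "theta \<eta> (theta \<eta> u)"
  let ?v = "d_star ?w - cscale (2 * (of_nat CARD('n) - of_nat p)) (contract_field ?w)"
  have w: "?w \<in> forms A (Suc k)" by (intro forms_theta u)
  have v: "?v \<in> forms A k" by (intro forms_diff forms_cscale forms_d_star forms_contract_field w)
  have "theta \<eta> (theta \<eta> (eta_pow (\<lambda>r. - 2 * int p) v)) = eta_pow (\<lambda>r. 2 * int r - 2 * int p) v"
    if "v \<in> forms A k" for v
    unfolding theta_eta_pow eta_pow_eta_pow[OF that] by (simp add: algebra_simps)
  from this[OF v] have "theta \<eta> (theta \<eta> (T_star_p A \<omega> \<eta> d_star p u)) = eta_pow (\<lambda>r. 2 * int r - 2 * int p) ?v"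
    by (simp only: T_star_p_eq[OF u])
  moreover have "hdeg as = p" if "?w c y as \<noteq> 0" for c y as
    using that by (intro pure[of c y as]) (simp add: theta_def)
  ultimately have "l2 X A \<omega> a (theta \<eta> (theta \<eta> (T_star_p A \<omega> \<eta> d_star p u))) = l2 X A \<omega> (ext_d A a) ?w"
    using twisted_adjoint_pure[OF w _ p a] by simp
  then show ?thesis by (simp only: theta_eta_pow l2_eta_pow)
qed

text \<open>Applied to \<open>theta_inv \<eta> a\<close>, this is the adjunction between
  \<open>D_op\<close> and the conjugate of \<open>T_star\<close> by \<theta>. It follows by
  summation over the bidegrees of \<open>u\<close>.\<close>

lemma T_star_adjoint:
  assumes u: "u \<in> forms A (Suc k)" and a: "a \<in> forms A k"
  shows "l2 X A \<omega> (theta \<eta> a) (theta \<eta> (T_star A \<omega> \<eta> d_star u)) = l2 X A \<omega> (theta \<eta> (ext_d A a)) (theta \<eta> u)"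
proof -
  let ?T = "\<lambda>p q. T_star_p A \<omega> \<eta> d_star p (bideg p q u)"
  have b: "bideg p q u \<in> forms A (Suc k)" for p q by (rule forms_bideg[OF u])
  have th: "theta \<eta> (\<Sum>i\<in>I. f i) = (\<Sum>i\<in>I. theta \<eta> (f i))" for f :: "nat \<Rightarrow> ('x, 'n) form" and I
  proof (induction I rule: infinite_finite_induct)
    case (insert x F)
    show ?case unfolding sum.insert[OF insert.hyps(1,2)] theta_add insert.IH ..
  qed (simp_all only: sum.infinite sum.empty theta_zero not_False_eq_True)
  have "l2 X A \<omega> (theta \<eta> a) (theta \<eta> (T_star A \<omega> \<eta> d_star u)) =
      (\<Sum>p\<le>CARD('n). \<Sum>q\<le>CARD('n). l2 X A \<omega> (theta \<eta> a) (theta \<eta> (?T p q)))"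
    unfolding T_star_def th
    by (subst l2_sum_right[OF forms_theta[OF a]], (intro forms_sum forms_theta forms_T_star_p b)[1])
      (subst l2_sum_right[OF forms_theta[OF a]], (intro forms_theta forms_T_star_p b)[1], rule refl)
  also have "\<dots> = (\<Sum>p\<le>CARD('n). \<Sum>q\<le>CARD('n). l2 X A \<omega> (theta \<eta> (ext_d A a)) (theta \<eta> (bideg p q u)))"
    by (intro sum.cong refl T_star_p_adjoint[OF b _ _ a]) (auto simp: bideg_def split: if_splits)
  also have "\<dots> = l2 X A \<omega> (theta \<eta> (ext_d A a)) (theta \<eta> (\<Sum>p\<le>CARD('n). \<Sum>q\<le>CARD('n). bideg p q u))"
    unfolding th
    by (subst l2_sum_right[OF forms_theta[OF forms_ext_d[OF a]]], (intro forms_sum forms_theta b)[1])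
      (subst l2_sum_right[OF forms_theta[OF forms_ext_d[OF a]]], (intro forms_theta b)[1], rule refl)
  finally show ?thesis unfolding bideg_decomposition[OF u, symmetric] .
qed

text \<open>In positive degree both operators satisfy the same adjunction relation, so definiteness
  identifies them. On functions both vanish: \<open>formal_adjoint\<close> prescribes this for
  \<open>D_star\<close> and \<open>d_star\<close>, and contractions have nothing to
  contract.\<close>

lemma T_star_eq:
  assumes u: "u \<in> forms A k"
  shows "T_star A \<omega> \<eta> d_star u = theta_inv \<eta> (D_star (theta \<eta> u))"
proof (cases k)
  case 0
  have "bideg p q u \<in> forms A 0" for p q using forms_bideg u 0 by simp
  then have "T_star A \<omega> \<eta> d_star u = 0" by (simp add: T_star_def T_star_p_function)
  moreover have "D_star (theta \<eta> u) = 0" using D_star_function forms_theta u 0 by simp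
  ultimately show ?thesis by (simp add: theta_inv_zero)
next
  case (Suc j)
  note u' = u[unfolded Suc]
  have "theta \<eta> (T_star A \<omega> \<eta> d_star u) = D_star (theta \<eta> u)"
  proof (rule l2_right_eqI)
    show "theta \<eta> (T_star A \<omega> \<eta> d_star u) \<in> forms A j" by (intro forms_theta forms_T_star u')
    show "D_star (theta \<eta> u) \<in> forms A j" by (intro forms_D_star forms_theta u')
    fix a assume a: "a \<in> forms A j"
    show "l2 X A \<omega> a (theta \<eta> (T_star A \<omega> \<eta> d_star u)) = l2 X A \<omega> a (D_star (theta \<eta> u))"
      using T_star_adjoint[OF u' forms_theta_inv[OF a]] D_star_adjoint[OF forms_theta[OF u'] a]
      by (simp add: D_op_def theta_theta_inv[OF a])
  qed
  then show ?thesis using theta_inv_theta[OF forms_T_star[OF u']] by simp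
qed

text \<open>\<open>formal_adjoint\<close> does not assert linearity; it follows from the adjunction
  relation by definiteness.\<close>

lemma D_star_add:
  assumes "u \<in> forms A k" "v \<in> forms A k"
  shows "D_star (u + v) = D_star u + D_star v"
proof (cases k)
  case 0
  then show ?thesis using assms forms_add D_star_function by (simp add: forms_add)
next
  case (Suc j)
  note uv = assms[unfolded Suc]
  show ?thesis
  proof (rule l2_right_eqI)
    show "D_star (u + v) \<in> forms A j" "D_star u + D_star v \<in> forms A j"
      by (intro forms_add forms_D_star uv)+
    fix a assume a: "a \<in> forms A j"
    show "l2 X A \<omega> a (D_star (u + v)) = l2 X A \<omega> a (D_star u + D_star v)"
      using l2_add_right[OF a forms_D_star[OF uv(1)] forms_D_star[OF uv(2)]]
        l2_add_right[OF forms_D_op[OF a] uv] D_star_adjoint[OF _ a] uv forms_add[OF uv] by simp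
  qed
qed

lemma D_star_cscale:
  assumes "u \<in> forms A k"
  shows "D_star (cscale b u) = cscale b (D_star u)"
proof (cases k)
  case 0
  then show ?thesis using assms D_star_function forms_cscale by (simp add: cscale_def zero_fun_def)
next
  case (Suc j)
  note u = assms[unfolded Suc]
  show ?thesis
  proof (rule l2_right_eqI)
    show "D_star (cscale b u) \<in> forms A j" "cscale b (D_star u) \<in> forms A j"
      by (intro forms_cscale forms_D_star u)+
    fix a assume a: "a \<in> forms A j"
    show "l2 X A \<omega> a (D_star (cscale b u)) = l2 X A \<omega> a (cscale b (D_star u))"
      using D_star_adjoint[OF u a] D_star_adjoint[OF forms_cscale[OF u] a] by (simp add: l2_cscale_right)
  qed
qed

lemma ext_d_outside: "\<not> (c \<in> A \<and> y \<in> cimg c) \<Longrightarrow> ext_d A u c y as = 0"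
  by (auto simp: ext_d_def)

lemma ext_d_add:
  assumes "u \<in> forms A k" "v \<in> forms A k"
  shows "ext_d A (u + v) = ext_d A u + ext_d A v"
proof (intro ext)
  fix c y as
  show "ext_d A (u + v) c y as = (ext_d A u + ext_d A v) c y as"
  proof (cases "c \<in> A \<and> y \<in> cimg c")
    case True
    then have c: "c \<in> A" "y \<in> cimg c" by auto
    have "pd a (\<lambda>z. (u + v) c z bs) y = pd a (\<lambda>z. u c z bs) y + pd a (\<lambda>z. v c z bs) y" for a bs
      using pd_add[OF smooth_on_differentiable[OF formsD(3)[OF assms(1) c(1)] c(2)]
          smooth_on_differentiable[OF formsD(3)[OF assms(2) c(1)] c(2)]] by simp
    then show ?thesis by (simp add: ext_d_alt[OF c] alt_add)
  qed (simp add: ext_d_outside)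
qed

lemma ext_d_cscale:
  assumes "u \<in> forms A k"
  shows "ext_d A (cscale b u) = cscale b (ext_d A u)"
proof (intro ext)
  fix c y as
  show "ext_d A (cscale b u) c y as = cscale b (ext_d A u) c y as"
  proof (cases "c \<in> A \<and> y \<in> cimg c")
    case True
    then have c: "c \<in> A" "y \<in> cimg c" by auto
    have "pd a (\<lambda>z. cscale b u c z bs) y = b * pd a (\<lambda>z. u c z bs) y" for a bs
      using pd_cmult[OF smooth_on_differentiable[OF formsD(3)[OF assms(1) c(1)] c(2)]] by (simp add: cscale_def)
    then show ?thesis by (simp add: ext_d_alt[OF c] alt_cmult) (simp add: cscale_def ext_d_alt[OF c])
  qed (simp add: ext_d_outside cscale_def)
qed

lemma ext_d_zero: "ext_d A 0 = 0"
  using ext_d_cscale[OF forms_zero, of 0] by (simp add: cscale_def zero_fun_def)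

section \<open>Conjugate Laplacians, their spectra and eigenspaces\<close>

abbreviation "\<Delta>\<^sub>1 \<equiv> laplacian (D_op A \<eta>) D_star"
abbreviation "\<Delta>\<^sub>2 \<equiv> laplacian (ext_d A) (T_star A \<omega> \<eta> d_star)"

lemma forms_D_op_D_star:
  assumes "u \<in> forms A k"
  shows "D_op A \<eta> (D_star u) \<in> forms A k"
proof (cases k)
  case 0
  then have "D_op A \<eta> (D_star u) = 0"
    using assms by (simp add: D_op_def D_star_function theta_inv_zero ext_d_zero theta_zero)
  then show ?thesis by (simp add: forms_zero)
qed (use assms forms_D_op forms_D_star in auto)

lemma forms_laplacian: "u \<in> forms A k \<Longrightarrow> \<Delta>\<^sub>1 u \<in> forms A k"
  unfolding laplacian_def by (intro forms_add forms_D_op_D_star forms_D_star forms_D_op)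

lemma D_op_add:
  "u \<in> forms A k \<Longrightarrow> v \<in> forms A k \<Longrightarrow> D_op A \<eta> (u + v) = D_op A \<eta> u + D_op A \<eta> v"
  by (simp add: D_op_def theta_inv_add ext_d_add[OF forms_theta_inv forms_theta_inv] theta_add)

lemma D_op_cscale: "u \<in> forms A k \<Longrightarrow> D_op A \<eta> (cscale b u) = cscale b (D_op A \<eta> u)"
  by (simp add: D_op_def theta_inv_cscale ext_d_cscale[OF forms_theta_inv] theta_cscale)

text \<open>At \<open>k = 0\<close> the truncated degree is again 0, and the value 0 belongs to
  every space of forms.\<close>

lemma forms_D_star': "u \<in> forms A k \<Longrightarrow> D_star u \<in> forms A (k - 1)"
  using forms_D_star[of u "k - 1"] D_star_function[of u] forms_zero by (cases k) auto

lemma laplacian_add: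
  assumes "u \<in> forms A k" "v \<in> forms A k"
  shows "\<Delta>\<^sub>1 (u + v) = \<Delta>\<^sub>1 u + \<Delta>\<^sub>1 v"
  unfolding laplacian_def D_star_add[OF assms] D_op_add[OF assms]
    D_op_add[OF assms[THEN forms_D_star']] D_star_add[OF assms[THEN forms_D_op]] by simp

lemma laplacian_cscale:
  assumes "u \<in> forms A k"
  shows "\<Delta>\<^sub>1 (cscale b u) = cscale b (\<Delta>\<^sub>1 u)"
  unfolding laplacian_def D_star_cscale[OF assms] D_op_cscale[OF assms]
    D_op_cscale[OF forms_D_star'[OF assms]] D_star_cscale[OF forms_D_op[OF assms]]
  by (simp add: cscale_def plus_fun_def distrib_left)

text \<open>\<open>D_op\<close> and \<open>D_star\<close> are the conjugates by \<theta> of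
  \<open>ext_d\<close> and \<open>T_star\<close>, so in each product the inner \<theta> and its
  inverse cancel.\<close>

lemma laplacian_conjugate:
  assumes u: "u \<in> forms A k"
  shows "\<Delta>\<^sub>2 (theta_inv \<eta> u) = theta_inv \<eta> (\<Delta>\<^sub>1 u)"
proof -
  note v = forms_theta_inv[OF u]
  have "T_star A \<omega> \<eta> d_star (theta_inv \<eta> u) = theta_inv \<eta> (D_star u)"
    by (simp add: T_star_eq[OF v] theta_theta_inv[OF u])
  moreover have "ext_d A (theta_inv \<eta> (D_star u)) = theta_inv \<eta> (D_op A \<eta> (D_star u))"
    unfolding D_op_def by (rule theta_inv_theta[OF forms_ext_d[OF forms_theta_inv[OF forms_D_star'[OF u]]], symmetric])
  moreover have "T_star A \<omega> \<eta> d_star (ext_d A (theta_inv \<eta> u)) = theta_inv \<eta> (D_star (D_op A \<eta> u))"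
    unfolding T_star_eq[OF forms_ext_d[OF v]] D_op_def ..
  ultimately show ?thesis by (simp add: laplacian_def theta_inv_add)
qed

lemma laplacian_conjugate':
  assumes v: "v \<in> forms A k"
  shows "\<Delta>\<^sub>2 v = theta_inv \<eta> (\<Delta>\<^sub>1 (theta \<eta> v))"
  using laplacian_conjugate[OF forms_theta[OF v]] by (simp only: theta_inv_theta[OF v])

lemma forms_twisted_laplacian: "v \<in> forms A k \<Longrightarrow> \<Delta>\<^sub>2 v \<in> forms A k"
  by (subst laplacian_conjugate', assumption) (intro forms_theta_inv forms_laplacian forms_theta)

lemma bij_betw_theta: "bij_betw (theta \<eta>) (forms A k) (forms A k)"
  by (rule bij_betw_byWitness[where f' = "theta_inv \<eta>"])
    (auto simp: theta_inv_theta theta_theta_inv forms_theta forms_theta_inv)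

lemma bij_betw_theta_inv: "bij_betw (theta_inv \<eta>) (forms A k) (forms A k)"
  by (rule bij_betw_byWitness[where f' = "theta \<eta>"])
    (auto simp: theta_inv_theta theta_theta_inv forms_theta forms_theta_inv)

lemma theta_inv_diff: "theta_inv \<eta> (u - v) = theta_inv \<eta> u - theta_inv \<eta> v"
  by (simp add: theta_inv_def fun_diff_def diff_divide_distrib)

lemma theta_diff: "theta \<eta> (u - v) = theta \<eta> u - theta \<eta> v"
  by (simp add: theta_def fun_diff_def right_diff_distrib)

text \<open>\<theta> is a bijection of the smooth forms that commutes with scalars, so conjugation
  by it carries one operator minus \<open>l\<close> to the other minus \<open>l\<close> and
  preserves bijectivity.\<close>

lemma spectrum_eq: "spectrum A k \<Delta>\<^sub>1 = spectrum A k \<Delta>\<^sub>2"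
proof -
  have "bij_betw (\<lambda>u. \<Delta>\<^sub>1 u - cscale l u) (forms A k) (forms A k) \<longleftrightarrow>
      bij_betw (\<lambda>u. \<Delta>\<^sub>2 u - cscale l u) (forms A k) (forms A k)" for l
  proof
    assume "bij_betw (\<lambda>u. \<Delta>\<^sub>1 u - cscale l u) (forms A k) (forms A k)"
    from bij_betw_trans[OF bij_betw_trans[OF bij_betw_theta this] bij_betw_theta_inv]
    show "bij_betw (\<lambda>u. \<Delta>\<^sub>2 u - cscale l u) (forms A k) (forms A k)"
      by (rule bij_betw_cong[THEN iffD1, rotated])
        (simp add: laplacian_conjugate' theta_inv_diff theta_inv_cscale theta_inv_theta)
  next
    assume "bij_betw (\<lambda>u. \<Delta>\<^sub>2 u - cscale l u) (forms A k) (forms A k)"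
    from bij_betw_trans[OF bij_betw_trans[OF bij_betw_theta_inv this] bij_betw_theta]
    show "bij_betw (\<lambda>u. \<Delta>\<^sub>1 u - cscale l u) (forms A k) (forms A k)"
      by (rule bij_betw_cong[THEN iffD1, rotated])
        (simp add: laplacian_conjugate theta_diff theta_cscale theta_theta_inv forms_laplacian
          theta_theta_inv[OF forms_laplacian])
  qed
  then show ?thesis by (simp add: spectrum_def)
qed

lemma eigenspace_theta_inv:
  "bij_betw (theta_inv \<eta>) (eigenspace A k \<Delta>\<^sub>1 l) (eigenspace A k \<Delta>\<^sub>2 l)"
proof (rule bij_betw_byWitness[where f' = "theta \<eta>"])
  show "\<forall>u\<in>eigenspace A k \<Delta>\<^sub>1 l. theta \<eta> (theta_inv \<eta> u) = u"
    by (auto simp: eigenspace_def theta_theta_inv)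
  show "\<forall>v\<in>eigenspace A k \<Delta>\<^sub>2 l. theta_inv \<eta> (theta \<eta> v) = v"
    by (auto simp: eigenspace_def theta_inv_theta)
  show "theta_inv \<eta> ` eigenspace A k \<Delta>\<^sub>1 l \<subseteq> eigenspace A k \<Delta>\<^sub>2 l"
    by (auto simp: eigenspace_def forms_theta_inv laplacian_conjugate theta_inv_cscale)
  show "theta \<eta> ` eigenspace A k \<Delta>\<^sub>2 l \<subseteq> eigenspace A k \<Delta>\<^sub>1 l"
  proof clarify
    fix v assume "v \<in> eigenspace A k \<Delta>\<^sub>2 l"
    then have v: "v \<in> forms A k" "\<Delta>\<^sub>2 v = cscale l v" by (auto simp: eigenspace_def)
    have "\<Delta>\<^sub>1 (theta \<eta> v) = theta \<eta> (\<Delta>\<^sub>2 v)"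
      by (simp only: laplacian_conjugate'[OF v(1)] theta_theta_inv[OF forms_laplacian[OF forms_theta[OF v(1)]]])
    then show "theta \<eta> v \<in> eigenspace A k \<Delta>\<^sub>1 l"
      using v by (simp add: eigenspace_def forms_theta theta_cscale)
  qed
qed

lemma eigenvalues_eq: "eigenvalues A k \<Delta>\<^sub>1 = eigenvalues A k \<Delta>\<^sub>2"
proof -
  have "(\<exists>u\<in>eigenspace A k \<Delta>\<^sub>1 l. u \<noteq> 0) \<longleftrightarrow> (\<exists>u\<in>eigenspace A k \<Delta>\<^sub>2 l. u \<noteq> 0)" for l
  proof
    assume "\<exists>u\<in>eigenspace A k \<Delta>\<^sub>1 l. u \<noteq> 0"
    then obtain u where u: "u \<in> eigenspace A k \<Delta>\<^sub>1 l" "u \<noteq> 0" by blast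
    then have "theta \<eta> (theta_inv \<eta> u) = u" by (auto simp: eigenspace_def theta_theta_inv)
    then have "theta_inv \<eta> u \<noteq> 0" using u(2) theta_zero by metis
    then show "\<exists>u\<in>eigenspace A k \<Delta>\<^sub>2 l. u \<noteq> 0"
      using bij_betwE[OF eigenspace_theta_inv] u(1) by blast
  next
    assume "\<exists>u\<in>eigenspace A k \<Delta>\<^sub>2 l. u \<noteq> 0"
    then obtain v where v: "v \<in> eigenspace A k \<Delta>\<^sub>2 l" "v \<noteq> 0" by blast
    then obtain u where "u \<in> eigenspace A k \<Delta>\<^sub>1 l" "v = theta_inv \<eta> u"
      using bij_betw_imp_surj_on[OF eigenspace_theta_inv] by blast
    then show "\<exists>u\<in>eigenspace A k \<Delta>\<^sub>1 l. u \<noteq> 0"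
      using v(2) theta_inv_zero by metis
  qed
  then show ?thesis by (simp add: eigenvalues_def)
qed

end

lemma module_cscale: "module (cscale :: complex \<Rightarrow> ('x, 'n) form \<Rightarrow> ('x, 'n) form)"
  by unfold_locales (simp_all add: cscale_def plus_fun_def algebra_simps)

context twisted_adjoints
begin

lemma twisted_laplacian_add:
  assumes "u \<in> forms A k" "v \<in> forms A k"
  shows "\<Delta>\<^sub>2 (u + v) = \<Delta>\<^sub>2 u + \<Delta>\<^sub>2 v"
  unfolding laplacian_conjugate'[OF forms_add[OF assms]] laplacian_conjugate'[OF assms(1)]
    laplacian_conjugate'[OF assms(2)] theta_add
    laplacian_add[OF forms_theta[OF assms(1)] forms_theta[OF assms(2)]] theta_inv_add ..

lemma twisted_laplacian_cscale:
  assumes "u \<in> forms A k"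
  shows "\<Delta>\<^sub>2 (cscale b u) = cscale b (\<Delta>\<^sub>2 u)"
  unfolding laplacian_conjugate'[OF forms_cscale[OF assms]] laplacian_conjugate'[OF assms]
    theta_cscale laplacian_cscale[OF forms_theta[OF assms]] theta_inv_cscale ..

text \<open>Additivity and homogeneity of \<open>P\<close> are assumed on forms of degree
  \<open>k\<close> only, because differentiability and the adjunction relation give them for the
  Laplacians there.\<close>

lemma subspace_eigenspace:
  assumes add: "\<And>u v. u \<in> forms A k \<Longrightarrow> v \<in> forms A k \<Longrightarrow> P (u + v) = P u + P v"
    and scale: "\<And>b u. u \<in> forms A k \<Longrightarrow> P (cscale b u) = cscale b (P u)"
  shows "module.subspace cscale (eigenspace A k P l)"
  unfolding module.subspace_def[OF module_cscale]
proof (intro conjI ballI allI)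
  have "cscale 0 u = 0" for u :: "('x, 'n) form" by (simp add: cscale_def zero_fun_def)
  moreover have "cscale l 0 = (0 :: ('x, 'n) form)" by (simp add: cscale_def zero_fun_def)
  ultimately show "0 \<in> eigenspace A k P l"
    using scale[OF forms_zero, of 0] by (simp add: eigenspace_def forms_zero)
  show "u + v \<in> eigenspace A k P l" if "u \<in> eigenspace A k P l" "v \<in> eigenspace A k P l" for u v
    using that add module.scale_right_distrib[OF module_cscale, of l u v]
    by (simp add: eigenspace_def forms_add)
  show "cscale b u \<in> eigenspace A k P l" if "u \<in> eigenspace A k P l" for b u
    using that scale module.scale_left_commute[OF module_cscale, of l b u]
    by (simp add: eigenspace_def forms_cscale)
qed

lemma linear_iso_eigenspaces:
  "linear_iso (theta_inv \<eta>) (eigenspace A k \<Delta>\<^sub>1 l) (eigenspace A k \<Delta>\<^sub>2 l)"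
  unfolding linear_iso_def
  using subspace_eigenspace[of k \<Delta>\<^sub>1 l, OF laplacian_add laplacian_cscale]
    subspace_eigenspace[of k \<Delta>\<^sub>2 l, OF twisted_laplacian_add twisted_laplacian_cscale]
    eigenspace_theta_inv by (simp add: theta_inv_add theta_inv_cscale)

end

theorem corollary2p9:
  fixes X :: "'x topology"
    and A :: "('x, 'n::finite) chart set"
    and \<omega> :: "('x, 'n) form"
    and \<eta> :: "'x \<Rightarrow> real"
    and k :: nat
    and D_star d_star :: "('x, 'n) form \<Rightarrow> ('x, 'n) form"
  defines "\<Delta>\<^sub>1 \<equiv> laplacian (D_op A \<eta>) D_star"
    and "\<Delta>\<^sub>2 \<equiv> laplacian (ext_d A) (T_star A \<omega> \<eta> d_star)"
  assumes "complex_manifold X A"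
    and "compact_space X"
    and "hermitian_metric A \<omega>"
    and "smooth_fun A \<eta>"
    and "\<forall>x\<in>topspace X. 0 < \<eta> x"
    and "k \<le> 2 * CARD('n)"
    and "formal_adjoint A (l2 X A \<omega>) (D_op A \<eta>) D_star"
    and "formal_adjoint A (l2_twisted X A \<omega> \<eta>) (ext_d A) d_star"
  shows "\<Delta>\<^sub>1 ` forms A k \<subseteq> forms A k \<and> \<Delta>\<^sub>2 ` forms A k \<subseteq> forms A k \<and>
    (\<forall>u\<in>forms A k. \<Delta>\<^sub>1 u = theta \<eta> (\<Delta>\<^sub>2 (theta_inv \<eta> u))) \<and>
    spectrum A k \<Delta>\<^sub>1 = spectrum A k \<Delta>\<^sub>2 \<and>
    eigenvalues A k \<Delta>\<^sub>1 = eigenvalues A k \<Delta>\<^sub>2 \<and>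
    (\<forall>l\<in>eigenvalues A k \<Delta>\<^sub>1.
       linear_iso (theta_inv \<eta>) (eigenspace A k \<Delta>\<^sub>1 l) (eigenspace A k \<Delta>\<^sub>2 l))"
proof -
  interpret twisted_adjoints X A \<omega> \<eta> D_star d_star
    by unfold_locales (use assms in auto)
  have "\<Delta>\<^sub>1 u = theta \<eta> (\<Delta>\<^sub>2 (theta_inv \<eta> u))" if "u \<in> forms A k" for u
    unfolding \<Delta>\<^sub>1_def \<Delta>\<^sub>2_def laplacian_conjugate[OF that] theta_theta_inv[OF forms_laplacian[OF that]] ..
  from this[unfolded \<Delta>\<^sub>1_def \<Delta>\<^sub>2_def] show ?thesis
    unfolding \<Delta>\<^sub>1_def \<Delta>\<^sub>2_def
    by (intro conjI ballI image_subsetI forms_laplacian forms_twisted_laplacian spectrum_eq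
        eigenvalues_eq linear_iso_eigenspaces)
qed

end
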